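(* For every integer $p\ge3$, the Baumslag-Solitar group $BS(1,p)=\langle a,t\mid tat^{-1}=a^p\rangle$ (with the symmetrization of this presentation) satisfies an intrinsic tame filling inequality with respect to a function $\mathbb N[\frac14]\to\mathbb N[\frac14]$ that is Lipschitz equivalent to the exponential function $n\mapsto p^n$.
   Context: Conventions. $\mathbb N$ includes $0$, and $\mathbb N[\frac14]$ is the set of nonnegative integer multiples of $\frac14$. Functions $f,g$ on $\mathbb N[\frac14]$ with nonnegative real values are Lipschitz equivalent if there is a constant $C\in\mathbb N$ with $f(n)\le Cg(Cn+C)+C$ and $g(n)\le Cf(Cn+C)+C$ for all $n$. $A=\{a,a^{-1},t,t^{-1}\}$; $A^*$ is the set of words over $A$; $=_G$ denotes equality in $G=BS(1,p)$; $\epsilon$ is the identity. The symmetrization of a presentation has generating set closed under inversion and set $R$ of (nonempty) relators closed under inversion, cyclic conjugation, and free reduction. A van Kampen diagram over $\langle A\mid R\rangle$ for $w\in A^*$ with $w=_G\epsilon$ is a finite, planar, contractible combinatorial 2-complex $\Delta$ with edges directed and labeled by $A$, whose boundary is an edge path labeled $w$ starting at a basepoint vertex $*$ and reading counterclockwise, every 2-cell having boundary labeled by an element of $R$ (not necessarily reduced). Coarse distance in $\Delta$: for $q\in\Delta$, $\tilde d_\Delta( *,q)$ is the path metric distance in $\Delta^1$ if $q$ is a vertex; $\min\{\tilde d_\Delta( *,v)\mid v\in\partial e\}+\frac12$ if $q$ is in the interior of an edge $e$; and $\max\{\tilde d_\Delta( *,q')\mid q'\in Int(e),\ e\text{ an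 edge of }\partial\sigma\}-\frac14$ if $q$ is in the interior of a 2-cell $\sigma$. A van Kampen homotopy of $\Delta$ is a continuous $\Psi:\partial\Delta\times[0,1]\to\Delta$ with $\Psi(q,0)=*$, $\Psi(q,1)=q$ for $q\in\partial\Delta$; $\Psi( *,t)=*$ for all $t$; and $\Psi(q,t)\in\Delta^1$ for all $t$ if $q$ is a vertex of $\partial\Delta$. The group satisfies an intrinsic tame filling inequality for a nondecreasing $f:\mathbb N[\frac14]\to\mathbb N[\frac14]$ if every $w\in A^*$ with $w=_G\epsilon$ has a van Kampen diagram $\Delta$ and van Kampen homotopy $\Psi$ such that $\tilde d_\Delta( *,\Psi(q,s))\le f(\tilde d_\Delta( *,\Psi(q,t)))$ for all $q\in\partial\Delta$, $0\le s<t\le1$. *)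

theory Defs
  imports "HOL-Complex_Analysis.Complex_Analysis"
begin

section \<open>Words, symmetrized presentations, and the group of a presentation\<close>

text \<open>
  A letter is a pair: \<open>(x, True)\<close> stands for the generator \<open>x\<close> and
  \<open>(x, False)\<close> for its formal inverse, so the alphabet is closed under inversion.
\<close>

type_synonym 'g letter = "'g \<times> bool"

fun inv_letter :: "'g letter \<Rightarrow> 'g letter" where
  "inv_letter (x, b) = (x, \<not> b)"

definition inv_word :: "'g letter list \<Rightarrow> 'g letter list" where
  "inv_word w = rev (map inv_letter w)"

inductive_set symmetrization :: "'g letter list set \<Rightarrow> 'g letter list set"
  for R :: "'g letter list set" where
  base: "r \<in> R \<Longrightarrow> r \<noteq> [] \<Longrightarrow> r \<in> symmetrization R"
| inversion: "r \<in> symmetrization R \<Longrightarrow> inv_word r \<in> symmetrization R"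
| cyclic: "u @ v \<in> symmetrization R \<Longrightarrow> v @ u \<in> symmetrization R"
| reduction: "u @ [x, inv_letter x] @ v \<in> symmetrization R \<Longrightarrow> u @ v \<noteq> []
    \<Longrightarrow> u @ v \<in> symmetrization R"

text \<open>
  \<open>pres_eq R u v\<close> says that \<open>u\<close> and \<open>v\<close> represent the same element of the group
  presented by \<open>R\<close>: this group is the quotient of the monoid of words by this congruence.
\<close>

inductive pres_eq :: "'g letter list set \<Rightarrow> 'g letter list \<Rightarrow> 'g letter list \<Rightarrow> bool"
  for R :: "'g letter list set" where
  refl: "pres_eq R u u"
| sym: "pres_eq R u v \<Longrightarrow> pres_eq R v u"
| trans: "pres_eq R u v \<Longrightarrow> pres_eq R v w \<Longrightarrow> pres_eq R u w"
| cancel: "pres_eq R (u @ [x, inv_letter x] @ v) (u @ v)"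
| relator: "r \<in> R \<Longrightarrow> pres_eq R (u @ r @ v) (u @ v)"

datatype bs_gen = Gen_a | Gen_t

definition BS_relators :: "nat \<Rightarrow> bs_gen letter list set" where
  "BS_relators p =
     {[(Gen_t, True), (Gen_a, True), (Gen_t, False)] @ inv_word (replicate p (Gen_a, True))}"


section \<open>Finite planar combinatorial 2-complexes with labeled directed edges\<close>

text \<open>
  A complex is given with an embedding in the plane.  Since it is finite, its edges and 2-cells are
  indexed by natural numbers.  \<open>emap\<close> gives the characteristic map of each edge, on the
  unit interval and along the direction of the edge; \<open>fmap\<close> gives the characteristic map of
  each 2-cell, on the closed unit disc.  A dart \<open>(e, b)\<close> is the edge \<open>e\<close>
  traversed along (\<open>b = True\<close>) or against (\<open>b = False\<close>) its direction, and
  \<open>fbdry\<close> is the closed edge path along which a 2-cell is attached.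
\<close>

type_synonym dart = "nat \<times> bool"

record 'g diagram =
  verts :: "complex set"
  edges :: "nat set"
  emap  :: "nat \<Rightarrow> real \<Rightarrow> complex"
  elab  :: "nat \<Rightarrow> 'g letter"
  faces :: "nat set"
  fmap  :: "nat \<Rightarrow> complex \<Rightarrow> complex"
  fbdry :: "nat \<Rightarrow> dart list"
  basept :: complex

fun dart_pt :: "'g diagram \<Rightarrow> dart \<Rightarrow> real \<Rightarrow> complex" where
  "dart_pt D (e, b) s = emap D e (if b then s else 1 - s)"

fun dart_lab :: "'g diagram \<Rightarrow> dart \<Rightarrow> 'g letter" where
  "dart_lab D (e, b) = (if b then elab D e else inv_letter (elab D e))"

definition path_label :: "'g diagram \<Rightarrow> dart list \<Rightarrow> 'g letter list" where
  "path_label D ds = map (dart_lab D) ds"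

fun edge_path :: "'g diagram \<Rightarrow> complex \<Rightarrow> dart list \<Rightarrow> complex \<Rightarrow> bool" where
  "edge_path D u [] v \<longleftrightarrow> u \<in> verts D \<and> u = v"
| "edge_path D u (d # ds) v \<longleftrightarrow>
     fst d \<in> edges D \<and> dart_pt D d 0 = u \<and> edge_path D (dart_pt D d 1) ds v"

definition open_edge :: "'g diagram \<Rightarrow> nat \<Rightarrow> complex set" where
  "open_edge D e = emap D e ` {0<..<1}"

definition open_face :: "'g diagram \<Rightarrow> nat \<Rightarrow> complex set" where
  "open_face D f = fmap D f ` ball 0 1"

definition skeleton1 :: "'g diagram \<Rightarrow> complex set" where
  "skeleton1 D = verts D \<union> (\<Union>e\<in>edges D. open_edge D e)"

definition space_of :: "'g diagram \<Rightarrow> complex set" where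
  "space_of D = skeleton1 D \<union> (\<Union>f\<in>faces D. open_face D f)"

text \<open>
  With the unit circle cut at the powers of \<open>cis (2 * pi / n)\<close>, where \<open>n\<close> is
  the length of \<open>ds\<close>, the map \<open>F\<close> follows the darts of \<open>ds\<close> along the
  successive arcs.
\<close>

definition circle_follows :: "'g diagram \<Rightarrow> (complex \<Rightarrow> complex) \<Rightarrow> dart list \<Rightarrow> bool" where
  "circle_follows D F ds \<longleftrightarrow>
     (\<forall>k < length ds. \<forall>s\<in>{0..1}.
        F (cis (2 * pi * (real k + s) / real (length ds))) = dart_pt D (ds ! k) s)"

definition planar_complex :: "'g diagram \<Rightarrow> bool" where
  "planar_complex D \<longleftrightarrow>
     finite (verts D) \<and> finite (edges D) \<and> finite (faces D) \<and>
     (\<forall>e\<in>edges D. continuous_on {0..1} (emap D e) \<and> inj_on (emap D e) {0<..<1} \<and>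
        emap D e 0 \<in> verts D \<and> emap D e 1 \<in> verts D) \<and>
     (\<forall>f\<in>faces D. continuous_on (cball 0 1) (fmap D f) \<and> inj_on (fmap D f) (ball 0 1) \<and>
        fbdry D f \<noteq> [] \<and> (\<exists>v. edge_path D v (fbdry D f) v) \<and>
        circle_follows D (fmap D f) (fbdry D f)) \<and>
     (\<forall>e\<in>edges D. verts D \<inter> open_edge D e = {}) \<and>
     (\<forall>f\<in>faces D. skeleton1 D \<inter> open_face D f = {}) \<and>
     disjoint_family_on (open_edge D) (edges D) \<and>
     disjoint_family_on (open_face D) (faces D)"


section \<open>Van Kampen diagrams\<close>

text \<open>
  \<open>ccw_boundary D ds\<close>: the edge path \<open>ds\<close> from the basepoint is the boundary of
  \<open>D\<close>, read counterclockwise.  The map \<open>F\<close> embeds a half-open annulus in the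
  complement of the diagram, winding once counterclockwise around it, and attaches the inner circle
  of the annulus along \<open>ds\<close>; so \<open>ds\<close> is the path met on going once around
  the diagram just outside it, also where the diagram is not a disc (where, for instance, edges are
  passed on both sides).  The clause on \<open>[]\<close> is the one-point diagram.
\<close>

definition ccw_boundary :: "'g diagram \<Rightarrow> dart list \<Rightarrow> bool" where
  "ccw_boundary D ds \<longleftrightarrow>
     edge_path D (basept D) ds (basept D) \<and>
     (\<exists>F. continuous_on {z. 1 \<le> norm z \<and> norm z \<le> 2} F \<and>
          inj_on F {z. 1 < norm z \<and> norm z \<le> 2} \<and>
          F ` {z. 1 < norm z \<and> norm z \<le> 2} \<inter> space_of D = {} \<and>
          winding_number (F \<circ> circlepath 0 2) (basept D) = 1 \<and>
          circle_follows D F ds \<and>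
          (ds = [] \<longrightarrow> (\<forall>z. norm z = 1 \<longrightarrow> F z = basept D)))"

definition van_kampen_diagram ::
    "'g letter list set \<Rightarrow> 'g letter list \<Rightarrow> 'g diagram \<Rightarrow> bool" where
  "van_kampen_diagram R w D \<longleftrightarrow>
     planar_complex D \<and> contractible (space_of D) \<and> basept D \<in> verts D \<and>
     (\<forall>f\<in>faces D. path_label D (fbdry D f) \<in> R) \<and>
     (\<exists>ds. ccw_boundary D ds \<and> path_label D ds = w)"

definition vert_dist :: "'g diagram \<Rightarrow> complex \<Rightarrow> nat" where
  "vert_dist D v = (LEAST n. \<exists>ds. edge_path D (basept D) ds v \<and> length ds = n)"

definition edge_dist :: "'g diagram \<Rightarrow> nat \<Rightarrow> real" where
  "edge_dist D e = Min ((\<lambda>v. real (vert_dist D v)) ` {emap D e 0, emap D e 1}) + 1/2"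

definition face_dist :: "'g diagram \<Rightarrow> nat \<Rightarrow> real" where
  "face_dist D f = Max (edge_dist D ` fst ` set (fbdry D f)) - 1/4"

definition coarse_dist :: "'g diagram \<Rightarrow> complex \<Rightarrow> real" where
  "coarse_dist D q =
     (if q \<in> verts D then real (vert_dist D q)
      else if q \<in> skeleton1 D then edge_dist D (THE e. e \<in> edges D \<and> q \<in> open_edge D e)
      else face_dist D (THE f. f \<in> faces D \<and> q \<in> open_face D f))"

definition bdry :: "'g diagram \<Rightarrow> complex set" where
  "bdry D = frontier (space_of D)"

definition van_kampen_homotopy :: "'g diagram \<Rightarrow> (complex \<times> real \<Rightarrow> complex) \<Rightarrow> bool" where
  "van_kampen_homotopy D \<Psi> \<longleftrightarrow>
     continuous_on (bdry D \<times> {0..1}) \<Psi> \<and>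
     \<Psi> ` (bdry D \<times> {0..1}) \<subseteq> space_of D \<and>
     (\<forall>q\<in>bdry D. \<Psi> (q, 0) = basept D \<and> \<Psi> (q, 1) = q) \<and>
     (\<forall>t\<in>{0..1}. \<Psi> (basept D, t) = basept D) \<and>
     (\<forall>q\<in>bdry D \<inter> verts D. \<forall>t\<in>{0..1}. \<Psi> (q, t) \<in> skeleton1 D)"


section \<open>Tame filling inequalities\<close>

definition quarter_nats :: "real set" where
  "quarter_nats = range (\<lambda>k::nat. real k / 4)"

definition lipschitz_equivalent :: "(real \<Rightarrow> real) \<Rightarrow> (real \<Rightarrow> real) \<Rightarrow> bool" where
  "lipschitz_equivalent f g \<longleftrightarrow>
     (\<exists>C::nat. \<forall>n\<in>quarter_nats.
        f n \<le> real C * g (real C * n + real C) + real C \<and>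
        g n \<le> real C * f (real C * n + real C) + real C)"

definition intrinsic_tame_filling :: "'g letter list set \<Rightarrow> (real \<Rightarrow> real) \<Rightarrow> bool" where
  "intrinsic_tame_filling R f \<longleftrightarrow>
     f ` quarter_nats \<subseteq> quarter_nats \<and> mono_on quarter_nats f \<and>
     (\<forall>w. pres_eq R w [] \<longrightarrow>
        (\<exists>D \<Psi>. van_kampen_diagram R w D \<and> van_kampen_homotopy D \<Psi> \<and>
           (\<forall>q\<in>bdry D. \<forall>s t. 0 \<le> s \<and> s < t \<and> t \<le> 1 \<longrightarrow>
              coarse_dist D (\<Psi> (q, s)) \<le> f (coarse_dist D (\<Psi> (q, t))))))"

end

theory Submission imports Defs begin

text \<open>
  Every element of \<open>BS(1,p)\<close> has a normal form \<open>t\<^sup>-\<^sup>i a\<^sup>k t\<^sup>j\<close>; these normal forms are closed under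
  prefixes, and their length is at most exponential in the word length of the element.  Given a word
  \<open>w = x\<^sub>1 ... x\<^sub>n\<close> that represents the identity, let \<open>y\<^sub>m\<close> be the normal form of its prefix of
  length \<open>m\<close>.  A diagram for \<open>w\<close> is grown from the point (the diagram for \<open>y\<^sub>n\<close>) by gluing
  2-cells to its outside, so that the boundary word runs through \<open>y\<^sub>m x\<^sub>m\<^sub>+\<^sub>1 ... x\<^sub>n\<close> for
  \<open>m = n, ..., 0\<close>.  Every new 2-cell retracts onto the old part of its boundary; composing the
  retractions contracts the diagram to the basepoint.  Along this contraction the points stay near
  vertices whose normal forms are no longer than those near the starting point, up to a constant, so
  their distance from the basepoint is at most exponential in the distance of the starting point.

  All new cells are drawn in a collar of the diagram, that is, in the annulus which witnesses that its
  boundary is read counterclockwise.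
\<close>

section \<open>Chords of the disc\<close>

text \<open>The inequality compares two points of one track, and distance is handled from its two
  sides by different means. From below: \<open>gp\<close> labels points by group elements, and a
  path from the basepoint spells a word for \<open>gp q\<close>, so the word norm of
  \<open>gp q\<close> is at most the coarse distance of \<open>q\<close> plus 1. From above: the
  weights in \<open>bw\<close> bound the distance along whole tracks. So distances are only
  estimated, never computed, and it suffices to bound later positions by \<open>Lim\<close> of the
  earlier label. Vertices of one 2-cell differ by a word of bounded length, so
  \<open>nf_length\<close> at one of them is at most exponential in the word norm of any other.

  The weights dictate the shape of a gluing step. The vertices of the new side \<open>B\<close>
  slide back along \<open>B\<close>, so normal forms must get longer along it; only its last edge
  crosses the cell, and it must dominate all of \<open>A\<close>. The cells of t a t^-1 = a^p meet
  this if they are attached towards the longer normal forms. Free cancellation is no relator, so a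
  spike has to be made of 2-cells as well.\<close>

lemma inv_letter_inv_letter [simp]: "inv_letter (inv_letter x) = x"
  by (cases x) simp

text \<open>A continuous map from a compact set to a Hausdorff space is closed, hence a quotient map
  onto its image. \<open>fm\<close>, \<open>retr\<close> and \<open>outer\<close> are known only
  through parametrizations and get their continuity from here.\<close>

lemma continuous_on_compact_quotient:
  fixes f :: "'a::topological_space \<Rightarrow> 'b::t2_space" and g :: "'b \<Rightarrow> 'c::topological_space"
  assumes "compact K" "continuous_on K f" "continuous_on K (g \<circ> f)"
  shows "continuous_on (f ` K) g"
proof -
  have cl: "closed (f ` K)"
    using assms compact_continuous_image compact_imp_closed by blast
  have "closed (g -` C \<inter> f ` K)" if "closed C" for C
  proof -
    have "closedin (top_of_set K) (K \<inter> (g \<circ> f) -` C)"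
      using assms(3) that by (simp add: continuous_on_closed_invariant continuous_closedin_preimage)
    hence "compact (K \<inter> (g \<circ> f) -` C)"
      using assms(1) closedin_compact by blast
    moreover have "continuous_on (K \<inter> (g \<circ> f) -` C) f"
      using assms(2) continuous_on_subset by blast
    ultimately have "compact (f ` (K \<inter> (g \<circ> f) -` C))"
      by (rule compact_continuous_image[rotated])
    moreover have "f ` (K \<inter> (g \<circ> f) -` C) = g -` C \<inter> f ` K"
      by auto
    ultimately show ?thesis
      by (simp add: compact_imp_closed)
  qed
  thus ?thesis
    using continuous_on_closed_vimage[OF cl] by blast
qed

text \<open>The segment over \<open>x\<close> goes to the chord that joins the points at angles
  \<open>-2 pi x l1/(l1+l2)\<close> and \<open>2 pi x l2/(l1+l2)\<close>; the chords for \<open>x = 0\<close> and \<open>x = 1\<close> are points.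
  If \<open>l1 = 0\<close>, all chords start at 1.\<close>

definition chord_map :: "nat \<Rightarrow> nat \<Rightarrow> real \<times> real \<Rightarrow> complex" where
  "chord_map l1 l2 = (\<lambda>(x, u). cis (pi * ((real l2 - real l1) / (real l1 + real l2)) * x)
      * Complex (cos (pi * x)) (sin (pi * x) * (2 * u - 1)))"

abbreviation unit_square :: "(real \<times> real) set" where
  "unit_square \<equiv> {0..1} \<times> {0..1}"

lemma continuous_on_chord_map: "continuous_on UNIV (chord_map l1 l2)"
  unfolding chord_map_def case_prod_unfold cis_conv_exp Complex_eq
  by (intro continuous_intros)

lemma chord_map_1:
  assumes "l2 \<ge> 1"
  shows "chord_map l1 l2 (x, 1) = cis (2 * pi * (real l2 * x / (real l1 + real l2)))"
proof -
  have "Complex (cos (pi * x)) (sin (pi * x)) = cis (pi * x)"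
    by (simp add: complex_eq_iff)
  moreover have "pi * ((real l2 - real l1) / (real l1 + real l2)) * x + pi * x
      = 2 * pi * (real l2 * x / (real l1 + real l2))"
    using assms by (simp add: field_simps)
  ultimately show ?thesis
    by (simp add: chord_map_def cis_mult)
qed

lemma chord_map_0:
  assumes "l2 \<ge> 1"
  shows "chord_map l1 l2 (x, 0) = cis (- (2 * pi * (real l1 * x / (real l1 + real l2))))"
proof -
  have "Complex (cos (pi * x)) (- sin (pi * x)) = cis (- (pi * x))"
    by (simp add: complex_eq_iff)
  moreover have "pi * ((real l2 - real l1) / (real l1 + real l2)) * x - pi * x
      = - (2 * pi * (real l1 * x / (real l1 + real l2)))"
    using assms by (simp add: field_simps)
  ultimately show ?thesis
    by (simp add: chord_map_def cis_mult)
qed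

lemma norm_chord_map:
  "norm (chord_map l1 l2 (x, u)) ^ 2 = 1 - (sin (pi * x))\<^sup>2 * (4 * u * (1 - u))"
proof -
  have "norm (chord_map l1 l2 (x, u)) ^ 2 = (cos (pi * x))\<^sup>2 + (sin (pi * x))\<^sup>2 * (2 * u - 1)\<^sup>2"
    by (simp add: chord_map_def norm_mult cmod_power2 power_mult_distrib)
  also have "\<dots> = 1 - (sin (pi * x))\<^sup>2 * (4 * u * (1 - u))"
    by (simp add: cos_squared_eq algebra_simps power2_eq_square)
  finally show ?thesis .
qed

lemma norm_chord_map_less:
  assumes "0 < x" "x < 1" "0 < u" "u < 1"
  shows "norm (chord_map l1 l2 (x, u)) < 1"
proof -
  have "sin (pi * x) > 0"
    using assms by (intro sin_gt_zero) auto
  hence "norm (chord_map l1 l2 (x, u)) ^ 2 < 1\<^sup>2"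
    using assms by (simp add: norm_chord_map)
  thus ?thesis
    by (rule power_less_imp_less_base) simp
qed

lemma norm_chord_map_le:
  assumes "0 \<le> u" "u \<le> 1"
  shows "norm (chord_map l1 l2 (x, u)) \<le> 1"
proof -
  have "norm (chord_map l1 l2 (x, u)) ^ 2 \<le> 1\<^sup>2"
    using assms by (simp add: norm_chord_map)
  thus ?thesis
    by (rule power2_le_imp_le) simp
qed

lemma norm_chord_map_eq_1:
  assumes "x = 0 \<or> x = 1 \<or> u = 0 \<or> u = 1"
  shows "norm (chord_map l1 l2 (x, u)) = 1"
proof -
  have "norm (chord_map l1 l2 (x, u)) ^ 2 = 1"
    using assms by (auto simp: norm_chord_map)
  thus ?thesis
    by (simp add: power2_eq_1_iff) (metis norm_not_less_zero neg_less_0_iff_less zero_less_one)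
qed

text \<open>The chord with index \<open>x'\<close> cuts off a half-plane that contains every chord with a
  smaller index.\<close>

lemma chord_map_neq:
  assumes "0 < x" "x < x'" "x' < 1" "0 < u" "u < 1" "l2 \<ge> 1"
  shows "chord_map l1 l2 (x, u) \<noteq> chord_map l1 l2 (x', u')"
proof
  assume eq: "chord_map l1 l2 (x, u) = chord_map l1 l2 (x', u')"
  define q where "q = (real l2 - real l1) / (real l1 + real l2)"
  have q: "-1 \<le> q" "q \<le> 1"
    using assms by (auto simp: q_def field_simps)
  \<comment> \<open>The point as a convex combination of the two ends of its chord.\<close>
  have chord: "chord_map l1 l2 (y, v) = of_real v * cis (pi * (q + 1) * y) + of_real (1 - v) * cis (pi * (q - 1) * y)" for y v
  proof -
    have "cis (pi * (q + 1) * y) = cis (pi * q * y) * cis (pi * y)"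
      "cis (pi * (q - 1) * y) = cis (pi * q * y) * cis (- (pi * y))"
      by (simp_all only: cis_mult) (simp_all add: algebra_simps)
    moreover have "Complex (cos (pi * y)) (sin (pi * y) * (2 * v - 1))
        = of_real v * cis (pi * y) + of_real (1 - v) * cis (- (pi * y))"
      by (simp add: complex_eq_iff algebra_simps)
    ultimately have "of_real v * cis (pi * (q + 1) * y) + of_real (1 - v) * cis (pi * (q - 1) * y)
        = cis (pi * q * y) * Complex (cos (pi * y)) (sin (pi * y) * (2 * v - 1))"
      by (simp only:) (simp only: ring_distribs mult.left_commute)
    thus ?thesis
      by (simp add: chord_map_def q_def)
  qed
  \<comment> \<open>\<open>rr\<close> measures along the normal of chord \<open>x'\<close>, on which
    it has the constant value \<open>cos (pi * x')\<close>. It remains to see that both ends of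
    chord \<open>x\<close> have at least this value, and one of them more.\<close>
  define rr where "rr z = Re (z * cis (- (pi * q * x')))" for z
  have rr1: "rr (chord_map l1 l2 (y, v)) = v * cos (pi * (q + 1) * y - pi * q * x')
      + (1 - v) * cos (pi * (q - 1) * y - pi * q * x')" for y v
    unfolding chord rr_def distrib_right mult.assoc[of "of_real _"] cis_mult by simp
  have r': "rr (chord_map l1 l2 (x', u')) = cos (pi * x')"
  proof -
    have "pi * (q + 1) * x' - pi * q * x' = pi * x'" "pi * (q - 1) * x' - pi * q * x' = - (pi * x')"
      by (simp_all add: algebra_simps)
    thus ?thesis
      unfolding rr1 by (simp only: cos_minus) (simp add: algebra_simps)
  qed
  have cosle: "cos (pi * x') < cos t" if "\<bar>t\<bar> < pi * x'" for t
  proof -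
    have "cos (pi * x') < cos \<bar>t\<bar>"
      using that assms by (intro cos_monotone_0_pi) (auto simp: )
    thus ?thesis by simp
  qed
  have cosle': "cos (pi * x') \<le> cos t" if "\<bar>t\<bar> \<le> pi * x'" for t
    using cosle[of t] that by (metis cos_abs_real order_le_less)
  have a1: "\<bar>(q + 1) * x - q * x'\<bar> \<le> x'"
  proof -
    have "(q + 1) * x \<le> (q + 1) * x'" using q assms by (intro mult_left_mono) auto
    moreover have "(q + 1) * x \<ge> 0" using q assms by simp
    moreover have "q * x' \<le> x'" using q assms by (simp add: mult_le_cancel_right1)
    ultimately show ?thesis unfolding abs_le_iff distrib_right by linarith
  qed
  have a2: "\<bar>(q - 1) * x - q * x'\<bar> \<le> x'"
  proof -
    have "(1 - q) * x \<le> (1 - q) * x'" using q assms by (intro mult_left_mono) auto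
    moreover have "(1 - q) * x \<ge> 0" using q assms by simp
    moreover have "- q * x' \<le> x'" using q assms mult_right_mono[of "- q" 1 x'] by simp
    ultimately show ?thesis unfolding abs_le_iff left_diff_distrib by linarith
  qed
  \<comment> \<open>For \<open>l1 = 0\<close> all chords share their lower end, so strictness is
    claimed only for one end, the one that moves faster.\<close>
  have a3: "\<bar>(q + 1) * x - q * x'\<bar> < x' \<or> \<bar>(q - 1) * x - q * x'\<bar> < x'"
  proof (cases "q \<ge> 0")
    case True
    have "(q + 1) * x < (q + 1) * x'" using True assms by (intro mult_strict_left_mono) auto
    moreover have "(q + 1) * x > 0" using True assms by simp
    moreover have "q * x' \<le> x'" using q assms by (simp add: mult_le_cancel_right1)
    ultimately show ?thesis unfolding abs_less_iff distrib_right by linarith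
  next
    case False
    have "(1 - q) * x < (1 - q) * x'" using False assms by (intro mult_strict_left_mono) auto
    moreover have "(1 - q) * x > 0" using False assms by simp
    moreover have "- q * x' \<le> x'" using q assms mult_right_mono[of "- q" 1 x'] by simp
    ultimately show ?thesis unfolding abs_less_iff left_diff_distrib by linarith
  qed
  have pi1: "\<bar>pi * c * x - pi * q * x'\<bar> = pi * \<bar>c * x - q * x'\<bar>" for c
  proof -
    have "pi * c * x - pi * q * x' = pi * (c * x - q * x')" by (simp add: algebra_simps)
    thus ?thesis by (simp only: abs_mult) simp
  qed
  define c1 where "c1 = cos (pi * (q + 1) * x - pi * q * x')"
  define c2 where "c2 = cos (pi * (q - 1) * x - pi * q * x')"
  have "c1 \<ge> cos (pi * x')" "c2 \<ge> cos (pi * x')"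
    unfolding c1_def c2_def by (intro cosle'; simp add: pi1 a1 a2)+
  moreover have "c1 > cos (pi * x') \<or> c2 > cos (pi * x')"
    using a3 cosle[of "pi * (q + 1) * x - pi * q * x'"] cosle[of "pi * (q - 1) * x - pi * q * x'"]
    unfolding c1_def c2_def pi1 using mult_strict_left_mono[OF _ pi_gt_zero] by blast
  moreover have "0 < 1 - u" using assms by simp
  ultimately have "u * c1 + (1 - u) * c2 > u * cos (pi * x') + (1 - u) * cos (pi * x')"
    using assms(4) by (elim disjE) (intro add_less_le_mono add_le_less_mono mult_strict_left_mono mult_left_mono; simp)+
  moreover have "u * c1 + (1 - u) * c2 = cos (pi * x')"
    using eq r' rr1 c1_def c2_def by metis
  ultimately show False
    by (simp add: algebra_simps)
qed

lemma inj_on_chord_map: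
  assumes "l2 \<ge> 1"
  shows "inj_on (chord_map l1 l2) ({0<..<1} \<times> {0<..<1})"
proof (rule inj_onI, clarify)
  fix x u x' u' assume *: "chord_map l1 l2 (x, u) = chord_map l1 l2 (x', u')"
    "x \<in> {0<..<1}" "x' \<in> {0<..<1}" "u \<in> {0<..<1}" "u' \<in> {0<..<1::real}"
  have xx: "x = x'"
    using chord_map_neq[of x x' u l2 l1 u'] chord_map_neq[of x' x u' l2 l1 u] assms *
    by (cases x x' rule: linorder_cases) auto
  have "sin (pi * x) > 0"
    using * by (intro sin_gt_zero) auto
  moreover have "sin (pi * x) * (2 * u - 1) = sin (pi * x) * (2 * u' - 1)"
    using *(1) by (simp add: chord_map_def xx)
  ultimately show "x = x' \<and> u = u'"
    using xx by simp
qed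

lemma chord_map_image_square:
  assumes "l2 \<ge> 1"
  shows "chord_map l1 l2 ` ({0<..<1} \<times> {0<..<1}) = ball 0 1"
proof
  show "chord_map l1 l2 ` ({0<..<1} \<times> {0<..<1}) \<subseteq> ball 0 1"
    using norm_chord_map_less by auto
  show "ball 0 1 \<subseteq> chord_map l1 l2 ` ({0<..<1} \<times> {0<..<1})"
  proof
    fix z :: complex assume z: "z \<in> ball 0 1"
    define q where "q = (real l2 - real l1) / (real l1 + real l2)"
    \<comment> \<open>\<open>r x\<close> is the signed distance of \<open>z\<close> from the line of
      the chord with index \<open>x\<close>; it changes sign as the chord moves across the
      disc.\<close>
    define r where "r x = Re (z * cis (- (pi * q * x))) - cos (pi * x)" for x
    have "\<bar>Re (z * cis t)\<bar> < 1" for t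
      using abs_Re_le_cmod[of "z * cis t"] z by (simp add: norm_mult)
    note rz = this
    have "r 0 \<le> 0" "r 1 \<ge> 0"
      using rz[of 0] rz[of "- (pi * q)"] by (auto simp: r_def abs_less_iff)
    moreover have "continuous_on {0..1} r"
      unfolding r_def cis_conv_exp by (intro continuous_intros)
    ultimately obtain x where x: "0 \<le> x" "x \<le> 1" "r x = 0"
      using IVT'[of r 0 0 1] by auto
    moreover have "x \<noteq> 0" "x \<noteq> 1"
      using x rz[of 0] rz[of "- (pi * q)"] by (auto simp: r_def abs_less_iff)
    ultimately have x01: "0 < x" "x < 1"
      by auto
    define w where "w = z * cis (- (pi * q * x))"
    have rw: "Re w = cos (pi * x)"
      using x by (simp add: w_def r_def)
    have sp: "sin (pi * x) > 0"
      using x01 by (intro sin_gt_zero) auto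
    have "norm w < 1"
      using z by (simp add: w_def norm_mult)
    hence "norm w ^ 2 < 1"
      by (simp add: power_less_one_iff)
    hence "(Im w)\<^sup>2 < (sin (pi * x))\<^sup>2"
      by (simp add: cmod_power2 rw sin_squared_eq)
    hence iw: "\<bar>Im w\<bar> < sin (pi * x)"
      using sp abs_le_square_iff[of "sin (pi * x)" "Im w"] by linarith
    define u where "u = (Im w / sin (pi * x) + 1) / 2"
    have u: "0 < u" "u < 1"
      using iw sp by (auto simp: u_def field_simps abs_less_iff)
    have "sin (pi * x) * (2 * u - 1) = Im w"
      using sp by (simp add: u_def field_simps)
    hence "Complex (cos (pi * x)) (sin (pi * x) * (2 * u - 1)) = w"
      using rw by (simp add: complex_eq_iff)
    hence "chord_map l1 l2 (x, u) = cis (pi * q * x) * w"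
      by (simp add: chord_map_def q_def)
    also have "\<dots> = z"
      by (simp add: w_def cis_mult mult.left_commute)
    finally show "z \<in> chord_map l1 l2 ` ({0<..<1} \<times> {0<..<1})"
      using x01 u by (intro image_eqI[of _ _ "(x, u)"]) auto
  qed
qed

lemma cis_2pi_eqD:
  assumes "cis (2 * pi * s) = cis (2 * pi * t)" "\<bar>s - t\<bar> < 1"
  shows "s = t"
proof -
  have "cos (2 * pi * s - 2 * pi * t) = (cos (2 * pi * s))\<^sup>2 + (sin (2 * pi * s))\<^sup>2"
    using assms(1) by (simp add: complex_eq_iff cos_diff power2_eq_square)
  hence "cos (2 * pi * s - 2 * pi * t) = 1"
    by simp
  then obtain k :: int where k: "2 * pi * s - 2 * pi * t = of_int k * (2 * pi)"
    by (auto simp only: cos_one_2pi_int mult_ac)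
  hence "(s - t) * (2 * pi) = of_int k * (2 * pi)"
    by (simp add: algebra_simps)
  hence "s - t = of_int k"
    by simp
  thus ?thesis
    using assms(2) by (simp flip: of_int_abs)
qed

lemma cis_2pi_eq_cases:
  assumes "cis (2 * pi * s) = cis (2 * pi * t)" "\<bar>s - t\<bar> \<le> 1"
  shows "s = t \<or> s = t + 1 \<or> t = s + 1"
  using cis_2pi_eqD[OF assms(1)] assms(2) by linarith

text \<open>\<open>chord_map\<close> is injective inside the square, and on the boundary it glues
  only what \<open>side\<close> and \<open>bot\<close> allow: the vertical sides collapse, and for
  \<open>l1 = 0\<close> so does the bottom. Hence \<open>g\<close> factors through the disc.\<close>

lemma chord_map_fibre:
  assumes l2: "l2 \<ge> 1"
    and side: "\<And>x u. x \<in> {0,1} \<Longrightarrow> u \<in> {0..1} \<Longrightarrow> g (x, u) = g (x, 0)"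
    and bot: "\<And>x. l1 = 0 \<Longrightarrow> x \<in> {0..1} \<Longrightarrow> g (x, 0) = g (0, 0)"
    and q: "q \<in> unit_square" "q' \<in> unit_square" and eq: "chord_map l1 l2 q = chord_map l1 l2 q'"
  shows "g q = g q'"
proof -
  define bd where "bd q \<longleftrightarrow> fst q \<in> {0,1} \<or> snd q \<in> {0,1}" for q :: "real \<times> real"
  have bd_norm: "bd q \<longleftrightarrow> norm (chord_map l1 l2 q) = 1" if "q \<in> unit_square" for q
  proof -
    obtain x u where xu: "q = (x, u)" by fastforce
    have "0 < x \<and> x < 1 \<and> 0 < u \<and> u < 1" if "\<not> bd q"
      using that \<open>q \<in> unit_square\<close> by (auto simp: xu bd_def less_le)
    thus ?thesis
      using norm_chord_map_eq_1[of x u l1 l2] norm_chord_map_less[of x u l1 l2]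
      by (cases "bd q") (auto simp: xu bd_def)
  qed
  define m where "m = real l1 + real l2"
  have m: "m > 0" using l2 by (simp add: m_def)
  define top where "top q \<longleftrightarrow> snd q = 1" for q :: "real \<times> real"
  have red: "\<exists>x\<in>{0..1}. \<exists>u\<in>{0,1}. g q = g (x, u) \<and> chord_map l1 l2 q = chord_map l1 l2 (x, u)"
    if "q \<in> unit_square" "bd q" for q
  proof (cases "snd q \<in> {0,1}")
    case True
    thus ?thesis using that by (intro bexI[of _ "fst q"] bexI[of _ "snd q"]) auto
  next
    case False
    have "chord_map l1 l2 (fst q, snd q) = chord_map l1 l2 (fst q, 0)"
      using that False by (auto simp: bd_def chord_map_def)
    thus ?thesis
      using side[of "fst q" "snd q"] that False by (intro bexI[of _ "fst q"] bexI[of _ 0]) (auto simp: bd_def)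
  qed
  have main: "g (x, u) = g (x', u')"
    if x: "x \<in> {0..1}" "x' \<in> {0..1}" and u: "u \<in> {0,1}" "u' \<in> {0,1}"
      and e: "chord_map l1 l2 (x, u) = chord_map l1 l2 (x', u')" and le: "u \<ge> u'" for x x' u u'
  proof -
    consider "u = 1" "u' = 1" | "u = 1" "u' = 0" | "u = 0" "u' = 0"
      using u le by auto
    thus ?thesis
    proof cases
      case 1
      have a: "\<bar>l2 * x / m - l2 * x' / m\<bar> = l2 / m * \<bar>x - x'\<bar>"
        using m by (simp add: abs_mult flip: right_diff_distrib diff_divide_distrib)
      have lm: "l2 / m \<le> 1" "l2 / m > 0" using m l2 by (auto simp: m_def)
      have xx: "\<bar>x - x'\<bar> \<le> 1" using x by auto
      have c: "cis (2 * pi * (l2 * x / m)) = cis (2 * pi * (l2 * x' / m))"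
        using e by (simp add: 1 chord_map_1[OF l2] m_def)
      show ?thesis
      proof (cases "l2 / m * \<bar>x - x'\<bar> < 1")
        case True
        hence "l2 * x / m = l2 * x' / m"
          using cis_2pi_eqD[OF c] a by simp
        thus ?thesis using m l2 1 by auto
      next
        case False
        have "l2 / m * \<bar>x - x'\<bar> \<le> 1 * \<bar>x - x'\<bar>" using lm by (intro mult_right_mono) auto
        hence "1 \<le> 1 * \<bar>x - x'\<bar>" using False by (meson linorder_not_less order_trans)
        hence ax: "\<bar>x - x'\<bar> = 1" using xx by simp
        hence "l2 / m \<ge> 1" using False by simp
        \<comment> \<open>The ends of the top meet only if it covers the whole circle; then they are
          joined through the collapsed sides and bottom.\<close>
        hence l1: "l1 = 0" using m by (simp add: m_def field_simps)
        have "{x, x'} = {0, 1}" using ax x by (auto simp: abs_if split: if_splits)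
        moreover have "g (0, 1) = g (1, 1)"
          using side[of 0 1] side[of 1 1] bot[OF l1, of 1] by simp
        ultimately show ?thesis using 1 by (auto simp: doubleton_eq_iff)
      qed
    next
      case 2
      have c: "cis (2 * pi * (l2 * x / m)) = cis (2 * pi * (- (l1 * x' / m)))"
        using e by (simp add: 2 chord_map_1[OF l2] chord_map_0[OF l2] m_def)
      have nn: "l2 * x / m \<ge> 0" "l1 * x' / m \<ge> 0" using x m by auto
      have "l2 * x \<le> l2" "l1 * x' \<le> l1" using x by (auto intro: mult_left_le)
      hence le1: "l2 * x / m + l1 * x' / m \<le> 1"
        using m by (simp add: m_def flip: add_divide_distrib)
      hence "l2 * x / m = - (l1 * x' / m) \<or> l2 * x / m = - (l1 * x' / m) + 1"
        using cis_2pi_eq_cases[OF c] nn by auto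
      thus ?thesis
      proof
        assume "l2 * x / m = - (l1 * x' / m)"
        hence "l2 * x / m = 0" "l1 * x' / m = 0" using nn by linarith+
        hence "x = 0" "l1 = 0 \<or> x' = 0" using m l2 by auto
        thus ?thesis using 2 side[of 0 1] bot[of x'] x by auto
      next
        assume "l2 * x / m = - (l1 * x' / m) + 1"
        hence "(l2 * x + l1 * x') / m = 1" by (simp add: add_divide_distrib)
        hence "l2 * x + l1 * x' = l1 + l2" using m by (simp add: m_def)
        hence "l2 * x = l2" "l1 * x' = l1" using \<open>l2 * x \<le> l2\<close> \<open>l1 * x' \<le> l1\<close> by linarith+
        hence "x = 1" "l1 = 0 \<or> x' = 1" using l2 by auto
        thus ?thesis using 2 side[of 1 1] bot[of x'] bot[of 1] x by auto
      qed
    next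
      case 3
      have c: "cis (2 * pi * (- (l1 * x / m))) = cis (2 * pi * (- (l1 * x' / m)))"
        using e by (simp add: 3 chord_map_0[OF l2] m_def)
      have a: "\<bar>- (l1 * x / m) - - (l1 * x' / m)\<bar> = l1 / m * \<bar>x - x'\<bar>"
      proof -
        have "- (l1 * x / m) - - (l1 * x' / m) = - (l1 / m * (x - x'))"
          by (simp add: algebra_simps diff_divide_distrib)
        thus ?thesis using m by (simp only: abs_mult abs_minus_cancel) simp
      qed
      have "l1 / m * \<bar>x - x'\<bar> \<le> l1 / m * 1"
        using x m by (intro mult_left_mono) auto
      also have "\<dots> < 1" using m l2 by (simp add: m_def)
      finally have "l1 * x / m = l1 * x' / m"
        using cis_2pi_eqD[OF c] a by simp
      hence "l1 = 0 \<or> x = x'" using m by auto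
      thus ?thesis using 3 bot[of x] bot[of x'] x by auto
    qed
  qed
  show ?thesis
  proof (cases "bd q")
    case True
    hence "bd q'" using bd_norm q eq by simp
    obtain x u where xu: "x \<in> {0..1}" "u \<in> {0,1}" "g q = g (x, u)" "chord_map l1 l2 q = chord_map l1 l2 (x, u)"
      using red[OF q(1) True] by blast
    obtain x' u' where xu': "x' \<in> {0..1}" "u' \<in> {0,1}" "g q' = g (x', u')" "chord_map l1 l2 q' = chord_map l1 l2 (x', u')"
      using red[OF q(2) \<open>bd q'\<close>] by blast
    show ?thesis
      using main[of x x' u u'] main[of x' x u' u] xu xu' eq by (cases "u \<ge> u'") auto
  next
    case False
    hence "\<not> bd q'" using bd_norm q eq by simp
    hence "q = q'"
      using False q by (intro inj_onD[OF inj_on_chord_map[OF l2] eq]) (auto simp: bd_def less_le)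
    thus ?thesis by simp
  qed
qed

lemma chord_map_image_unit_square:
  assumes "l2 \<ge> 1"
  shows "chord_map l1 l2 ` unit_square = cball 0 1"
proof
  show "chord_map l1 l2 ` unit_square \<subseteq> cball 0 1"
    using norm_chord_map_le by auto
  have "compact (chord_map l1 l2 ` unit_square)"
    by (intro compact_continuous_image continuous_on_subset[OF continuous_on_chord_map] compact_Times) auto
  moreover have "ball 0 1 \<subseteq> chord_map l1 l2 ` unit_square"
    using image_mono[of "{0<..<1} \<times> {0<..<1}" unit_square "chord_map l1 l2"]
    by (simp add: chord_map_image_square[OF assms] subset_iff)
  ultimately have "closure (ball 0 1) \<subseteq> chord_map l1 l2 ` unit_square"
    by (intro closure_minimal compact_imp_closed)
  thus "cball 0 1 \<subseteq> chord_map l1 l2 ` unit_square"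
    by simp
qed

section \<open>Distances in planar complexes\<close>

lemma planar_complex_edgeD:
  assumes "planar_complex D" "e \<in> edges D"
  shows "continuous_on {0..1} (emap D e)" "inj_on (emap D e) {0<..<1}"
    "emap D e 0 \<in> verts D" "emap D e 1 \<in> verts D" "verts D \<inter> open_edge D e = {}"
  using assms unfolding planar_complex_def by blast+

lemma planar_complex_faceD:
  assumes "planar_complex D" "f \<in> faces D"
  shows "continuous_on (cball 0 1) (fmap D f)" "inj_on (fmap D f) (ball 0 1)"
    "fbdry D f \<noteq> []" "\<exists>v. edge_path D v (fbdry D f) v"
    "circle_follows D (fmap D f) (fbdry D f)" "skeleton1 D \<inter> open_face D f = {}"
  using assms unfolding planar_complex_def by blast+

lemma planar_complex_disjointD:
  assumes "planar_complex D"
  shows "disjoint_family_on (open_edge D) (edges D)" "disjoint_family_on (open_face D) (faces D)"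
  using assms unfolding planar_complex_def by blast+

lemma planar_complex_finiteD:
  assumes "planar_complex D"
  shows "finite (verts D)" "finite (edges D)" "finite (faces D)"
  using assms unfolding planar_complex_def by blast+

lemma dart_pt_in_verts:
  assumes "planar_complex D" "fst d \<in> edges D"
  shows "dart_pt D d 0 \<in> verts D" "dart_pt D d 1 \<in> verts D"
  using planar_complex_edgeD(3,4)[OF assms] by (cases d; simp)+

lemma edge_path_in_verts:
  assumes "planar_complex D" "edge_path D u ds v"
  shows "u \<in> verts D" "v \<in> verts D"
proof -
  show "u \<in> verts D"
    using assms dart_pt_in_verts(1) by (cases ds) auto
  show "v \<in> verts D"
    using assms(2) by (induction ds arbitrary: u) auto
qed

lemma edge_path_append:
  assumes "planar_complex D"
  shows "edge_path D u (xs @ ys) v \<longleftrightarrow> (\<exists>w. edge_path D u xs w \<and> edge_path D w ys v)"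
  using edge_path_in_verts(1)[OF assms] by (induction xs arbitrary: u) auto

lemma edge_path_edges: "edge_path D u ds v \<Longrightarrow> fst ` set ds \<subseteq> edges D"
  by (induction ds arbitrary: u) auto

text \<open>\<open>vert_dist\<close> is a \<open>LEAST\<close> and says something only about
  vertices that some path reaches.\<close>

definition reachable :: "'g diagram \<Rightarrow> bool" where
  "reachable D \<longleftrightarrow> (\<forall>v\<in>verts D. \<exists>ds. edge_path D (basept D) ds v)"

lemma vert_dist_le: "edge_path D (basept D) ds v \<Longrightarrow> vert_dist D v \<le> length ds"
  unfolding vert_dist_def by (rule Least_le) auto

lemma vert_dist_path:
  assumes "reachable D" "v \<in> verts D"
  obtains ds where "edge_path D (basept D) ds v" "length ds = vert_dist D v"
proof -
  obtain ds where "edge_path D (basept D) ds v"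
    using assms unfolding reachable_def by blast
  hence "\<exists>ds'. edge_path D (basept D) ds' v \<and> length ds' = length ds"
    by blast
  hence "\<exists>ds'. edge_path D (basept D) ds' v \<and> length ds' = vert_dist D v"
    unfolding vert_dist_def by (rule LeastI)
  then obtain ds' where "edge_path D (basept D) ds' v" "length ds' = vert_dist D v"
    by blast
  thus ?thesis
    by (rule that)
qed

lemma vert_dist_edge_path:
  assumes "planar_complex D" "reachable D" "edge_path D u ds v"
  shows "vert_dist D v \<le> vert_dist D u + length ds"
proof -
  obtain es where "edge_path D (basept D) es u" "length es = vert_dist D u"
    using vert_dist_path[OF assms(2) edge_path_in_verts(1)[OF assms(1,3)]] by blast
  thus ?thesis
    using vert_dist_le[of D "es @ ds" v] assms(3) edge_path_append[OF assms(1)] by auto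
qed

lemma coarse_dist_vert: "v \<in> verts D \<Longrightarrow> coarse_dist D v = real (vert_dist D v)"
  by (simp add: coarse_dist_def)

lemma coarse_dist_edge:
  assumes "planar_complex D" "e \<in> edges D" "q \<in> open_edge D e"
  shows "coarse_dist D q = edge_dist D e"
proof -
  have "q \<notin> verts D" "q \<in> skeleton1 D"
    using assms planar_complex_edgeD(5)[OF assms(1,2)] by (auto simp: skeleton1_def)
  moreover have "(THE e. e \<in> edges D \<and> q \<in> open_edge D e) = e"
    using assms planar_complex_disjointD(1)[OF assms(1)]
    by (intro the_equality) (auto simp: disjoint_family_on_def)
  ultimately show ?thesis
    by (simp add: coarse_dist_def)
qed

lemma coarse_dist_face:
  assumes "planar_complex D" "f \<in> faces D" "q \<in> open_face D f"
  shows "coarse_dist D q = face_dist D f"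
proof -
  have "q \<notin> skeleton1 D"
    using assms planar_complex_faceD(6) by blast
  moreover have "q \<notin> verts D"
    using calculation by (simp add: skeleton1_def)
  moreover have "(THE f. f \<in> faces D \<and> q \<in> open_face D f) = f"
    using assms planar_complex_disjointD(2)[OF assms(1)]
    by (intro the_equality) (auto simp: disjoint_family_on_def)
  ultimately show ?thesis
    by (simp add: coarse_dist_def)
qed

lemma edge_dist_eq:
  "edge_dist D e = min (real (vert_dist D (emap D e 0))) (real (vert_dist D (emap D e 1))) + 1/2"
  by (simp add: edge_dist_def)

lemma edge_dist_dart_le: "edge_dist D (fst d) \<le> vert_dist D (dart_pt D d 0) + 1/2"
  by (cases d) (simp add: edge_dist_eq)

lemma space_of_cases [consumes 1, case_names vert edge face]:
  assumes "q \<in> space_of D"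
  obtains "q \<in> verts D" | e where "e \<in> edges D" "q \<in> open_edge D e"
  | f where "f \<in> faces D" "q \<in> open_face D f"
  using assms unfolding space_of_def skeleton1_def by blast

lemma skeleton1_space: "skeleton1 X \<subseteq> space_of X" "verts X \<subseteq> skeleton1 X"
  "e \<in> edges X \<Longrightarrow> open_edge X e \<subseteq> skeleton1 X" "f \<in> faces X \<Longrightarrow> open_face X f \<subseteq> space_of X"
  by (auto simp: space_of_def skeleton1_def)

lemma dart_pt_cases:
  assumes "planar_complex D" "fst d \<in> edges D" "s \<in> {0..1}"
  shows "dart_pt D d s \<in> {dart_pt D d 0, dart_pt D d 1} \<or> dart_pt D d s \<in> open_edge D (fst d)"
proof (cases "s = 0 \<or> s = 1")
  case False
  thus ?thesis
    using assms by (cases d) (auto simp: open_edge_def)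
qed auto

lemma dart_pt_in_skeleton1:
  assumes "planar_complex D" "fst d \<in> edges D" "s \<in> {0..1}"
  shows "dart_pt D d s \<in> skeleton1 D"
  using dart_pt_cases[OF assms] dart_pt_in_verts[OF assms(1,2)] assms(2) by (auto simp: skeleton1_def)

lemma coarse_dist_dart_le:
  assumes "planar_complex D" "reachable D" "fst d \<in> edges D" "s \<in> {0..1}"
  shows "coarse_dist D (dart_pt D d s) \<le> vert_dist D (dart_pt D d 0) + 1"
proof -
  have "edge_path D (dart_pt D d 0) [d] (dart_pt D d 1)"
    using assms dart_pt_in_verts[OF assms(1,3)] by (simp del: dart_pt.simps)
  from vert_dist_edge_path[OF assms(1,2) this]
  have "vert_dist D (dart_pt D d 1) \<le> vert_dist D (dart_pt D d 0) + 1"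
    by simp
  moreover have "coarse_dist D (dart_pt D d s) \<le> vert_dist D (dart_pt D d 0) + 1/2"
    if "dart_pt D d s \<in> open_edge D (fst d)"
    using that assms edge_dist_dart_le[of D d] by (simp add: coarse_dist_edge)
  ultimately show ?thesis
    using dart_pt_cases[OF assms(1,3,4)] dart_pt_in_verts[OF assms(1,3)]
    by (auto simp: coarse_dist_vert simp del: dart_pt.simps)
qed

lemma face_dist_le:
  assumes "planar_complex D" "f \<in> faces D"
    and "\<And>d. d \<in> set (fbdry D f) \<Longrightarrow> edge_dist D (fst d) \<le> c"
  shows "face_dist D f \<le> c"
proof -
  have "Max (edge_dist D ` fst ` set (fbdry D f)) \<le> c"
    using assms planar_complex_faceD(3)[OF assms(1,2)] by (subst Max_le_iff) auto
  thus ?thesis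
    by (simp add: face_dist_def)
qed


section \<open>Subdiagrams and the monotonicity of distance\<close>

definition subdiagram :: "'g diagram \<Rightarrow> 'g diagram \<Rightarrow> bool" where
  "subdiagram D D' \<longleftrightarrow> verts D \<subseteq> verts D' \<and> edges D \<subseteq> edges D' \<and> faces D \<subseteq> faces D' \<and>
     (\<forall>e\<in>edges D. emap D' e = emap D e \<and> elab D' e = elab D e) \<and>
     (\<forall>f\<in>faces D. fmap D' f = fmap D f \<and> fbdry D' f = fbdry D f) \<and> basept D' = basept D"

lemma subdiagram_dart:
  assumes "subdiagram D D'" "fst d \<in> edges D"
  shows "dart_pt D' d = dart_pt D d" "dart_lab D' d = dart_lab D d"
  using assms by (cases d; auto simp: subdiagram_def)+

lemma subdiagram_edge_path:
  assumes "subdiagram D D'" "edge_path D u ds v"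
  shows "edge_path D' u ds v"
  using assms(2)
proof (induction ds arbitrary: u)
  case Nil
  thus ?case using assms(1) by (auto simp: subdiagram_def)
next
  case (Cons d ds)
  thus ?case using assms(1) subdiagram_dart[OF assms(1), of d] by (auto simp: subdiagram_def)
qed

lemma subdiagram_open:
  assumes "subdiagram D D'"
  shows "e \<in> edges D \<Longrightarrow> open_edge D' e = open_edge D e"
    and "f \<in> faces D \<Longrightarrow> open_face D' f = open_face D f"
  using assms by (auto simp: subdiagram_def open_edge_def open_face_def)

lemma subdiagram_skeleton1:
  assumes "subdiagram D D'"
  shows "skeleton1 D \<subseteq> skeleton1 D'"
proof -
  have "verts D \<subseteq> verts D'" "edges D \<subseteq> edges D'"
    using assms by (auto simp: subdiagram_def)
  thus ?thesis
    using subdiagram_open(1)[OF assms] unfolding skeleton1_def by blast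
qed

lemma subdiagram_space_of:
  assumes "subdiagram D D'"
  shows "space_of D \<subseteq> space_of D'"
proof -
  have "faces D \<subseteq> faces D'"
    using assms by (auto simp: subdiagram_def)
  thus ?thesis
    using subdiagram_open(2)[OF assms] subdiagram_skeleton1[OF assms] unfolding space_of_def by blast
qed

lemma subdiagram_vert_dist:
  assumes "subdiagram D D'" "reachable D" "v \<in> verts D"
  shows "vert_dist D' v \<le> vert_dist D v"
proof -
  obtain ds where ds: "edge_path D (basept D) ds v" "length ds = vert_dist D v"
    using vert_dist_path[OF assms(2,3)] by blast
  moreover have "basept D' = basept D"
    using assms(1) by (simp add: subdiagram_def)
  ultimately show ?thesis
    using vert_dist_le[of D' ds v] subdiagram_edge_path[OF assms(1) ds(1)] by simp
qed

lemma subdiagram_edge_dist: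
  assumes "subdiagram D D'" "reachable D" "planar_complex D" "e \<in> edges D"
  shows "edge_dist D' e \<le> edge_dist D e"
proof -
  have "emap D' e = emap D e"
    using assms by (simp add: subdiagram_def)
  moreover have "vert_dist D' (emap D e i) \<le> vert_dist D (emap D e i)" if "i \<in> {0,1}" for i
    using that assms planar_complex_edgeD(3,4) by (intro subdiagram_vert_dist) auto
  ultimately show ?thesis
    unfolding edge_dist_eq by (intro add_mono min.mono) auto
qed

text \<open>A larger diagram has more paths, while the cell of a point and its attaching path stay
  the same. So bounds established before a gluing step survive it.\<close>

lemma subdiagram_coarse_dist:
  assumes "subdiagram D D'" "reachable D" "planar_complex D" "planar_complex D'" "q \<in> space_of D"
  shows "coarse_dist D' q \<le> coarse_dist D q"
  using assms(5)
proof (cases rule: space_of_cases)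
  case vert
  thus ?thesis
    using assms subdiagram_vert_dist[OF assms(1,2)] by (auto simp: coarse_dist_vert subdiagram_def)
next
  case (edge e)
  hence "e \<in> edges D'" "q \<in> open_edge D' e"
    using assms subdiagram_open(1)[OF assms(1)] by (auto simp: subdiagram_def)
  thus ?thesis
    using assms edge subdiagram_edge_dist[OF assms(1-3)] by (simp add: coarse_dist_edge)
next
  case (face f)
  hence f: "f \<in> faces D'" "q \<in> open_face D' f"
    using assms subdiagram_open(2)[OF assms(1)] by (auto simp: subdiagram_def)
  have fb: "fbdry D' f = fbdry D f"
    using assms(1) face by (simp add: subdiagram_def)
  have ed: "fst ` set (fbdry D f) \<subseteq> edges D"
    using planar_complex_faceD(4)[OF assms(3) face(1)] edge_path_edges by blast
  have "face_dist D' f \<le> face_dist D f"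
    unfolding face_dist_def fb
  proof (intro diff_right_mono)
    let ?E = "fst ` set (fbdry D f)"
    have ne: "?E \<noteq> {}" using planar_complex_faceD(3)[OF assms(3) face(1)] by simp
    have "edge_dist D' e \<le> Max (edge_dist D ` ?E)" if "e \<in> ?E" for e
    proof -
      have "edge_dist D' e \<le> edge_dist D e"
        using that ed by (intro subdiagram_edge_dist[OF assms(1-3)]) auto
      also have "\<dots> \<le> Max (edge_dist D ` ?E)"
        using that by (intro Max_ge) auto
      finally show ?thesis .
    qed
    thus "Max (edge_dist D' ` ?E) \<le> Max (edge_dist D ` ?E)"
      using ne by (subst Max_le_iff) auto
  qed
  thus ?thesis
    using assms f face by (simp add: coarse_dist_face)
qed

section \<open>Labelling a diagram by group elements\<close>

text \<open>All that the topology needs to know of the group: letters act invertibly, as by right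
  multiplication, and relators fix every element. \<open>Lim g\<close> bounds how far the
  contraction may carry a point labelled \<open>g\<close>; its choice is left to the group.\<close>

locale letter_action =
  fixes R :: "'g letter list set" and act :: "'g letter \<Rightarrow> 'h \<Rightarrow> 'h" and e0 :: 'h
    and K :: nat and Lim :: "'h \<Rightarrow> real"
  assumes act_inv_letter: "act (inv_letter x) (act x g) = g"
    and fold_relator: "r \<in> R \<Longrightarrow> foldl (\<lambda>g x. act x g) g r = g"
    and length_relator: "r \<in> R \<Longrightarrow> length r < K"
begin

definition ev :: "'h \<Rightarrow> 'g letter list \<Rightarrow> 'h" where
  "ev = foldl (\<lambda>g x. act x g)"

lemma ev_simps [simp]: "ev g [] = g" "ev g (x # w) = ev (act x g) w" "ev g (u @ v) = ev (ev g u) v"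
  by (simp_all add: ev_def)

lemma act_act_inv_letter: "act x (act (inv_letter x) g) = g"
  using act_inv_letter[of "inv_letter x"] by simp

lemma ev_inv_word: "ev (ev g (inv_word w)) w = g"
  by (induction w arbitrary: g) (simp_all add: inv_word_def act_act_inv_letter)

lemma ev_relator_eq:
  assumes "u @ inv_word v \<in> R"
  shows "ev g u = ev g v"
proof -
  have "ev (ev g u) (inv_word v) = g"
    using fold_relator[OF assms] by (simp flip: ev_def)
  thus ?thesis
    using ev_inv_word[of "ev g u" v] by simp
qed

text \<open>A map to the vertex set of the Cayley graph. An open cell takes the value of one vertex
  of its boundary, so continuity is not an issue and points still stay close to their
  labels.\<close>

definition labelling :: "'g diagram \<Rightarrow> (complex \<Rightarrow> 'h) \<Rightarrow> bool" where
  "labelling D gp \<longleftrightarrow> gp (basept D) = e0 \<and>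
     (\<forall>e\<in>edges D. gp (emap D e 1) = act (elab D e) (gp (emap D e 0)) \<and>
        (\<forall>q\<in>open_edge D e. gp q = gp (emap D e 0))) \<and>
     (\<forall>f\<in>faces D. \<forall>q\<in>open_face D f. gp q = gp (dart_pt D (hd (fbdry D f)) 0))"

lemma labelling_dart:
  assumes "labelling D gp" "fst d \<in> edges D"
  shows "gp (dart_pt D d 1) = act (dart_lab D d) (gp (dart_pt D d 0))"
  using assms by (cases d) (auto simp: labelling_def act_inv_letter)

lemma labelling_edge_path:
  assumes "labelling D gp" "edge_path D u ds v"
  shows "gp v = ev (gp u) (path_label D ds)"
  using assms(2)
proof (induction ds arbitrary: u)
  case (Cons d ds)
  thus ?case
    using labelling_dart[OF assms(1), of d] by (simp add: path_label_def del: dart_pt.simps) metis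
qed (simp add: path_label_def)

lemma labelling_vert:
  assumes "planar_complex D" "reachable D" "labelling D gp" "v \<in> verts D"
  shows "\<exists>u. ev e0 u = gp v \<and> length u = vert_dist D v"
proof -
  obtain ds where "edge_path D (basept D) ds v" "length ds = vert_dist D v"
    using vert_dist_path assms by blast
  thus ?thesis
    using labelling_edge_path[OF assms(3)] assms(3)
    by (intro exI[of _ "path_label D ds"]) (auto simp: labelling_def path_label_def)
qed

lemma labelling_dart_start:
  assumes "planar_complex D" "reachable D" "labelling D gp" "fst d \<in> edges D"
  shows "\<exists>u. ev e0 u = gp (dart_pt D d 0) \<and> length u \<le> edge_dist D (fst d) + 1/2"
proof (cases "vert_dist D (dart_pt D d 0) \<le> vert_dist D (dart_pt D d 1)")
  case True
  hence "edge_dist D (fst d) = vert_dist D (dart_pt D d 0) + 1/2"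
    by (cases d) (auto simp: edge_dist_eq)
  thus ?thesis
    using labelling_vert[OF assms(1-3) dart_pt_in_verts(1)[OF assms(1,4)]]
    by (auto simp del: dart_pt.simps)
next
  case False
  hence *: "edge_dist D (fst d) = vert_dist D (dart_pt D d 1) + 1/2"
    by (cases d) (auto simp: edge_dist_eq)
  obtain u where "ev e0 u = gp (dart_pt D d 1)" "length u = vert_dist D (dart_pt D d 1)"
    using labelling_vert[OF assms(1-3) dart_pt_in_verts(2)[OF assms(1,4)]] by blast
  thus ?thesis
    using * labelling_dart[OF assms(3,4)] act_inv_letter
    by (intro exI[of _ "u @ [inv_letter (dart_lab D d)]"]) auto
qed

text \<open>The lower bound on distance: a shortest path to a vertex spells a word for its label.
  For an edge the labelling vertex may be the farther end, which costs 1/2 over the edge distance,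
  and a face loses another 1/4; the slack 1 covers both.\<close>

lemma labelling_point:
  assumes "planar_complex D" "reachable D" "labelling D gp" "q \<in> space_of D"
  shows "\<exists>u. ev e0 u = gp q \<and> length u \<le> coarse_dist D q + 1"
  using assms(4)
proof (cases rule: space_of_cases)
  case vert
  thus ?thesis
    using labelling_vert[OF assms(1-3) vert] by (auto simp: coarse_dist_vert)
next
  case (edge e)
  moreover have "gp q = gp (emap D e 0)"
    using assms(3) edge by (simp add: labelling_def)
  ultimately show ?thesis
    using labelling_dart_start[OF assms(1-3), of "(e, True)"] assms(1)
    by (auto simp: coarse_dist_edge)
next
  case (face f)
  let ?d = "hd (fbdry D f)"
  have d: "?d \<in> set (fbdry D f)"
    using planar_complex_faceD(3)[OF assms(1) face(1)] by simp
  have "fst ?d \<in> edges D"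
    using planar_complex_faceD(4)[OF assms(1) face(1)] edge_path_edges d by blast
  then obtain u where u: "ev e0 u = gp (dart_pt D ?d 0)" "length u \<le> edge_dist D (fst ?d) + 1/2"
    using labelling_dart_start[OF assms(1-3)] by blast
  have "edge_dist D (fst ?d) \<le> Max (edge_dist D ` fst ` set (fbdry D f))"
    using d by (intro Max_ge) auto
  hence "length u \<le> coarse_dist D q + 1"
    using u face assms by (simp add: coarse_dist_face face_dist_def)
  moreover have "gp q = gp (dart_pt D ?d 0)"
    using assms(3) face by (simp add: labelling_def)
  ultimately show ?thesis
    using u by auto
qed

end

lemma edge_path_appendI:
  "edge_path D u xs w \<Longrightarrow> edge_path D w ys v \<Longrightarrow> edge_path D u (xs @ ys) v"
  by (induction xs arbitrary: u) auto

fun flip_dart :: "dart \<Rightarrow> dart" where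
  "flip_dart (e, b) = (e, \<not> b)"

lemma flip_dart_simps [simp]:
  "fst (flip_dart d) = fst d"
  "dart_pt D (flip_dart d) s = dart_pt D d (1 - s)"
  "dart_lab D (flip_dart d) = inv_letter (dart_lab D d)"
  by (cases d; simp)+

lemma edge_path_rev:
  assumes "planar_complex D" "edge_path D u ds v"
  shows "edge_path D v (rev (map flip_dart ds)) u"
  using assms(2)
proof (induction ds arbitrary: u)
  case (Cons d ds)
  have "edge_path D (dart_pt D d 1) [flip_dart d] u"
    using Cons.prems dart_pt_in_verts[OF assms(1), of d] by (simp del: dart_pt.simps)
  thus ?case
    using Cons edge_path_appendI by fastforce
qed simp

section \<open>Diagrams with a collar and a contraction\<close>

text \<open>The value 0 for the empty word is the distance of the basepoint.\<close>

definition end_weight :: "('g letter \<times> nat \<times> nat) list \<Rightarrow> nat" where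
  "end_weight bw = (if bw = [] then 0 else snd (snd (last bw)))"

lemma end_weight_simps [simp]:
  "end_weight [] = 0" "end_weight (xs @ [x]) = snd (snd x)"
  "ys \<noteq> [] \<Longrightarrow> end_weight (xs @ ys) = end_weight ys"
  by (simp_all add: end_weight_def)

lemma end_weight_take_Suc: "k < length bw \<Longrightarrow> end_weight (take (Suc k) bw) = snd (snd (bw ! k))"
  by (simp add: take_Suc_conv_app_nth)

lemma nat_floor_decomp:
  assumes "0 \<le> x" "x < real n"
  obtains k s where "k < n" "s \<in> {0..<1}" "x = real k + s"
proof -
  have "real (nat \<lfloor>x\<rfloor>) \<le> x" "x < real (nat \<lfloor>x\<rfloor>) + 1"
    using assms by linarith+
  moreover from this have "nat \<lfloor>x\<rfloor> < n"
    using assms by linarith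
  ultimately show ?thesis
    by (intro that[of "nat \<lfloor>x\<rfloor>" "x - real (nat \<lfloor>x\<rfloor>)"]) (simp_all only: atLeastLessThan_iff, linarith)
qed

text \<open>
  \<open>F\<close> parametrizes the collar: on the bottom of the strip, \<open>[k, k+1]\<close> follows the \<open>k\<close>-th boundary dart,
  and the extra interval \<open>[n, n+1]\<close> is constant, so that the empty boundary path is no exception.
  \<open>Phi\<close> contracts the diagram to the basepoint in finite time.  An entry \<open>(x, c, d)\<close> of \<open>bw\<close> stands for
  a boundary dart with label \<open>x\<close>; \<open>c\<close> bounds the coarse distance along the tracks of its points, and
  \<open>d\<close> does so for the track of its end vertex.
\<close>

locale filling = letter_action R act e0 K Lim
  for R :: "'g letter list set" and act :: "'g letter \<Rightarrow> 'h \<Rightarrow> 'h" and e0 K Lim +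
  fixes D :: "'g diagram" and ds :: "dart list" and F :: "real \<times> real \<Rightarrow> complex"
    and Phi :: "complex \<times> real \<Rightarrow> complex" and gp :: "complex \<Rightarrow> 'h"
    and bw :: "('g letter \<times> nat \<times> nat) list"
  assumes planar: "planar_complex D"
    and basept: "basept D = 0"
    and reach: "reachable D"
    and face_labels: "\<And>f. f \<in> faces D \<Longrightarrow> path_label D (fbdry D f) \<in> R"
    and path: "edge_path D 0 ds 0"
    and lab: "path_label D ds = map fst bw"
    and F_cont: "continuous_on ({0..real (length ds) + 1} \<times> {0..1}) F"
    and F_per: "\<And>y. y \<in> {0..1} \<Longrightarrow> F (real (length ds) + 1, y) = F (0, y)"
    and F_inj: "inj_on F ({0..<real (length ds) + 1} \<times> {0<..1})"
    and F_out: "\<And>th y. th \<in> {0..real (length ds) + 1} \<Longrightarrow> y \<in> {0<..1} \<Longrightarrow> F (th, y) \<notin> space_of D"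
    and F_top: "\<And>th. th \<in> {0..real (length ds) + 1} \<Longrightarrow>
       F (th, 1) = 2 * cis (2 * pi * (th / (real (length ds) + 1)))"
    and F_bot: "\<And>k s. k < length ds \<Longrightarrow> s \<in> {0..1} \<Longrightarrow> F (real k + s, 0) = dart_pt D (ds ! k) s"
    and F_dummy: "\<And>th. th \<in> {real (length ds)..real (length ds) + 1} \<Longrightarrow> F (th, 0) = 0"
    and compact_space: "compact (space_of D)"
    and Phi_cont: "continuous_on (space_of D \<times> {0..}) Phi"
    and Phi_space: "\<And>q t. q \<in> space_of D \<Longrightarrow> t \<ge> 0 \<Longrightarrow> Phi (q, t) \<in> space_of D"
    and Phi_0: "\<And>q. q \<in> space_of D \<Longrightarrow> Phi (q, 0) = q"
    and Phi_base: "\<And>t. t \<ge> 0 \<Longrightarrow> Phi (0, t) = 0"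
    and Phi_end: "\<exists>N\<ge>0. \<forall>q\<in>space_of D. \<forall>t\<ge>N. Phi (q, t) = 0"
    and Phi_vert: "\<And>v t. v \<in> verts D \<Longrightarrow> t \<ge> 0 \<Longrightarrow> Phi (v, t) \<in> skeleton1 D"
    and lbl: "labelling D gp"
    and edge_weight: "\<And>k s t. k < length bw \<Longrightarrow> s \<in> {0..1} \<Longrightarrow> t \<ge> 0 \<Longrightarrow>
       coarse_dist D (Phi (F (real k + s, 0), t)) \<le> fst (snd (bw ! k))"
    and vert_weight: "\<And>k t. k \<le> length bw \<Longrightarrow> t \<ge> 0 \<Longrightarrow>
       coarse_dist D (Phi (F (real k, 0), t)) \<le> end_weight (take k bw)"
    and tame: "\<And>q t t'. q \<in> space_of D \<Longrightarrow> 0 \<le> t \<Longrightarrow> t \<le> t' \<Longrightarrow>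
       coarse_dist D (Phi (q, t')) \<le> Lim (gp (Phi (q, t)))"
begin

lemma length_bw: "length bw = length ds"
  using lab by (metis length_map path_label_def)

lemma base_space: "0 \<in> verts D" "0 \<in> space_of D"
  using edge_path_in_verts(1)[OF planar path] by (auto simp: space_of_def skeleton1_def)

lemma F_0_0: "F (0, 0) = 0"
proof (cases ds)
  case Nil
  thus ?thesis using F_dummy[of 0] by simp
next
  case (Cons d ds')
  thus ?thesis using F_bot[of 0 0] path by simp
qed

lemma edge_path_between:
  assumes "a \<le> b" "b \<le> length ds"
  shows "edge_path D (F (real a, 0)) (take (b - a) (drop a ds)) (F (real b, 0))"
proof -
  have base: "F (real k, 0) \<in> verts D" if "k \<le> length ds" for k
  proof (cases "k < length ds")
    case True
    have "fst (ds ! k) \<in> edges D"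
      using edge_path_edges[OF path] True by (auto simp: image_subset_iff)
    thus ?thesis
      using F_bot[OF True, of 0] dart_pt_in_verts[OF planar] by simp
  next
    case False
    thus ?thesis
      using that F_dummy[of "length ds"] edge_path_in_verts[OF planar path] by simp
  qed
  show ?thesis
    using assms
  proof (induction b rule: dec_induct)
    case base
    thus ?case using \<open>\<And>k. k \<le> length ds \<Longrightarrow> F (real k, 0) \<in> verts D\<close> by simp
  next
    case (step b)
    have "fst (ds ! b) \<in> edges D"
      using edge_path_edges[OF path] step by (auto simp: image_subset_iff)
    moreover have "F (real (Suc b), 0) \<in> verts D"
      using base[of "Suc b"] step by simp
    ultimately have "edge_path D (F (real b, 0)) [ds ! b] (F (real (Suc b), 0))"
      using F_bot[of b 0] F_bot[of b 1] step by (simp add: add.commute)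
    moreover have "take (Suc b - a) (drop a ds) = take (b - a) (drop a ds) @ [ds ! b]"
      using step by (simp add: Suc_diff_le take_Suc_conv_app_nth)
    ultimately show ?case
      using edge_path_appendI step by fastforce
  qed
qed

lemma F_bot_vert: "k \<le> length ds \<Longrightarrow> F (real k, 0) \<in> verts D"
  using edge_path_in_verts(1)[OF planar edge_path_between[of k k]] by simp

lemma dart_edges: "k < length ds \<Longrightarrow> fst (ds ! k) \<in> edges D"
  using edge_path_edges[OF path] by (auto simp: image_subset_iff)

lemma F_bot_cases:
  assumes "th \<in> {0..real (length ds)}"
  obtains "th = real (length ds)" | k s where "k < length ds" "s \<in> {0..1}" "s < 1" "th = real k + s"
proof (cases "th = length ds")
  case False
  then obtain k s where "k < length ds" "s \<in> {0..<1}" "th = real k + s"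
    using nat_floor_decomp[of th "length ds"] assms by auto
  thus ?thesis
    using that(2)[of k s] by auto
qed (use that in auto)

lemma F_bot_skeleton1:
  assumes "th \<in> {0..real (length ds) + 1}"
  shows "F (th, 0) \<in> skeleton1 D"
proof (cases "th \<le> real (length ds)")
  case True
  hence "th \<in> {0..real (length ds)}" using assms by simp
  thus ?thesis
  proof (cases rule: F_bot_cases)
    case 1
    thus ?thesis using F_bot_vert[of "length ds"] by (simp add: skeleton1_def)
  next
    case (2 k s)
    thus ?thesis using F_bot[of k s] dart_pt_in_skeleton1[OF planar dart_edges] by simp
  qed
next
  case False
  thus ?thesis
    using assms F_dummy[of th] edge_path_in_verts(1)[OF planar path] by (simp add: skeleton1_def)
qed

lemma F_bot_space: "th \<in> {0..real (length ds) + 1} \<Longrightarrow> F (th, 0) \<in> space_of D"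
  using F_bot_skeleton1 by (auto simp: space_of_def)

lemma gp_bot:
  assumes "k \<le> length ds"
  shows "gp (F (real k, 0)) = ev e0 (map fst (take k bw))"
proof -
  have "edge_path D 0 (take k ds) (F (real k, 0))"
    using edge_path_between[of 0 k] assms F_0_0 by simp
  moreover have "gp 0 = e0"
    using lbl basept by (simp add: labelling_def)
  moreover have "path_label D (take k ds) = map fst (take k bw)"
    using lab by (simp add: path_label_def take_map[symmetric])
  ultimately show ?thesis
    using labelling_edge_path[OF lbl] by simp
qed

lemma gp_dart:
  assumes "k < length ds" "s \<in> {0..1}"
  shows "gp (F (real k + s, 0)) \<in> {gp (F (real k, 0)), gp (F (real (Suc k), 0))}"
proof -
  let ?d = "ds ! k"
  have b: "F (real k, 0) = dart_pt D ?d 0" "F (real (Suc k), 0) = dart_pt D ?d 1"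
    using F_bot[of k 0] F_bot[of k 1] assms by (simp_all add: add.commute)
  have "gp q \<in> {gp (dart_pt D ?d 0), gp (dart_pt D ?d 1)}" if "q \<in> open_edge D (fst ?d)" for q
  proof -
    have "gp q = gp (emap D (fst ?d) 0)"
      using lbl that dart_edges[OF assms(1)] by (simp add: labelling_def)
    thus ?thesis by (cases ?d; cases "snd ?d") auto
  qed
  thus ?thesis
    using dart_pt_cases[OF planar dart_edges[OF assms(1)] assms(2)] F_bot[OF assms]
    unfolding b by auto
qed

end

section \<open>Attaching a 2-cell\<close>

text \<open>
  The part \<open>A\<close> of the boundary is covered by a 2-cell whose other side is \<open>B\<close>; \<open>A\<close> may be empty.  The
  vertices of \<open>B\<close> are contracted along \<open>B\<close> to its starting point, so that only the last edge of \<open>B\<close>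
  sweeps over the 2-cell and inherits the weights of \<open>A\<close>.
\<close>

locale filling_step = filling R act e0 K Lim D ds F Phi gp bw
  for R :: "'g letter list set" and act :: "'g letter \<Rightarrow> 'h \<Rightarrow> 'h" and e0 K and Lim :: "'h \<Rightarrow> real"
    and D ds F Phi gp bw +
  fixes P A B S :: "('g letter \<times> nat \<times> nat) list" and N M :: nat
  assumes bw_eq: "bw = P @ A @ S"
    and B_ne: "B \<noteq> []"
    and rel: "map fst B @ inv_word (map fst A) \<in> R"
    and fresh_edge: "\<And>e. e \<in> edges D \<Longrightarrow> e < N" and fresh_face: "M \<notin> faces D"
    and new_vert_weight: "\<And>i. i < length B - 1 \<Longrightarrow> end_weight P + i + 1 \<le> snd (snd (B ! i))"
    and last_vert_weight: "end_weight (P @ A) \<le> snd (snd (last B))"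
    and new_edge_weight: "\<And>b. b \<in> set B \<Longrightarrow> end_weight P + K \<le> fst (snd b)"
    and sweep_weight: "\<And>x. x \<in> set A \<Longrightarrow> fst (snd x) \<le> fst (snd (last B))"
    and lim_new: "\<And>i. i \<le> length B \<Longrightarrow> real (fst (snd (last B))) \<le> Lim (ev e0 (map fst (P @ take i B)))"
    and lim_old: "\<And>i. i \<le> length A \<Longrightarrow> real (fst (snd (last B))) \<le> Lim (ev e0 (map fst (P @ take i A)))"
begin

abbreviation "n \<equiv> real (length ds)"
abbreviation "k0 \<equiv> real (length P)"
abbreviation "l1 \<equiv> real (length A)"
abbreviation "l2 \<equiv> real (length B)"
abbreviation "n' \<equiv> n - l1 + l2"

lemma n_eq: "n = k0 + l1 + real (length S)"
  using length_bw bw_eq by simp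

lemma l2_ge: "l2 \<ge> 1" "length B \<ge> 1" "l2 > 0" "l2 \<noteq> 0" "B \<noteq> []"
  using B_ne by (cases B; simp)+

lemma slope_pos: "2 * l2 - 1 > 0"
  using l2_ge(1) by linarith

text \<open>
  \<open>psi\<close> reparametrizes the boundary so that \<open>A\<close> lies under the \<open>length B\<close> unit intervals of \<open>B\<close>; it is
  only weakly monotone, and interpolating with a linear map makes it injective off the bottom.  The
  new 2-cell is the region under the graph of \<open>bump\<close>, and \<open>B\<close> is the graph, with its peak over the
  middle of the last edge of \<open>B\<close>.
\<close>

definition psi :: "real \<Rightarrow> real" where
  "psi th = th - (l2 - l1) / l2 * max 0 (min (th - k0) l2)"

definition chi :: "real \<Rightarrow> real \<Rightarrow> real" where
  "chi th y = (1 - y) * psi th + y * (th * (n + 1) / (n' + 1))"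

definition F1 :: "real \<times> real \<Rightarrow> complex" where
  "F1 q = F (chi (fst q) (snd q), snd q)"

definition bump :: "real \<Rightarrow> real" where
  "bump th = max 0 (min (th - k0) ((2 * l2 - 1) * (k0 + l2 - th))) / l2"

lemma psi_low: "th \<le> k0 \<Longrightarrow> psi th = th"
  by (simp add: psi_def)

lemma psi_mid: "th \<in> {k0..k0 + l2} \<Longrightarrow> psi th = k0 + (th - k0) * l1 / l2"
proof -
  assume "th \<in> {k0..k0 + l2}"
  hence "max 0 (min (th - k0) l2) = th - k0"
    by auto
  moreover have "(l2 - l1) / l2 * (th - k0) = (th - k0) - (th - k0) * l1 / l2"
    using l2_ge(3) by (simp add: divide_simps) (simp add: algebra_simps)
  ultimately show ?thesis
    by (simp add: psi_def)
qed

lemma psi_high: "th \<ge> k0 + l2 \<Longrightarrow> psi th = th - l2 + l1"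
  using l2_ge(3) by (simp add: psi_def)

lemma psi_mono:
  assumes "th \<le> th'"
  shows "psi th \<le> psi th'"
proof -
  define d where "d = max 0 (min (th' - k0) l2) - max 0 (min (th - k0) l2)"
  have d: "0 \<le> d" "d \<le> th' - th"
    using assms by (auto simp: d_def)
  have "(l2 - l1) / l2 \<le> 1"
    using l2_ge(3) by (simp only: divide_le_eq_1) simp
  hence "(l2 - l1) / l2 * d \<le> 1 * d"
    using d by (intro mult_right_mono) auto
  moreover have "psi th' - psi th = (th' - th) - (l2 - l1) / l2 * d"
    by (simp add: psi_def d_def algebra_simps)
  ultimately show ?thesis
    using d by linarith
qed

lemma n'_pos: "n' + 1 > 0" "n' \<ge> k0 + l2" "n + 1 > 0"
  using n_eq l2_ge by auto

lemma chi_less: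
  assumes "th < th'" "0 < y" "y \<le> 1"
  shows "chi th y < chi th' y"
proof -
  have "(1 - y) * psi th \<le> (1 - y) * psi th'"
    using psi_mono[of th th'] assms by (intro mult_left_mono) auto
  moreover have "y * (th * (n + 1) / (n' + 1)) < y * (th' * (n + 1) / (n' + 1))"
    using assms n'_pos by (intro mult_strict_left_mono divide_strict_right_mono mult_strict_right_mono) auto
  ultimately show ?thesis
    by (simp add: chi_def)
qed

lemma chi_ends: "chi 0 y = 0" "chi (n' + 1) y = n + 1"
proof -
  show "chi 0 y = 0"
    by (simp add: chi_def psi_low)
  have "(n' + 1) * (n + 1) / (n' + 1) = n + 1"
    using n'_pos by simp
  moreover have "psi (n' + 1) = n + 1"
    using n'_pos by (subst psi_high) auto
  ultimately show "chi (n' + 1) y = n + 1"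
    unfolding chi_def by (simp add: algebra_simps)
qed

lemma chi_y0: "chi th 0 = psi th"
  by (simp add: chi_def)

lemma chi_range:
  assumes "th \<in> {0..n' + 1}" "y \<in> {0..1}"
  shows "chi th y \<in> {0..n + 1}"
proof -
  have le: "chi a y \<le> chi b y" if "a \<le> b" for a b
    using chi_less[of a b y] that assms psi_mono[of a b]
    by (cases "y = 0"; cases "a = b") (auto simp: chi_y0)
  show ?thesis
    using le[of 0 th] le[of th "n' + 1"] assms by (simp add: chi_ends)
qed

lemma chi_range_less:
  assumes "th \<in> {0..<n' + 1}" "y \<in> {0<..1}"
  shows "chi th y \<in> {0..<n + 1}"
  using chi_range[of th y] chi_less[of th "n' + 1" y] assms chi_ends(2)[of y] by auto

lemma continuous_on_chi: "continuous_on X (\<lambda>q. chi (fst q) (snd q))"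
  unfolding chi_def psi_def using n'_pos by (intro continuous_intros) auto

abbreviation "dom' \<equiv> {0..n' + 1} \<times> {0..1 :: real}"

lemma F1_cont: "continuous_on dom' F1"
  unfolding F1_def
  by (intro continuous_on_compose2[OF F_cont] continuous_intros continuous_on_chi)
    (use chi_range in auto)

lemma F1_per: "y \<in> {0..1} \<Longrightarrow> F1 (n' + 1, y) = F1 (0, y)"
  using F_per[of y] by (simp add: F1_def chi_ends)

lemma F1_inj: "inj_on F1 ({0..<n' + 1} \<times> {0<..1})"
proof (rule inj_onI)
  fix p q assume p: "p \<in> {0..<n' + 1} \<times> {0<..1}" and q: "q \<in> {0..<n' + 1} \<times> {0<..1}" and "F1 p = F1 q"
  hence "(chi (fst p) (snd p), snd p) = (chi (fst q) (snd q), snd q)"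
    using chi_range_less by (intro inj_onD[OF F_inj]) (auto simp: F1_def)
  hence "snd p = snd q" "chi (fst p) (snd p) = chi (fst q) (snd p)"
    by auto
  moreover have "fst p = fst q"
    using chi_less[of "fst p" "fst q" "snd p"] chi_less[of "fst q" "fst p" "snd p"] calculation p
    by (cases "fst p" "fst q" rule: linorder_cases) auto
  ultimately show "p = q"
    by (simp add: prod_eq_iff)
qed

lemma F1_out: "th \<in> {0..n' + 1} \<Longrightarrow> y \<in> {0<..1} \<Longrightarrow> F1 (th, y) \<notin> space_of D"
  using F_out[of "chi th y" y] chi_range[of th y] by (simp add: F1_def)

lemma F1_top: "th \<in> {0..n' + 1} \<Longrightarrow> F1 (th, 1) = 2 * cis (2 * pi * (th / (n' + 1)))"
  using F_top[of "chi th 1"] chi_range[of th 1] n'_pos by (simp add: F1_def chi_def)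

lemma F1_bot: "F1 (th, 0) = F (psi th, 0)"
  by (simp add: F1_def chi_y0)

lemma F1_bot_space: "th \<in> {0..n' + 1} \<Longrightarrow> F1 (th, 0) \<in> space_of D"
  using chi_range[of th 0] by (simp add: F1_bot chi_y0 F_bot_space)

lemma bump_nonneg: "bump th \<ge> 0"
  by (simp add: bump_def)

lemma bump_less_1: "bump th < 1"
proof -
  have "max 0 (min (th - k0) ((2 * l2 - 1) * (k0 + l2 - th))) < l2"
  proof (cases "th - k0 < l2")
    case False
    hence "(2 * l2 - 1) * (k0 + l2 - th) \<le> 0"
      using slope_pos by (intro mult_nonneg_nonpos) linarith+
    thus ?thesis using l2_ge by auto
  qed (use l2_ge in auto)
  thus ?thesis
    using l2_ge by (simp add: bump_def)
qed

lemma bump_low: "th \<le> k0 \<Longrightarrow> bump th = 0"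
  by (simp add: bump_def)

lemma bump_high: "th \<ge> k0 + l2 \<Longrightarrow> bump th = 0"
proof -
  assume "th \<ge> k0 + l2"
  hence "(2 * l2 - 1) * (k0 + l2 - th) \<le> 0"
    using slope_pos by (intro mult_nonneg_nonpos) linarith+
  thus ?thesis
    by (simp add: bump_def max_absorb1 min.coboundedI2)
qed

lemma bump_pos: "k0 < th \<Longrightarrow> th < k0 + l2 \<Longrightarrow> bump th > 0"
  using l2_ge(3) slope_pos by (simp add: bump_def less_max_iff_disj)

text \<open>The falling branch is \<open>2 * l2 - 1\<close> times as steep as the rising one, so the
  two cross at \<open>k0 + l2 - 1/2\<close>. All edges of \<open>B\<close> except the last lie on
  the rising branch, a line of slope \<open>1 / l2\<close>.\<close>

lemma bump_rise:
  assumes "k0 \<le> th" "th \<le> k0 + l2 - 1"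
  shows "bump th = (th - k0) / l2"
proof -
  have "(2 * l2 - 1) * 1 \<le> (2 * l2 - 1) * (k0 + l2 - th)"
    using assms slope_pos by (intro mult_left_mono) linarith+
  hence "min (th - k0) ((2 * l2 - 1) * (k0 + l2 - th)) = th - k0"
    using assms l2_ge(1) by (intro min_absorb1) (simp only: mult_1_right)
  thus ?thesis
    using assms by (simp add: bump_def)
qed

lemma bump_le: "k0 \<le> th \<Longrightarrow> l2 * bump th \<le> th - k0"
  using l2_ge by (auto simp: bump_def)

text \<open>Going down by \<open>s\<close> and left by \<open>l2 * s\<close> is going parallel to
  the rising branch: that branch drops by exactly \<open>s\<close>, while the falling branch gets
  higher. This keeps \<open>pull\<close> inside the cell.\<close>

lemma bump_shift:
  assumes "0 \<le> s" "s \<le> bump th"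
  shows "bump th - s \<le> bump (th - l2 * s)"
proof -
  have "(2 * l2 - 1) * (k0 + l2 - th) \<le> (2 * l2 - 1) * (k0 + l2 - (th - l2 * s))"
    using assms slope_pos by (intro mult_left_mono) simp_all
  moreover have "0 \<le> l2 * s"
    using assms l2_ge by simp
  ultimately have "max 0 (min (th - k0) ((2 * l2 - 1) * (k0 + l2 - th))) - l2 * s
      \<le> max 0 (min (th - l2 * s - k0) ((2 * l2 - 1) * (k0 + l2 - (th - l2 * s))))"
    by linarith
  hence "(max 0 (min (th - k0) ((2 * l2 - 1) * (k0 + l2 - th))) - l2 * s) / l2 \<le> bump (th - l2 * s)"
    unfolding bump_def using l2_ge by (intro divide_right_mono) auto
  thus ?thesis
    using l2_ge(3) by (simp add: bump_def[of th] diff_divide_distrib)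
qed

lemma continuous_on_bump: "continuous_on X f \<Longrightarrow> continuous_on X (\<lambda>q. bump (f q))"
  unfolding bump_def using l2_ge by (intro continuous_intros) auto

section \<open>The new cell as a region of the strip\<close>

definition top :: "real \<Rightarrow> complex" where
  "top th = F1 (th, bump th)"

definition T :: "(real \<times> real) set" where
  "T = {(th, y). k0 \<le> th \<and> th \<le> k0 + l2 \<and> 0 \<le> y \<and> y \<le> bump th}"

text \<open>The part of \<open>T\<close> on which \<open>F1\<close> is injective and avoids the old
  diagram. On the bottom \<open>F1\<close> follows the old boundary path, which can pass through a
  point several times.\<close>

definition Tpos :: "(real \<times> real) set" where
  "Tpos = {(th, y). k0 < th \<and> th < k0 + l2 \<and> 0 < y \<and> y \<le> bump th}"

definition Tin :: "(real \<times> real) set" where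
  "Tin = {(th, y). k0 < th \<and> th < k0 + l2 \<and> 0 < y \<and> y < bump th}"

lemma T_cases: "w \<in> T \<Longrightarrow> w \<in> Tpos \<or> (snd w = 0 \<and> fst w \<in> {k0..k0 + l2})"
  using bump_low bump_high by (cases w) (auto simp: T_def Tpos_def less_le)

lemma T_dom: "T \<subseteq> {k0..k0 + l2} \<times> {0..1}" "T \<subseteq> dom'"
proof -
  show "T \<subseteq> {k0..k0 + l2} \<times> {0..1}"
    using order_trans[OF _ bump_less_1[THEN less_imp_le]] by (auto simp: T_def)
  moreover have "{k0..k0 + l2} \<times> {0..1} \<subseteq> dom'"
    using n'_pos by (intro Sigma_mono) auto
  ultimately show "T \<subseteq> dom'"
    by blast
qed

lemma Tpos_dom: "Tpos \<subseteq> {0..<n' + 1} \<times> {0<..1}"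
proof
  fix w assume "w \<in> Tpos"
  thus "w \<in> {0..<n' + 1} \<times> {0<..1}"
    using n'_pos bump_less_1[of "fst w"] by (cases w) (simp add: Tpos_def)
qed

lemma Tpos_T: "Tpos \<subseteq> T" "Tin \<subseteq> Tpos"
  by (auto simp: T_def Tpos_def Tin_def)

lemma compact_T: "compact T"
proof -
  have "T = ({k0..k0 + l2} \<times> {0..1}) \<inter> {q. snd q \<le> bump (fst q)}"
    using T_dom(1) by (auto simp: T_def)
  moreover have "closed {q :: real \<times> real. snd q \<le> bump (fst q)}"
    by (intro closed_Collect_le continuous_on_bump continuous_intros)
  ultimately show ?thesis
    by (simp add: compact_Int_closed compact_Times)
qed

lemma F1_T_cont: "continuous_on T F1"
  using F1_cont T_dom(2) continuous_on_subset by blast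

lemma F1_inj_Tpos: "inj_on F1 Tpos"
  using F1_inj Tpos_dom inj_on_subset by blast

lemma F1_Tpos_out: "w \<in> Tpos \<Longrightarrow> F1 w \<notin> space_of D"
  using F1_out[of "fst w" "snd w"] Tpos_dom by force

lemma F1_eq_Tpos:
  assumes "w \<in> Tpos" "th \<in> {0..<n' + 1}" "y \<in> {0..1}" "F1 (th, y) = F1 w"
  shows "(th, y) = w"
proof -
  have "y \<noteq> 0"
    using F1_bot_space[of th] F1_Tpos_out[OF assms(1)] assms by auto
  thus ?thesis
    using assms Tpos_dom by (intro inj_onD[OF F1_inj]) auto
qed

lemma top_Tpos: "k0 < th \<Longrightarrow> th < k0 + l2 \<Longrightarrow> (th, bump th) \<in> Tpos"
  using bump_pos by (auto simp: Tpos_def)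

lemma top_T: "k0 \<le> th \<Longrightarrow> th \<le> k0 + l2 \<Longrightarrow> (th, bump th) \<in> T"
  using bump_nonneg by (auto simp: T_def)

lemma top_low: "0 \<le> th \<Longrightarrow> th \<le> k0 \<Longrightarrow> top th = F (th, 0)"
  by (simp add: top_def bump_low F1_bot psi_low)

lemma top_high: "th \<ge> k0 + l2 \<Longrightarrow> top th = F (th - l2 + l1, 0)"
  by (simp add: top_def bump_high F1_bot psi_high)

lemma top_cont: "continuous_on {0..n' + 1} top"
  unfolding top_def
  by (intro continuous_on_compose2[OF F1_cont] continuous_intros continuous_on_bump)
    (use bump_nonneg bump_less_1[THEN less_imp_le] in auto)

lemma top_inj: "inj_on top {k0<..<k0 + l2}"
proof (rule inj_onI)
  fix a b assume "a \<in> {k0<..<k0 + l2}" "b \<in> {k0<..<k0 + l2}" "top a = top b"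
  thus "a = b"
    using inj_onD[OF F1_inj_Tpos, of "(a, bump a)" "(b, bump b)"] top_Tpos by (simp add: top_def)
qed

section \<open>The enlarged diagram\<close>

definition new_darts :: "dart list" where
  "new_darts = map (\<lambda>i. (N + i, True)) [0..<length B]"

definition "dsP = take (length P) ds"
definition "dsA = take (length A) (drop (length P) ds)"
definition "dsS = drop (length P + length A) ds"

definition sq :: "real \<times> real \<Rightarrow> real \<times> real" where
  "sq q = (k0 + l2 * fst q, snd q * bump (k0 + l2 * fst q))"

text \<open>\<open>circle_follows\<close> wants equal arcs for all darts of the attaching path.
  \<open>chord_map\<close> sends the top of the square to the first \<open>length B\<close> of these
  arcs and the bottom, backwards, to the last \<open>length A\<close>.\<close>

definition fm :: "complex \<Rightarrow> complex" where
  "fm z = F1 (sq (SOME q. q \<in> unit_square \<and> chord_map (length A) (length B) q = z))"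

definition D' :: "'g diagram" where
  "D' = D\<lparr>verts := verts D \<union> (\<lambda>i. top (k0 + real i)) ` {1..<length B},
          edges := edges D \<union> {N..<N + length B},
          emap := \<lambda>e. if e < N then emap D e else (\<lambda>s. top (k0 + real (e - N) + s)),
          elab := \<lambda>e. if e < N then elab D e else fst (B ! (e - N)),
          faces := insert M (faces D),
          fmap := (fmap D)(M := fm),
          fbdry := (fbdry D)(M := new_darts @ rev (map flip_dart dsA))\<rparr>"

lemma D'_simps:
  "verts D' = verts D \<union> (\<lambda>i. top (k0 + real i)) ` {1..<length B}"
  "edges D' = edges D \<union> {N..<N + length B}"
  "faces D' = insert M (faces D)"
  "fmap D' M = fm" "fbdry D' M = new_darts @ rev (map flip_dart dsA)"
  "emap D' (N + i) = (\<lambda>s. top (k0 + real i + s))"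
  "elab D' (N + i) = fst (B ! i)"
  "basept D' = 0"
  using basept by (simp_all add: D'_def)

lemma sub: "subdiagram D D'"
  using fresh_edge fresh_face by (auto simp: subdiagram_def D'_def)

lemma lengths: "length dsP = length P" "length dsA = length A" "length dsS = length S"
  "ds = dsP @ dsA @ dsS"
proof -
  show "length dsP = length P" "length dsA = length A" "length dsS = length S"
    using length_bw bw_eq by (auto simp: dsP_def dsA_def dsS_def)
  have "dsA @ dsS = drop (length P) ds"
    unfolding dsA_def dsS_def by (metis append_take_drop_id drop_drop add.commute)
  thus "ds = dsP @ dsA @ dsS"
    by (simp add: dsP_def)
qed

lemma new_darts_simps: "length new_darts = length B"
  "i < length B \<Longrightarrow> new_darts ! i = (N + i, True)"
  "set new_darts = (\<lambda>i. (N + i, True)) ` {..<length B}"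
  by (auto simp: new_darts_def)

lemma new_dart_pt: "dart_pt D' (N + i, True) s = top (k0 + real i + s)"
  by (simp add: D'_simps)

lemma old_dart_pt: "fst d \<in> edges D \<Longrightarrow> dart_pt D' d = dart_pt D d"
  using subdiagram_dart[OF sub] by blast

lemma top_k0: "top k0 = F (k0, 0)" "top (k0 + l2) = F (k0 + l1, 0)"
  using top_low[of k0] top_high[of "k0 + l2"] by (simp_all add: add.commute add.left_commute)

lemma top_vert: "j \<le> length B \<Longrightarrow> top (k0 + real j) \<in> verts D'"
proof -
  assume j: "j \<le> length B"
  consider "j = 0" | "j \<in> {1..<length B}" | "j = length B"
    using j by force
  thus ?thesis
  proof cases
    case 1
    thus ?thesis
      using F_bot_vert[of "length P"] top_k0 n_eq length_bw bw_eq by (simp add: D'_simps)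
  next
    case 2
    thus ?thesis by (auto simp: D'_simps)
  next
    case 3
    thus ?thesis
      using F_bot_vert[of "length P + length A"] top_k0 length_bw bw_eq by (simp add: D'_simps)
  qed
qed

lemma new_edge_path:
  assumes "a \<le> b" "b \<le> length B"
  shows "edge_path D' (top (k0 + real a)) (map (\<lambda>i. (N + i, True)) [a..<b]) (top (k0 + real b))"
  using assms
proof (induction b rule: dec_induct)
  case base
  thus ?case using top_vert by simp
next
  case (step b)
  have "edge_path D' (top (k0 + real b)) [(N + b, True)] (top (k0 + real (Suc b)))"
    using step top_vert[of "Suc b"] unfolding edge_path.simps new_dart_pt
    by (simp add: D'_simps add.commute add.left_commute)
  thus ?case
    using step edge_path_appendI by fastforce
qed

lemma new_darts_path: "edge_path D' (F (k0, 0)) new_darts (F (k0 + l1, 0))"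
  using new_edge_path[of 0 "length B"] top_k0 by (simp add: new_darts_def)

lemma dsP_path: "edge_path D 0 dsP (F (k0, 0))"
  using edge_path_between[of 0 "length P"] F_0_0 length_bw bw_eq by (simp add: dsP_def)

lemma dsA_path: "edge_path D (F (k0, 0)) dsA (F (k0 + l1, 0))"
  using edge_path_between[of "length P" "length P + length A"] length_bw bw_eq by (simp add: dsA_def)

lemma dsS_path: "edge_path D (F (k0 + l1, 0)) dsS 0"
proof -
  have "length ds = length P + length A + length S"
    using length_bw bw_eq by simp
  thus ?thesis
    using edge_path_between[of "length P + length A" "length ds"] F_dummy[of n]
    by (simp add: dsS_def)
qed

definition "ds' = dsP @ new_darts @ dsS"

lemma length_ds': "real (length ds') = n'" "length ds' = length P + length B + length S"
  using n_eq by (simp_all add: ds'_def lengths(1-3) new_darts_simps)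

lemma ds'_path: "edge_path D' 0 ds' 0"
  unfolding ds'_def
  by (intro edge_path_appendI[OF _ edge_path_appendI[OF new_darts_path]] subdiagram_edge_path[OF sub]
      dsP_path dsS_path)

lemma path_label_sub: "edge_path D u es v \<Longrightarrow> path_label D' es = path_label D es"
  using edge_path_edges[of D u es v] subdiagram_dart(2)[OF sub] by (auto simp: path_label_def)

lemma path_label_new: "path_label D' new_darts = map fst B"
  by (auto simp: path_label_def new_darts_def D'_simps intro: nth_equalityI)

lemma path_label_parts: "path_label D dsP = map fst P" "path_label D dsA = map fst A"
  "path_label D dsS = map fst S"
proof -
  have "path_label D dsP @ path_label D dsA @ path_label D dsS = map fst P @ map fst A @ map fst S"
    using lab bw_eq lengths(4) by (metis map_append path_label_def)
  thus "path_label D dsP = map fst P" "path_label D dsA = map fst A"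
    "path_label D dsS = map fst S"
    by (simp_all add: append_eq_append_conv path_label_def lengths(1-3))
qed

lemma ds'_lab: "path_label D' ds' = map fst (P @ B @ S)"
proof -
  have "path_label D' ds' = path_label D' dsP @ path_label D' new_darts @ path_label D' dsS"
    by (simp add: ds'_def path_label_def)
  thus ?thesis
    using path_label_sub[OF dsP_path] path_label_sub[OF dsS_path] path_label_new path_label_parts
    by simp
qed

lemma fbdry_path: "edge_path D' (F (k0, 0)) (fbdry D' M) (F (k0, 0))"
  unfolding D'_simps
  by (intro edge_path_appendI[OF new_darts_path] subdiagram_edge_path[OF sub]
      edge_path_rev[OF planar dsA_path])

lemma path_label_flip: "path_label X (rev (map flip_dart es)) = inv_word (path_label X es)"
  by (simp add: path_label_def inv_word_def rev_map)

lemma fbdry_label: "path_label D' (fbdry D' M) \<in> R"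
proof -
  have "path_label D' (fbdry D' M) = path_label D' new_darts @ path_label D' (rev (map flip_dart dsA))"
    by (simp add: D'_simps path_label_def)
  thus ?thesis
    using rel path_label_new path_label_flip[of D' dsA] path_label_sub[OF dsA_path] path_label_parts
    by simp
qed

lemma face_size: "length A + length B < K"
  using length_relator[OF rel] by (simp add: inv_word_def)

lemma sq_T: "q \<in> unit_square \<Longrightarrow> sq q \<in> T"
  using l2_ge(3) bump_nonneg mult_right_mono[of "snd q" 1 "bump (k0 + l2 * fst q)"]
  by (cases q) (auto simp: sq_def T_def)

lemma sq_image: "sq ` ({0<..<1} \<times> {0<..<1}) = Tin"
proof
  show "sq ` ({0<..<1} \<times> {0<..<1}) \<subseteq> Tin"
  proof
    fix w assume "w \<in> sq ` ({0<..<1} \<times> {0<..<1})"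
    then obtain x u where *: "x \<in> {0<..<1}" "u \<in> {0<..<1}" and w: "w = sq (x, u)"
      by auto
    have "bump (k0 + l2 * x) > 0"
      using * l2_ge(3) by (intro bump_pos) auto
    thus "w \<in> Tin"
      using * l2_ge(3) by (auto simp: w sq_def Tin_def)
  qed
  show "Tin \<subseteq> sq ` ({0<..<1} \<times> {0<..<1})"
  proof
    fix w assume "w \<in> Tin"
    then obtain th y where *: "(th, y) \<in> Tin" and w: "w = (th, y)"
      by (cases w) auto
    hence b: "bump th > 0" by (auto simp: Tin_def)
    have "k0 + l2 * ((th - k0) / l2) = th"
      using l2_ge(3) by simp
    thus "w \<in> sq ` ({0<..<1} \<times> {0<..<1})"
      unfolding w using * b l2_ge(3) by (intro image_eqI[of _ _ "((th - k0) / l2, y / bump th)"]) (auto simp: sq_def Tin_def)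
  qed
qed

lemma sq_inj: "inj_on sq ({0<..<1} \<times> {0<..<1})"
proof (rule inj_onI, clarify)
  fix x u x' u' :: real assume *: "x \<in> {0<..<1}" "u \<in> {0<..<1}" "sq (x, u) = sq (x', u')"
  have "bump (k0 + l2 * x) > 0"
    using * l2_ge(3) by (intro bump_pos) auto
  thus "x = x' \<and> u = u'"
    using * l2_ge(3) by (auto simp: sq_def)
qed

lemma sq_cont: "continuous_on X sq"
  unfolding sq_def by (intro continuous_intros continuous_on_bump)

lemma F1_sq_bot: "x \<in> {0..1} \<Longrightarrow> F1 (sq (x, 0)) = F (k0 + l1 * x, 0)"
  using l2_ge(3) by (simp add: sq_def F1_bot psi_mid mult.commute)

text \<open>The choice in \<open>fm\<close> does not matter: \<open>bump\<close> vanishes over the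
  ends of \<open>B\<close>, so \<open>sq\<close> collapses the vertical sides, and for empty
  \<open>A\<close> the map \<open>psi\<close> is constant over \<open>B\<close>, so
  \<open>F1\<close> collapses the bottom.\<close>

lemma fm_chord_map:
  assumes "q \<in> unit_square"
  shows "fm (chord_map (length A) (length B) q) = F1 (sq q)"
proof -
  define q' where "q' = (SOME q'. q' \<in> unit_square \<and>
    chord_map (length A) (length B) q' = chord_map (length A) (length B) q)"
  have "q' \<in> unit_square \<and> chord_map (length A) (length B) q' = chord_map (length A) (length B) q"
    unfolding q'_def by (rule someI[of _ q]) (use assms in auto)
  moreover have "(F1 \<circ> sq) q' = (F1 \<circ> sq) q"
  proof (rule chord_map_fibre[OF l2_ge(2)])
    show "(F1 \<circ> sq) (x, u) = (F1 \<circ> sq) (x, 0)" if "x \<in> {0,1}" "u \<in> {0..1}" for x u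
      using that by (auto simp: sq_def bump_low bump_high)
    show "(F1 \<circ> sq) (x, 0) = (F1 \<circ> sq) (0, 0)" if "length A = 0" "x \<in> {0..1}" for x
      using that F1_sq_bot[of x] F1_sq_bot[of 0] by simp
  qed (use calculation assms in auto)
  ultimately show ?thesis
    by (simp add: fm_def q'_def)
qed

lemma fm_cont: "continuous_on (cball 0 1) fm"
proof -
  have "compact unit_square"
    by (intro compact_Times compact_Icc)
  moreover have "continuous_on unit_square (fm \<circ> chord_map (length A) (length B))"
  proof -
    have "continuous_on unit_square (\<lambda>q. F1 (sq q))"
      using sq_T by (intro continuous_on_compose2[OF F1_T_cont] sq_cont) auto
    thus ?thesis
      using fm_chord_map by (simp cong: continuous_on_cong)
  qed
  ultimately show ?thesis
    using continuous_on_compact_quotient[of unit_square "chord_map (length A) (length B)" fm]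
      continuous_on_subset[OF continuous_on_chord_map, of unit_square]
      chord_map_image_unit_square[OF l2_ge(2)] by simp
qed

lemma fm_ball: "fm ` ball 0 1 = F1 ` Tin"
proof -
  have "fm ` ball 0 1 = (fm \<circ> chord_map (length A) (length B)) ` ({0<..<1} \<times> {0<..<1})"
    by (simp only: image_comp[symmetric] chord_map_image_square[OF l2_ge(2)])
  also have "\<dots> = (F1 \<circ> sq) ` ({0<..<1} \<times> {0<..<1})"
    by (intro image_cong) (auto simp: fm_chord_map)
  finally show ?thesis
    by (simp only: image_comp[symmetric] sq_image)
qed

lemma fm_inj: "inj_on fm (ball 0 1)"
proof (rule inj_onI)
  let ?Q = "{0<..<1} \<times> {0<..<1} :: (real \<times> real) set"
  fix z z' assume z: "z \<in> ball 0 1" "z' \<in> ball 0 1" "fm z = fm z'"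
  obtain q where q: "z = chord_map (length A) (length B) q" "q \<in> ?Q"
    using z(1) unfolding chord_map_image_square[OF l2_ge(2), of "length A", symmetric] by blast
  obtain q' where q': "z' = chord_map (length A) (length B) q'" "q' \<in> ?Q"
    using z(2) unfolding chord_map_image_square[OF l2_ge(2), of "length A", symmetric] by blast
  have "F1 (sq q) = F1 (sq q')"
    using fm_chord_map[of q] fm_chord_map[of q'] q q' z by auto
  moreover have "sq q \<in> Tpos" "sq q' \<in> Tpos"
    using sq_image q q' Tpos_T(2) by blast+
  ultimately have "sq q = sq q'"
    using inj_onD[OF F1_inj_Tpos] by blast
  thus "z = z'"
    using inj_onD[OF sq_inj] q q' by blast
qed

lemma F_bot_A:
  assumes "j < length A" "s \<in> {0..1}"
  shows "F (k0 + real j + s, 0) = dart_pt D (dsA ! j) s" "fst (dsA ! j) \<in> edges D"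
proof -
  have "length P + j < length ds"
    using assms length_bw bw_eq by simp
  moreover from this have "ds ! (length P + j) = dsA ! j"
    using assms by (simp add: dsA_def)
  ultimately show "F (k0 + real j + s, 0) = dart_pt D (dsA ! j) s" "fst (dsA ! j) \<in> edges D"
    using F_bot[of "length P + j" s] dart_edges[of "length P + j"] assms by simp_all
qed

lemma fm_follows: "circle_follows D' fm (fbdry D' M)"
  unfolding circle_follows_def
proof (intro allI impI ballI)
  fix k s assume k: "k < length (fbdry D' M)" and s: "s \<in> {0..1::real}"
  define m where "m = l1 + l2"
  have m: "m > 0" using l2_ge(3) unfolding m_def by linarith
  have len: "real (length (fbdry D' M)) = m"
    by (simp add: D'_simps new_darts_simps lengths(1-3) m_def)
  show "fm (cis (2 * pi * (real k + s) / real (length (fbdry D' M)))) = dart_pt D' (fbdry D' M ! k) s"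
  proof (cases "k < length B")
    case True
    define x where "x = (real k + s) / l2"
    have lx: "l2 * x = real k + s" using l2_ge(3) by (simp add: x_def)
    have "real k + 1 \<le> l2" using True by simp
    hence x: "x \<in> {0..1}" using s l2_ge(3) by (auto simp: x_def)
    have "cis (2 * pi * (real k + s) / m) = chord_map (length A) (length B) (x, 1)"
      by (simp add: chord_map_1[OF l2_ge(2)] lx m_def)
    hence "fm (cis (2 * pi * (real k + s) / m)) = top (k0 + l2 * x)"
      using fm_chord_map[of "(x, 1)"] x by (simp add: sq_def top_def)
    thus ?thesis
      unfolding len using True
      by (simp add: D'_simps(5) nth_append new_darts_simps new_dart_pt lx add.assoc del: dart_pt.simps)
  next
    case False
    define j where "j = k - length B"
    have j: "j < length A" "k = length B + j"
      using False k by (auto simp: j_def D'_simps new_darts_simps lengths(1-3))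
    \<comment> \<open>The darts of \<open>A\<close> come in reverse order and flipped: position
      \<open>j\<close> behind \<open>B\<close> belongs to dart \<open>i\<close>, run from
      \<open>x = (i + 1) / l1\<close> down to \<open>x = i / l1\<close>.\<close>
    define i where "i = length A - 1 - j"
    have i: "i < length A" "real i = l1 - 1 - real j"
      using j by (auto simp: i_def of_nat_diff)
    define x where "x = (l1 - real j - s) / l1"
    have l1: "l1 > 0" using j(1) by (metis gr_implies_not0 neq0_conv of_nat_0_less_iff)
    have lx: "l1 * x = real i + (1 - s)" using l1 i by (simp add: x_def)
    have x: "x \<in> {0..1}" using s l1 j by (auto simp: x_def field_simps)
    have "2 * pi * (real k + s) / m = 2 * pi - 2 * pi * (l1 * x / m)"
    proof -
      have "real k + s = m - l1 * x"
        unfolding lx i(2) m_def j(2) by simp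
      thus ?thesis using m by (simp add: diff_divide_distrib right_diff_distrib)
    qed
    hence "cis (2 * pi * (real k + s) / m) = cis (2 * pi + - (2 * pi * (l1 * x / m)))"
      by simp
    also have "\<dots> = cis (- (2 * pi * (l1 * x / m)))"
      unfolding cis_mult[symmetric] by simp
    finally have "cis (2 * pi * (real k + s) / m) = chord_map (length A) (length B) (x, 0)"
      by (simp add: chord_map_0[OF l2_ge(2)] m_def)
    hence "fm (cis (2 * pi * (real k + s) / m)) = F (k0 + l1 * x, 0)"
      using fm_chord_map[of "(x, 0)"] x F1_sq_bot[OF x] by simp
    also have "\<dots> = dart_pt D (dsA ! i) (1 - s)"
      using F_bot_A(1)[OF i(1), of "1 - s"] s by (simp add: lx add.assoc)
    also have "\<dots> = dart_pt D' (flip_dart (dsA ! i)) s"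
      using old_dart_pt[OF F_bot_A(2)[OF i(1) s]] by simp
    also have "flip_dart (dsA ! i) = fbdry D' M ! k"
      using j i_def by (simp add: D'_simps(5) nth_append new_darts_simps rev_nth lengths(1-3))
    finally show ?thesis
      unfolding len .
  qed
qed

lemma new_open_edge: "open_edge D' (N + i) = top ` {k0 + real i<..<k0 + real i + 1}"
proof -
  have "{k0 + real i<..<k0 + real i + 1} = (\<lambda>s. k0 + real i + s) ` {0<..<1}"
  proof
    show "{k0 + real i<..<k0 + real i + 1} \<subseteq> (\<lambda>s. k0 + real i + s) ` {0<..<1}"
      by (intro subsetI image_eqI[of _ _ "x - (k0 + real i)" for x]) auto
  qed auto
  thus ?thesis
    by (simp add: open_edge_def D'_simps image_image)
qed

lemma new_open_face: "open_face D' M = F1 ` Tin"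
  by (simp add: open_face_def D'_simps fm_ball)

lemma skeleton1_D': "skeleton1 D' = skeleton1 D \<union> top ` {k0<..<k0 + l2}"
proof -
  have new: "(\<Union>e\<in>{N..<N + length B}. open_edge D' e) = (\<Union>i<length B. top ` {k0 + real i<..<k0 + real i + 1})"
  proof -
    have "{N..<N + length B} = (\<lambda>i. N + i) ` {..<length B}"
      using image_add_atLeastLessThan[of N 0 "length B"] by (simp add: atLeast0LessThan add.commute)
    thus ?thesis by (simp add: new_open_edge)
  qed
  have dec: "{k0<..<k0 + l2} = (\<lambda>i. k0 + real i) ` {1..<length B} \<union>
      (\<Union>i<length B. {k0 + real i<..<k0 + real i + 1})" (is "?l = ?r")
  proof
    show "?l \<subseteq> ?r"
    proof
      fix th assume th: "th \<in> ?l"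
      then obtain k s where ks: "k < length B" "s \<in> {0..<1}" "th - k0 = real k + s"
        using nat_floor_decomp[of "th - k0" "length B"] by auto
      show "th \<in> ?r"
      proof (cases "s = 0")
        case True
        hence "th = k0 + real k" "k \<ge> 1" using ks th by auto
        thus ?thesis using ks by auto
      next
        case False
        hence "th \<in> {k0 + real k<..<k0 + real k + 1}" using ks by auto
        thus ?thesis using ks by blast
      qed
    qed
    have "k0 + real i + 1 \<le> k0 + l2" if "i < length B" for i
      using that by simp
    thus "?r \<subseteq> ?l" by fastforce
  qed
  have "(\<Union>e\<in>edges D. open_edge D' e) = (\<Union>e\<in>edges D. open_edge D e)"
    using subdiagram_open(1)[OF sub] by simp
  thus ?thesis
    unfolding skeleton1_def D'_simps UN_Un new dec by (simp add: image_Un image_UN image_image) blast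
qed

lemma F1_T_split: "F1 ` Tpos = F1 ` Tin \<union> top ` {k0<..<k0 + l2}"
proof -
  have "Tpos = Tin \<union> (\<lambda>th. (th, bump th)) ` {k0<..<k0 + l2}"
    using bump_pos by (auto simp: Tpos_def Tin_def)
  thus ?thesis
    by (simp add: image_Un image_image top_def)
qed

lemma space_D'_pos: "space_of D' = space_of D \<union> F1 ` Tpos"
proof -
  have "(\<Union>f\<in>faces D. open_face D' f) = (\<Union>f\<in>faces D. open_face D f)"
    using subdiagram_open(2)[OF sub] by simp
  thus ?thesis
    unfolding space_of_def skeleton1_D' D'_simps F1_T_split by (simp add: new_open_face) blast
qed

lemma space_D': "space_of D' = space_of D \<union> F1 ` T"
proof -
  have "F1 w \<in> space_of D" if "snd w = 0" "fst w \<in> {k0..k0 + l2}" for w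
    using F1_bot_space[of "fst w"] that n'_pos by (cases w) auto
  hence "F1 ` T \<subseteq> space_of D \<union> F1 ` Tpos"
    using T_cases by blast
  thus ?thesis
    using space_D'_pos Tpos_T(1) by blast
qed

lemma compact_space': "compact (space_of D')"
  unfolding space_D' by (intro compact_Un compact_space compact_continuous_image[OF F1_T_cont compact_T])

lemma Tpos_disjoint: "F1 ` Tpos \<inter> space_of D = {}"
  using F1_Tpos_out by blast

lemma Tin_top_disjoint: "F1 ` Tin \<inter> top ` {k0<..<k0 + l2} = {}"
proof -
  have False if w: "w \<in> Tin" and th: "th \<in> {k0<..<k0 + l2}" and "F1 w = top th" for w th
  proof -
    have "w = (th, bump th)"
      using that Tpos_T(2) top_Tpos[of th] by (intro inj_onD[OF F1_inj_Tpos]) (auto simp: top_def)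
    thus False using w by (simp add: Tin_def)
  qed
  thus ?thesis by blast
qed

lemma top_range: "i < length B \<Longrightarrow> {k0 + real i<..<k0 + real i + 1} \<subseteq> {k0<..<k0 + l2}"
proof -
  assume "i < length B"
  hence "k0 + real i + 1 \<le> k0 + l2" by simp
  thus ?thesis by auto
qed

lemma new_open_edge_Tpos: "i < length B \<Longrightarrow> open_edge D' (N + i) \<subseteq> F1 ` Tpos"
  using top_range[of i] by (auto simp: new_open_edge F1_T_split)

lemma edge_D'_cases:
  assumes "e \<in> edges D'"
  obtains "e \<in> edges D" | i where "i < length B" "e = N + i"
proof (cases "e \<in> edges D")
  case False
  hence "e - N < length B" "e = N + (e - N)" using assms by (auto simp: D'_simps)
  thus ?thesis using that by blast
qed (use that in blast)

text \<open>Every new open cell and every new vertex is the image of a subset of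
  \<open>Tpos\<close>. There \<open>F1\<close> is injective and avoids the old diagram, so
  disjointness can be checked in the strip.\<close>

lemma planar': "planar_complex D'"
proof -
  have fin: "finite (verts D')" "finite (edges D')" "finite (faces D')"
    using planar_complex_finiteD[OF planar] by (simp_all add: D'_simps)
  have edges: "continuous_on {0..1} (emap D' e) \<and> inj_on (emap D' e) {0<..<1} \<and>
        emap D' e 0 \<in> verts D' \<and> emap D' e 1 \<in> verts D'" if "e \<in> edges D'" for e
    using that
  proof (cases rule: edge_D'_cases)
    case 1
    hence "emap D' e = emap D e" "verts D \<subseteq> verts D'" using sub by (auto simp: subdiagram_def)
    thus ?thesis using planar_complex_edgeD(1-4)[OF planar 1] by auto
  next
    case (2 i)
    have i1: "k0 + real i + 1 \<le> k0 + l2" using 2 by simp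
    have "continuous_on {0..1} (\<lambda>s. top (k0 + real i + s))"
      using i1 n'_pos by (intro continuous_on_compose2[OF top_cont] continuous_intros) auto
    moreover have "inj_on (\<lambda>s. top (k0 + real i + s)) {0<..<1}"
    proof (rule inj_onI)
      fix a b :: real assume "a \<in> {0<..<1}" "b \<in> {0<..<1}" "top (k0 + real i + a) = top (k0 + real i + b)"
      hence "k0 + real i + a = k0 + real i + b"
        using i1 by (intro inj_onD[OF top_inj]) auto
      thus "a = b" by simp
    qed
    moreover have "top (k0 + real i + 1) \<in> verts D'"
      using top_vert[of "Suc i"] 2 by (simp add: add.commute add.left_commute)
    ultimately show ?thesis
      using top_vert[of i] 2 by (simp add: D'_simps(6))
  qed
  have faces: "continuous_on (cball 0 1) (fmap D' f) \<and> inj_on (fmap D' f) (ball 0 1) \<and>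
        fbdry D' f \<noteq> [] \<and> (\<exists>v. edge_path D' v (fbdry D' f) v) \<and>
        circle_follows D' (fmap D' f) (fbdry D' f)" if "f \<in> faces D'" for f
  proof (cases "f = M")
    case True
    have "fbdry D' M \<noteq> []" using l2_ge(5) by (simp add: D'_simps new_darts_def)
    thus ?thesis
      using True fm_cont fm_inj fbdry_path fm_follows by (auto simp: D'_simps(4))
  next
    case False
    hence f: "f \<in> faces D" using that by (simp add: D'_simps)
    hence eq: "fmap D' f = fmap D f" "fbdry D' f = fbdry D f"
      using sub by (auto simp: subdiagram_def)
    note fD = planar_complex_faceD[OF planar f]
    obtain v where v: "edge_path D v (fbdry D f) v" using fD(4) by blast
    have "fst (fbdry D f ! k) \<in> edges D" if "k < length (fbdry D f)" for k
      using edge_path_edges[OF v] that by (auto simp: image_subset_iff)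
    hence "circle_follows D' (fmap D f) (fbdry D f)"
      using fD(5) old_dart_pt by (simp add: circle_follows_def)
    thus ?thesis
      unfolding eq using fD(1-3) subdiagram_edge_path[OF sub v] by blast
  qed
  have verts_disj: "verts D' \<inter> open_edge D' e = {}" if "e \<in> edges D'" for e
    using that
  proof (cases rule: edge_D'_cases)
    case 1
    have "open_edge D e \<subseteq> space_of D" using skeleton1_space(1)[of D] skeleton1_space(3)[OF 1] by blast
    moreover have "(\<lambda>i. top (k0 + real i)) ` {1..<length B} \<subseteq> F1 ` Tpos"
      by (auto simp: F1_T_split)
    ultimately show ?thesis
      using planar_complex_edgeD(5)[OF planar 1] Tpos_disjoint subdiagram_open(1)[OF sub 1]
      by (simp add: D'_simps) blast
  next
    case (2 i)
    have "verts D \<inter> open_edge D' e = {}"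
      using new_open_edge_Tpos[OF 2(1)] Tpos_disjoint skeleton1_space(1,2)[of D] 2 by blast
    moreover have "top (k0 + real j) \<notin> open_edge D' e" if j: "j \<in> {1..<length B}" for j
    proof
      assume "top (k0 + real j) \<in> open_edge D' e"
      then obtain th where th: "th \<in> {k0 + real i<..<k0 + real i + 1}" "top (k0 + real j) = top th"
        using 2 by (auto simp: new_open_edge)
      hence "k0 + real j = th"
        using j top_range[OF 2(1)] by (intro inj_onD[OF top_inj]) auto
      hence "real i < real j" "real j < real (Suc i)" using th by auto
      thus False by simp
    qed
    ultimately show ?thesis
      by (auto simp: D'_simps(1))
  qed
  have face_disj: "skeleton1 D' \<inter> open_face D' f = {}" if "f \<in> faces D'" for f
  proof (cases "f = M")
    case True
    thus ?thesis
      using Tin_top_disjoint Tpos_disjoint Tpos_T(2) skeleton1_space(1)[of D]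
      unfolding True new_open_face skeleton1_D' by blast
  next
    case False
    hence f: "f \<in> faces D" using that by (simp add: D'_simps)
    have "open_face D f \<subseteq> space_of D" using skeleton1_space(4)[OF f] .
    thus ?thesis
      using planar_complex_faceD(6)[OF planar f] Tpos_disjoint subdiagram_open(2)[OF sub f]
      unfolding skeleton1_D' F1_T_split by auto
  qed
  have "disjoint_family_on (open_edge D') (edges D')"
    unfolding disjoint_family_on_def
  proof (intro ballI impI)
    have mixed: "open_edge D' e \<inter> open_edge D' (N + i) = {}" if "e \<in> edges D" "i < length B" for e i
      using new_open_edge_Tpos[OF that(2)] Tpos_disjoint skeleton1_space(1)[of D] skeleton1_space(3)[OF that(1)]
        subdiagram_open(1)[OF sub that(1)] by blast
    fix e e' assume e: "e \<in> edges D'" "e' \<in> edges D'" "e \<noteq> e'"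
    show "open_edge D' e \<inter> open_edge D' e' = {}"
      using e(1)
    proof (cases rule: edge_D'_cases)
      case 1
      show ?thesis
        using e(2)
      proof (cases rule: edge_D'_cases)
        case 1
        thus ?thesis
          using \<open>e \<in> edges D\<close> e(3) planar_complex_disjointD(1)[OF planar] subdiagram_open(1)[OF sub]
          by (simp add: disjoint_family_on_def)
      qed (use mixed 1 in blast)
    next
      case (2 i)
      show ?thesis
        using e(2)
      proof (cases rule: edge_D'_cases)
        case 1
        thus ?thesis using mixed 2 by blast
      next
        case (2 j)
        have "{k0 + real i<..<k0 + real i + 1} \<inter> {k0 + real j<..<k0 + real j + 1} = {}"
        proof -
          have "i \<noteq> j" using \<open>e = N + i\<close> 2 e by simp
          hence "real i + 1 \<le> real j \<or> real j + 1 \<le> real i" by linarith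
          thus ?thesis by auto
        qed
        thus ?thesis
          using inj_on_image_Int[OF top_inj top_range[OF \<open>i < length B\<close>] top_range[OF 2(1)]]
          by (simp add: \<open>e = N + i\<close> 2 new_open_edge)
      qed
    qed
  qed
  moreover have "disjoint_family_on (open_face D') (faces D')"
    unfolding disjoint_family_on_def
  proof (intro ballI impI)
    have mixed: "open_face D' f \<inter> open_face D' M = {}" if "f \<in> faces D" for f
      using skeleton1_space(4)[OF that] Tpos_disjoint Tpos_T(2) subdiagram_open(2)[OF sub that]
      unfolding new_open_face by blast
    have old: "open_face D' f \<inter> open_face D' f' = {}" if "f \<in> faces D" "f' \<in> faces D" "f \<noteq> f'" for f f'
      using that planar_complex_disjointD(2)[OF planar] subdiagram_open(2)[OF sub]
      by (simp add: disjoint_family_on_def)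
    fix f f' assume "f \<in> faces D'" "f' \<in> faces D'" "f \<noteq> f'"
    thus "open_face D' f \<inter> open_face D' f' = {}"
      using mixed old unfolding D'_simps(3) by blast
  qed
  ultimately show ?thesis
    unfolding planar_complex_def using fin edges faces verts_disj face_disj by blast
qed

lemma reach': "reachable D'"
  unfolding reachable_def
proof
  fix v assume "v \<in> verts D'"
  then consider "v \<in> verts D" | i where "i < length B" "v = top (k0 + real i)"
    by (auto simp: D'_simps)
  thus "\<exists>ds. edge_path D' (basept D') ds v"
  proof cases
    case 1
    then obtain es where "edge_path D 0 es v"
      using reach basept by (auto simp: reachable_def)
    thus ?thesis
      using subdiagram_edge_path[OF sub] by (auto simp: D'_simps(8))
  next
    case (2 i)
    have "edge_path D' 0 (dsP @ map (\<lambda>i. (N + i, True)) [0..<i]) v"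
      using edge_path_appendI[OF subdiagram_edge_path[OF sub dsP_path]] new_edge_path[of 0 i] top_k0 2
      by auto
    thus ?thesis by (auto simp: D'_simps(8))
  qed
qed

section \<open>The new collar: the strip above the graph of \<open>bump\<close>, stretched back to
  full height\<close>

definition F' :: "real \<times> real \<Rightarrow> complex" where
  "F' q = F1 (fst q, bump (fst q) + snd q * (1 - bump (fst q)))"

lemma lift_range:
  assumes "y \<in> {0..1}"
  shows "bump th + y * (1 - bump th) \<in> {0..1}" "bump th + y * (1 - bump th) \<ge> bump th"
proof -
  have "y * (1 - bump th) \<le> 1 * (1 - bump th)" "0 \<le> y * (1 - bump th)"
    using assms bump_less_1[of th] by (auto intro!: mult_right_mono)
  thus "bump th + y * (1 - bump th) \<in> {0..1}" "bump th + y * (1 - bump th) \<ge> bump th"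
    using bump_nonneg[of th] by auto
qed

lemma lift_greater:
  assumes "y \<in> {0<..1}"
  shows "bump th + y * (1 - bump th) > bump th"
  using assms bump_less_1[of th] by simp

lemma F'_bot: "F' (th, 0) = top th"
  by (simp add: F'_def top_def)

lemma F'_cont: "continuous_on ({0..real (length ds') + 1} \<times> {0..1}) F'"
  unfolding F'_def length_ds'(1)
  by (intro continuous_on_compose2[OF F1_cont] continuous_intros continuous_on_bump)
    (use lift_range in auto)

lemma bump_ends: "bump 0 = 0" "bump (n' + 1) = 0"
  using n'_pos by (auto intro: bump_low bump_high)

lemma F'_per: "y \<in> {0..1} \<Longrightarrow> F' (real (length ds') + 1, y) = F' (0, y)"
  using F1_per[of y] by (simp add: F'_def length_ds'(1) bump_ends)

lemma F'_inj: "inj_on F' ({0..<real (length ds') + 1} \<times> {0<..1})"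
proof (rule inj_onI)
  fix p q assume p: "p \<in> {0..<real (length ds') + 1} \<times> {0<..1}"
    and q: "q \<in> {0..<real (length ds') + 1} \<times> {0<..1}" and eq: "F' p = F' q"
  have pos: "bump (fst r) + snd r * (1 - bump (fst r)) \<in> {0<..1}"
    if "r \<in> {0..<real (length ds') + 1} \<times> {0<..1}" for r :: "real \<times> real"
    using that lift_range(1)[of "snd r" "fst r"] lift_greater[of "snd r" "fst r"] bump_nonneg[of "fst r"]
    by (cases r) auto
  have "(fst p, bump (fst p) + snd p * (1 - bump (fst p))) = (fst q, bump (fst q) + snd q * (1 - bump (fst q)))"
    using eq pos[OF p] pos[OF q] p q unfolding F'_def
    by (intro inj_onD[OF F1_inj]) (auto simp: length_ds'(1))
  hence "fst p = fst q" "snd p * (1 - bump (fst p)) = snd q * (1 - bump (fst p))"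
    by auto
  thus "p = q"
    using bump_less_1[of "fst p"] by (simp add: prod_eq_iff)
qed

lemma F'_out:
  assumes th: "th \<in> {0..real (length ds') + 1}" and y: "y \<in> {0<..1}"
  shows "F' (th, y) \<notin> space_of D'"
proof
  define h where "h = bump th + y * (1 - bump th)"
  have h: "h > bump th" "h \<in> {0<..1}"
    using lift_greater[OF y, of th] lift_range(1)[of y th] y bump_nonneg[of th] by (auto simp: h_def)
  assume "F' (th, y) \<in> space_of D'"
  hence "F1 (th, h) \<in> space_of D'"
    by (simp add: F'_def h_def)
  moreover have "F1 (th, h) \<notin> space_of D"
    using F1_out[of th h] th h by (simp add: length_ds'(1))
  ultimately obtain w where w: "w \<in> Tpos" "F1 (th, h) = F1 w"
    unfolding space_D'_pos by blast
  \<comment> \<open>The two vertical ends of the strip are identified, and injectivity holds only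
    without the right one.\<close>
  define th0 where "th0 = (if th = n' + 1 then 0 else th)"
  have "F1 (th0, h) = F1 w"
    using w(2) F1_per[of h] h by (auto simp: th0_def)
  hence "(th0, h) = w"
    using th h n'_pos by (intro F1_eq_Tpos[OF w(1)]) (auto simp: th0_def length_ds'(1))
  hence "h \<le> bump th0"
    using w(1) by (auto simp: Tpos_def)
  moreover have "bump th0 = bump th"
    by (simp add: th0_def bump_ends)
  ultimately show False
    using h by simp
qed

lemma F'_top: "th \<in> {0..real (length ds') + 1} \<Longrightarrow>
    F' (th, 1) = 2 * cis (2 * pi * (th / (real (length ds') + 1)))"
  using F1_top[of th] by (simp add: F'_def length_ds'(1))

lemma ds'_nth: "k < length P \<Longrightarrow> ds' ! k = ds ! k"
  "i < length B \<Longrightarrow> ds' ! (length P + i) = (N + i, True)"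
  "k < length S \<Longrightarrow> ds' ! (length P + length B + k) = ds ! (length P + length A + k)"
proof -
  show "ds' ! k = ds ! k" if "k < length P"
    using that by (simp add: ds'_def nth_append lengths(1)) (simp add: dsP_def)
  show "ds' ! (length P + i) = (N + i, True)" if "i < length B"
    using that by (simp add: ds'_def nth_append lengths(1) new_darts_simps)
  show "ds' ! (length P + length B + k) = ds ! (length P + length A + k)" if "k < length S"
    using that length_bw bw_eq by (simp add: ds'_def nth_append lengths(1) new_darts_simps(1)) (simp add: dsS_def)
qed

lemma pos_cases [consumes 1, case_names left new right]:
  assumes "k < length (P @ B @ S)"
  obtains "k < length P" | i where "i < length B" "k = length P + i"
  | i where "i < length S" "k = length P + length B + i"
proof -
  consider "k < length P" | "length P \<le> k" "k < length P + length B" | "length P + length B \<le> k"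
    by linarith
  thus ?thesis
  proof cases
    case 2
    thus ?thesis using that(2)[of "k - length P"] by simp
  next
    case 3
    thus ?thesis using that(3)[of "k - (length P + length B)"] assms by simp
  qed (use that in blast)
qed

lemma F'_left: "k < length P \<Longrightarrow> s \<in> {0..1} \<Longrightarrow> F' (real k + s, 0) = F (real k + s, 0)"
proof -
  assume "k < length P" "s \<in> {0..1}"
  moreover from this have "real k + 1 \<le> k0" by simp
  ultimately show ?thesis
    unfolding F'_bot by (intro top_low) auto
qed

lemma F'_right: "s \<in> {0..1} \<Longrightarrow>
    F' (real (length P + length B + i) + s, 0) = F (real (length P + length A + i) + s, 0)"
  unfolding F'_bot by (subst top_high) (auto simp: algebra_simps)

lemma F'_bot_dart:
  assumes "k < length ds'" "s \<in> {0..1}"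
  shows "F' (real k + s, 0) = dart_pt D' (ds' ! k) s"
proof -
  have "k < length (P @ B @ S)"
    using assms length_ds'(2) by simp
  thus ?thesis
  proof (cases rule: pos_cases)
    case left
    have k: "k < length ds" using left length_bw bw_eq by simp
    show ?thesis
      using F'_left[OF left assms(2)] F_bot[OF k assms(2)] old_dart_pt[OF dart_edges[OF k]]
      by (simp add: ds'_nth(1)[OF left])
  next
    case (new i)
    thus ?thesis
      using new_dart_pt[of i s] by (simp add: ds'_nth(2) F'_bot del: dart_pt.simps)
  next
    case (right i)
    have k: "length P + length A + i < length ds" using right length_bw bw_eq by simp
    show ?thesis
      using F'_right[OF assms(2), of i] F_bot[OF k assms(2)] old_dart_pt[OF dart_edges[OF k]]
      by (simp add: right ds'_nth(3))
  qed
qed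

lemma F'_dummy:
  assumes "th \<in> {real (length ds')..real (length ds') + 1}"
  shows "F' (th, 0) = 0"
proof -
  have "th \<ge> k0 + l2" "th - l2 + l1 \<in> {n..n + 1}"
    using assms n'_pos by (auto simp: length_ds'(1))
  thus ?thesis
    using top_high F_dummy by (simp add: F'_bot)
qed

section \<open>The contraction of the enlarged diagram\<close>

text \<open>\<open>pull\<close> moves parallel to the left slope of \<open>bump\<close>, which therefore slides along itself.\<close>

definition pull :: "real \<times> real \<Rightarrow> real \<Rightarrow> real \<times> real" where
  "pull w t = (fst w - t * (l2 * snd w), (1 - t) * snd w)"

lemma pull_0 [simp]: "pull w 0 = w"
  by (simp add: pull_def)

lemma pull_bot: "snd w = 0 \<Longrightarrow> pull w t = w"
  by (simp add: pull_def prod_eq_iff)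

lemma pull_T:
  assumes "w \<in> T" "t \<in> {0..1}"
  shows "pull w t \<in> T"
proof -
  obtain th y where w: "w = (th, y)" by fastforce
  have ty: "0 \<le> t * y" "t * y \<le> y"
    using assms by (auto simp: w T_def intro: mult_left_le_one_le)
  have y: "0 \<le> y" "y \<le> bump th" "k0 \<le> th" "th \<le> k0 + l2"
    using assms by (auto simp: w T_def)
  have "l2 * (t * y) \<le> th - k0"
    using bump_le[OF y(3)] mult_left_mono[of "t * y" "bump th" l2] ty y by linarith
  moreover have "0 \<le> l2 * (t * y)"
    using ty by simp
  moreover have "bump th - t * y \<le> bump (th - l2 * (t * y))"
    using ty y by (intro bump_shift) auto
  hence "(1 - t) * y \<le> bump (th - l2 * (t * y))"
    using y by (simp add: algebra_simps)
  moreover have "0 \<le> (1 - t) * y"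
    using assms y by simp
  ultimately show ?thesis
    using y by (simp add: w pull_def T_def mult.left_commute)
qed

lemma pull_top:
  assumes "0 \<le> x" "x \<le> l2 - 1" "t \<in> {0..1}"
  shows "F1 (pull (k0 + x, bump (k0 + x)) t) = top (k0 + (1 - t) * x)"
proof -
  have b: "bump (k0 + x) = x / l2"
    using assms by (subst bump_rise) auto
  have "(1 - t) * x \<le> 1 * x"
    using assms by (intro mult_right_mono) auto
  hence b': "bump (k0 + (1 - t) * x) = (1 - t) * x / l2"
    using assms by (subst bump_rise) auto
  show ?thesis
    unfolding pull_def b top_def b' using l2_ge(3) by (simp add: algebra_simps)
qed

definition retr :: "complex \<times> real \<Rightarrow> complex" where
  "retr qt = (if fst qt \<in> space_of D then fst qt else F1 (pull (inv_into Tpos F1 (fst qt)) (snd qt)))"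

lemma retr_old: "q \<in> space_of D \<Longrightarrow> retr (q, t) = q"
  by (simp add: retr_def)

lemma F1_T_bot: "w \<in> T \<Longrightarrow> snd w = 0 \<Longrightarrow> F1 w \<in> space_of D"
  using F1_bot_space[of "fst w"] T_dom(2) by (cases w) auto

text \<open>\<open>inv_into\<close> recovers the coordinates only off the bottom.
  \<open>pull\<close> fixes the bottom, so there the other clause of \<open>retr\<close> gives the
  same value.\<close>

lemma retr_F1:
  assumes "w \<in> T"
  shows "retr (F1 w, t) = F1 (pull w t)"
  using T_cases[OF assms]
proof
  assume w: "w \<in> Tpos"
  thus ?thesis
    using F1_Tpos_out[OF w] inv_into_f_f[OF F1_inj_Tpos w] by (simp add: retr_def)
next
  assume "snd w = 0 \<and> fst w \<in> {k0..k0 + l2}"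
  thus ?thesis
    using F1_T_bot[OF assms] by (simp add: retr_old pull_bot)
qed

lemma pull_1_bot: "w \<in> T \<Longrightarrow> F1 (pull w 1) \<in> space_of D"
  by (intro F1_T_bot pull_T) (auto simp: pull_def)

lemma space_D'_cases [consumes 1, case_names old new]:
  assumes "q \<in> space_of D'"
  obtains "q \<in> space_of D" | w where "w \<in> T" "q = F1 w"
  using assms unfolding space_D' by blast

lemma retr_space: "q \<in> space_of D' \<Longrightarrow> t \<in> {0..1} \<Longrightarrow> retr (q, t) \<in> space_of D'"
proof -
  assume q: "q \<in> space_of D'" and t: "t \<in> {0..1}"
  show ?thesis
    using q
  proof (cases rule: space_D'_cases)
    case (new w)
    thus ?thesis using pull_T[of w t] t by (simp add: retr_F1 space_D')
  qed (simp add: retr_old space_D')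
qed

lemma retr_1: "q \<in> space_of D' \<Longrightarrow> retr (q, 1) \<in> space_of D"
  by (erule space_D'_cases) (simp_all add: retr_old retr_F1 pull_1_bot)

lemma retr_0: "q \<in> space_of D' \<Longrightarrow> retr (q, 0) = q"
  by (cases rule: space_D'_cases) (auto simp: retr_old retr_F1)

text \<open>Continuity of \<open>inv_into\<close> is avoided: lifted to \<open>T\<close> the map is
  a formula, which descends to the image of \<open>T\<close> by compactness; this image and the old
  diagram are closed, so the two pieces fit together.\<close>

lemma retr_cont: "continuous_on (space_of D' \<times> {0..1}) retr"
proof -
  let ?X = "space_of D \<times> {0..1 :: real}" and ?Y = "(F1 ` T) \<times> {0..1 :: real}"
  have "continuous_on ?X retr"
    by (rule continuous_on_eq[OF continuous_on_fst[OF continuous_on_id]]) (auto simp: retr_old)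
  moreover have "continuous_on ?Y retr"
  proof -
    let ?m = "\<lambda>wt. (F1 (fst wt), snd wt)"
    have c: "continuous_on (T \<times> {0..1}) ?m"
      by (intro continuous_intros continuous_on_compose2[OF F1_T_cont]) auto
    have "continuous_on (T \<times> {0..1}) (\<lambda>wt. F1 (pull (fst wt) (snd wt)))"
      unfolding pull_def
      by (intro continuous_on_compose2[OF F1_T_cont] continuous_intros)
        (use pull_T in \<open>auto simp: pull_def\<close>)
    hence "continuous_on (T \<times> {0..1}) (retr \<circ> ?m)"
      by (rule continuous_on_eq) (auto simp: retr_F1)
    moreover have "compact (T \<times> {0..1 :: real})"
      by (intro compact_Times compact_T compact_Icc)
    ultimately have "continuous_on (?m ` (T \<times> {0..1})) retr"
      using continuous_on_compact_quotient[OF _ c] by blast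
    moreover have "?m ` (T \<times> {0..1}) = ?Y"
      by force
    ultimately show ?thesis by simp
  qed
  moreover have "closed ?X" "closed ?Y"
    by (intro closed_Times compact_imp_closed compact_space closed_atLeastAtMost
        compact_continuous_image[OF F1_T_cont compact_T])+
  ultimately have "continuous_on (?X \<union> ?Y) retr"
    by (intro continuous_on_closed_Un)
  moreover have "?X \<union> ?Y = space_of D' \<times> {0..1}"
    by (auto simp: space_D')
  ultimately show ?thesis by simp
qed

definition Phi' :: "complex \<times> real \<Rightarrow> complex" where
  "Phi' qt = (if snd qt \<le> 1 then retr qt else Phi (retr (fst qt, 1), snd qt - 1))"

lemma Phi'_early: "t \<le> 1 \<Longrightarrow> Phi' (q, t) = retr (q, t)"
  by (simp add: Phi'_def)

lemma Phi'_late: "q \<in> space_of D' \<Longrightarrow> t \<ge> 1 \<Longrightarrow> Phi' (q, t) = Phi (retr (q, 1), t - 1)"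
  using Phi_0[OF retr_1] by (cases "t = 1") (auto simp: Phi'_def)

lemma Phi'_old: "q \<in> space_of D \<Longrightarrow> Phi' (q, t) = Phi (q, max 0 (t - 1))"
  using Phi_0 by (auto simp: Phi'_def retr_old max_def)

lemma Phi'_cont: "continuous_on (space_of D' \<times> {0..}) Phi'"
proof -
  let ?X = "space_of D' \<times> {0..1 :: real}" and ?Y = "space_of D' \<times> {1 :: real..}"
  have "continuous_on ?X Phi'"
    by (rule continuous_on_eq[OF retr_cont]) (auto simp: Phi'_early)
  moreover have "continuous_on ?Y Phi'"
  proof -
    have "continuous_on ?Y (\<lambda>qt. retr (fst qt, 1))"
      by (intro continuous_on_compose2[OF retr_cont] continuous_intros) auto
    hence "continuous_on ?Y (\<lambda>qt. Phi (retr (fst qt, 1), snd qt - 1))"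
      by (intro continuous_on_compose2[OF Phi_cont] continuous_intros) (auto simp: retr_1)
    thus ?thesis
      by (rule continuous_on_eq) (auto simp: Phi'_late)
  qed
  moreover have "closed ?X" "closed ?Y"
    by (intro closed_Times compact_imp_closed compact_space' closed_atLeastAtMost closed_atLeast)+
  ultimately have "continuous_on (?X \<union> ?Y) Phi'"
    by (intro continuous_on_closed_Un)
  moreover have "?X \<union> ?Y = space_of D' \<times> {0..}"
    by auto
  ultimately show ?thesis by simp
qed

lemma Phi'_space: "q \<in> space_of D' \<Longrightarrow> t \<ge> 0 \<Longrightarrow> Phi' (q, t) \<in> space_of D'"
  using retr_space[of q t] Phi_space[OF retr_1[of q], of "t - 1"] Phi'_late[of q t] Phi'_early[of t q]
    subdiagram_space_of[OF sub]
  by (cases "t \<le> 1") auto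

lemma Phi'_0: "q \<in> space_of D' \<Longrightarrow> Phi' (q, 0) = q"
  by (simp add: Phi'_early retr_0)

lemma Phi'_base: "t \<ge> 0 \<Longrightarrow> Phi' (0, t) = 0"
  using Phi_base by (simp add: Phi'_old base_space)

lemma Phi'_end: "\<exists>N\<ge>0. \<forall>q\<in>space_of D'. \<forall>t\<ge>N. Phi' (q, t) = 0"
proof -
  obtain N0 where N0: "N0 \<ge> 0" "\<forall>q\<in>space_of D. \<forall>t\<ge>N0. Phi (q, t) = 0"
    using Phi_end by blast
  have "Phi' (q, t) = 0" if "q \<in> space_of D'" "t \<ge> N0 + 1" for q t
    using that N0 Phi'_late[of q t] retr_1[of q] by auto
  thus ?thesis
    using N0(1) by (intro exI[of _ "N0 + 1"]) auto
qed

lemma Phi'_new_vert: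
  assumes "i < length B" "t \<ge> 0"
  shows "Phi' (top (k0 + real i), t) = (if t \<le> 1 then top (k0 + (1 - t) * real i)
      else Phi (F (k0, 0), t - 1))"
proof -
  have i: "real i \<le> l2 - 1" using assms by simp
  have T: "(k0 + real i, bump (k0 + real i)) \<in> T"
    using i by (intro top_T) auto
  have r: "retr (top (k0 + real i), t) = top (k0 + (1 - t) * real i)" if "t \<in> {0..1}" for t
    unfolding top_def[of "k0 + real i"] retr_F1[OF T] using that i by (intro pull_top) auto
  have "top (k0 + real i) \<in> space_of D'"
    using T by (auto simp: space_D' top_def)
  thus ?thesis
    using r[of t] r[of 1] assms(2) by (auto simp: Phi'_early Phi'_late top_k0(1))
qed

lemma Phi'_vert:
  assumes "v \<in> verts D'" "t \<ge> 0"
  shows "Phi' (v, t) \<in> skeleton1 D'"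
proof -
  have sk: "skeleton1 D \<subseteq> skeleton1 D'" by (rule subdiagram_skeleton1[OF sub])
  consider "v \<in> verts D" | i where "i \<in> {1..<length B}" "v = top (k0 + real i)"
    using assms by (auto simp: D'_simps)
  thus ?thesis
  proof cases
    case 1
    hence "v \<in> space_of D" using skeleton1_space(1,2) by blast
    thus ?thesis
      using Phi_vert[OF 1, of "max 0 (t - 1)"] sk Phi'_old by auto
  next
    case (2 i)
    have F0: "F (k0, 0) \<in> verts D"
      using F_bot_vert[of "length P"] length_bw bw_eq by simp
    have "top (k0 + (1 - t) * real i) \<in> skeleton1 D'" if "t \<le> 1"
    proof (cases "t = 1")
      case True
      thus ?thesis using F0 top_k0 sk skeleton1_space(2)[of D] by auto
    next
      case False
      have "(1 - t) * real i \<le> 1 * real i"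
        using assms by (intro mult_right_mono) auto
      moreover have "(1 - t) * real i > 0"
        using False that 2 by simp
      moreover have "real i < l2" using 2 by simp
      ultimately show ?thesis
        unfolding skeleton1_D' by auto
    qed
    thus ?thesis
      using Phi'_new_vert[of i t] 2 assms Phi_vert[OF F0, of "t - 1"] sk by auto
  qed
qed

text \<open>A point in the interior of an edge gets the label of the start of the edge, hence the rounding.\<close>

definition gp' :: "complex \<Rightarrow> 'h" where
  "gp' q = (if q \<in> space_of D then gp q
     else if \<exists>th\<in>{k0<..<k0 + l2}. q = top th
       then ev e0 (map fst (P @ take (nat \<lfloor>(THE th. th \<in> {k0<..<k0 + l2} \<and> q = top th) - k0\<rfloor>) B))
       else ev e0 (map fst P))"

lemma gp'_old: "q \<in> space_of D \<Longrightarrow> gp' q = gp q"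
  by (simp add: gp'_def)

lemma gp'_top:
  assumes "i < length B" "s \<in> {0..<1}"
  shows "gp' (top (k0 + real i + s)) = ev e0 (map fst (P @ take i B))"
proof (cases "real i + s = 0")
  case True
  hence 0: "i = 0" "s = 0" using assms by auto
  have "F (k0, 0) \<in> space_of D"
    using F_bot_vert[of "length P"] length_bw bw_eq skeleton1_space(1,2) by auto
  moreover have "gp (F (k0, 0)) = ev e0 (map fst P)"
    using gp_bot[of "length P"] length_bw bw_eq by simp
  ultimately show ?thesis
    using 0 by (simp add: top_k0 gp'_old)
next
  case False
  define th where "th = k0 + real i + s"
  have "real i + 1 \<le> l2" using assms by simp
  hence th: "th \<in> {k0<..<k0 + l2}"
    using False assms by (auto simp: th_def)
  have "top th \<notin> space_of D"
    using F1_Tpos_out[OF top_Tpos[of th]] th by (simp add: top_def)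
  moreover have "(THE th'. th' \<in> {k0<..<k0 + l2} \<and> top th = top th') = th"
    using th inj_onD[OF top_inj] by (intro the_equality) auto
  moreover have "nat \<lfloor>th - k0\<rfloor> = i"
  proof -
    have "\<lfloor>th - k0\<rfloor> = int i"
      using assms by (intro floor_unique) (auto simp: th_def)
    thus ?thesis by simp
  qed
  ultimately show ?thesis
    using th unfolding gp'_def th_def[symmetric] by auto
qed

text \<open>The end of \<open>B\<close> is an old vertex, labelled through \<open>A\<close>. That
  \<open>B\<close> leads to the same label is the consistency condition for extending the labelling,
  and it holds because the relator acts trivially.\<close>

lemma gp'_end: "gp' (top (k0 + l2)) = ev e0 (map fst (P @ B))"
proof -
  have "F (k0 + l1, 0) \<in> space_of D"
    using F_bot_vert[of "length P + length A"] length_bw bw_eq skeleton1_space(1,2) by auto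
  moreover have "gp (F (k0 + l1, 0)) = ev e0 (map fst (P @ A))"
    using gp_bot[of "length P + length A"] length_bw bw_eq by simp
  moreover have "ev g (map fst A) = ev g (map fst B)" for g
    using ev_relator_eq[OF rel] by simp
  ultimately show ?thesis
    by (simp add: top_k0 gp'_old)
qed

lemma gp'_top_vert: "i \<le> length B \<Longrightarrow> gp' (top (k0 + real i)) = ev e0 (map fst (P @ take i B))"
  using gp'_top[of i 0] gp'_end by (cases "i = length B") auto

lemma gp'_Tin: "q \<in> F1 ` Tin \<Longrightarrow> gp' q = ev e0 (map fst P)"
  using Tin_top_disjoint Tpos_disjoint Tpos_T(2) unfolding gp'_def by (auto simp: disjoint_iff)

lemma lbl': "labelling D' gp'"
  unfolding labelling_def
proof (intro conjI ballI)
  show "gp' (basept D') = e0"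
    using lbl basept by (simp add: D'_simps gp'_old base_space labelling_def)
next
  fix e assume e: "e \<in> edges D'"
  show "gp' (emap D' e 1) = act (elab D' e) (gp' (emap D' e 0))"
    using e
  proof (cases rule: edge_D'_cases)
    case 1
    have "emap D e 0 \<in> space_of D" "emap D e 1 \<in> space_of D"
      using planar_complex_edgeD(3,4)[OF planar 1] skeleton1_space(1,2) by blast+
    thus ?thesis
      using lbl sub 1 by (simp add: labelling_def subdiagram_def gp'_old)
  next
    case (2 i)
    have "gp' (emap D' e 1) = ev e0 (map fst (P @ take (Suc i) B))"
      using gp'_top_vert[of "Suc i"] 2 by (simp add: D'_simps add.commute add.left_commute)
    moreover have "gp' (emap D' e 0) = ev e0 (map fst (P @ take i B))"
      using gp'_top_vert[of i] 2 by (simp add: D'_simps)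
    moreover have "elab D' e = fst (B ! i)"
      using 2 by (simp add: D'_simps)
    ultimately show ?thesis
      using 2 by (simp add: take_Suc_conv_app_nth)
  qed
  fix q assume q: "q \<in> open_edge D' e"
  show "gp' q = gp' (emap D' e 0)"
    using e
  proof (cases rule: edge_D'_cases)
    case 1
    have "emap D e 0 \<in> space_of D"
      using planar_complex_edgeD(3,4)[OF planar 1] skeleton1_space(1,2) by blast
    moreover have "q \<in> open_edge D e" "emap D' e = emap D e"
      using q subdiagram_open(1)[OF sub 1] sub 1 by (auto simp: subdiagram_def)
    moreover have "q \<in> space_of D"
      using calculation skeleton1_space(1)[of D] skeleton1_space(3)[OF 1] by blast
    ultimately show ?thesis
      using lbl 1 by (simp add: labelling_def gp'_old)
  next
    case (2 i)
    then obtain th where "th \<in> {k0 + real i<..<k0 + real i + 1}" "q = top th"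
      using q by (auto simp: new_open_edge)
    thus ?thesis
      using gp'_top[of i "th - k0 - real i"] gp'_top_vert[of i] 2 by (simp add: D'_simps)
  qed
next
  fix f q assume f: "f \<in> faces D'" and q: "q \<in> open_face D' f"
  show "gp' q = gp' (dart_pt D' (hd (fbdry D' f)) 0)"
  proof (cases "f = M")
    case True
    have "hd (fbdry D' M) = (N + 0, True)"
      using l2_ge(5) by (simp add: D'_simps new_darts_def hd_map upt_conv_Cons)
    thus ?thesis
      using gp'_Tin[of q] q gp'_top_vert[of 0] new_dart_pt[of 0 0] True new_open_face
      by (simp del: dart_pt.simps)
  next
    case False
    hence f: "f \<in> faces D" using f by (simp add: D'_simps)
    hence eq: "fbdry D' f = fbdry D f" using sub by (simp add: subdiagram_def)
    have qD: "q \<in> open_face D f" "q \<in> space_of D"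
      using q subdiagram_open(2)[OF sub f] skeleton1_space(4)[OF f] by auto
    have hd: "fst (hd (fbdry D f)) \<in> edges D"
    proof -
      obtain v where "edge_path D v (fbdry D f) v" using planar_complex_faceD(4)[OF planar f] by blast
      thus ?thesis
        using edge_path_edges planar_complex_faceD(3)[OF planar f] hd_in_set by blast
    qed
    have "dart_pt D (hd (fbdry D f)) 0 \<in> space_of D"
      using dart_pt_in_verts(1)[OF planar hd] skeleton1_space(1,2) by blast
    thus ?thesis
      using lbl f qD old_dart_pt[OF hd] by (simp add: eq gp'_old labelling_def)
  qed
qed

section \<open>Distances and tracks in the enlarged diagram\<close>

lemma P_le: "length P \<le> length ds" "length P + length A \<le> length ds" "length P \<le> length bw"
  using length_bw bw_eq by simp_all

text \<open>A vertex weight bounds the whole track of the vertex; at time 0 the track is at the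
  vertex itself.\<close>

lemma vert_dist_start: "vert_dist D' (F (k0, 0)) \<le> end_weight P"
proof -
  have v: "F (k0, 0) \<in> verts D"
    using F_bot_vert P_le by simp
  hence "Phi (F (k0, 0), 0) = F (k0, 0)"
    using Phi_0 skeleton1_space(1,2) by blast
  hence "real (vert_dist D (F (k0, 0))) \<le> end_weight P"
    using vert_weight[of "length P" 0] P_le v bw_eq by (simp add: coarse_dist_vert)
  thus ?thesis
    using subdiagram_vert_dist[OF sub reach v] by linarith
qed

lemma vert_dist_top:
  assumes "i \<le> length B"
  shows "vert_dist D' (top (k0 + real i)) \<le> end_weight P + i"
  using vert_dist_edge_path[OF planar' reach' new_edge_path[of 0 i]] assms vert_dist_start
  by (simp add: top_k0)

lemma vert_dist_A:
  assumes "j \<le> length A"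
  shows "vert_dist D' (F (k0 + real j, 0)) \<le> end_weight P + j"
proof -
  have "edge_path D (F (k0, 0)) (take j (drop (length P) ds)) (F (k0 + real j, 0))"
    using edge_path_between[of "length P" "length P + j"] assms P_le by simp
  from vert_dist_edge_path[OF planar' reach' subdiagram_edge_path[OF sub this]]
  show ?thesis
    using vert_dist_start by simp
qed

lemma coarse_dist_top:
  assumes "i < length B" "s \<in> {0..1}"
  shows "coarse_dist D' (top (k0 + real i + s)) \<le> end_weight P + i + 1"
proof -
  have "fst (N + i, True) \<in> edges D'"
    using assms by (simp add: D'_simps)
  from coarse_dist_dart_le[OF planar' reach' this assms(2)]
  show ?thesis
    using vert_dist_top[of i] assms unfolding new_dart_pt by simp
qed

lemma A_point_cases:
  assumes "x \<in> {0..l1}"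
  obtains "A = []" "x = 0" | j s where "j < length A" "s \<in> {0..1}" "x = real j + s"
proof (cases "x = l1")
  case True
  thus ?thesis
    using that(1) that(2)[of "length A - 1" 1] by (cases "A = []") (auto simp: of_nat_diff Suc_leI)
next
  case False
  then obtain j s where "j < length A" "s \<in> {0..<1}" "x = real j + s"
    using nat_floor_decomp[of x "length A"] assms by auto
  thus ?thesis
    using that(2)[of j s] by auto
qed

lemma coarse_dist_A:
  assumes "x \<in> {0..l1}"
  shows "coarse_dist D' (F (k0 + x, 0)) \<le> end_weight P + K"
  using assms
proof (cases rule: A_point_cases)
  case 1
  have "F (k0, 0) \<in> verts D'"
    using F_bot_vert[OF P_le(1)] by (simp add: D'_simps)
  thus ?thesis
    using vert_dist_start 1 by (simp add: coarse_dist_vert)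
next
  case (2 j s)
  have "fst (dsA ! j) \<in> edges D'"
    using F_bot_A(2)[OF 2(1,2)] by (simp add: D'_simps)
  from coarse_dist_dart_le[OF planar' reach' this 2(2)]
  have "coarse_dist D' (F (k0 + real j + s, 0)) \<le> vert_dist D' (F (k0 + real j + 0, 0)) + 1"
    using F_bot_A[OF 2(1,2)] F_bot_A(1)[OF 2(1), of 0] old_dart_pt by simp
  also have "\<dots> \<le> end_weight P + real j + 1"
    using vert_dist_A[of j] 2 by simp
  also have "\<dots> \<le> end_weight P + K"
    using 2(1) face_size by simp
  finally show ?thesis
    by (simp add: 2 add.assoc)
qed

lemma face_dist_M: "face_dist D' M \<le> end_weight P + K"
proof (rule face_dist_le[OF planar'])
  show "M \<in> faces D'" by (simp add: D'_simps)
  fix d assume "d \<in> set (fbdry D' M)"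
  then consider i where "i < length B" "d = (N + i, True)" | j where "j < length A" "fst d = fst (dsA ! j)"
    by (auto simp: D'_simps new_darts_simps(3) in_set_conv_nth lengths(2))
  thus "edge_dist D' (fst d) \<le> real (end_weight P + K)"
  proof cases
    case (1 i)
    have "edge_dist D' (fst d) \<le> vert_dist D' (top (k0 + real i)) + 1/2"
      using edge_dist_dart_le[of D' d] new_dart_pt[of i 0] 1 by (simp del: dart_pt.simps)
    also have "\<dots> \<le> end_weight P + real i + 1/2"
      using vert_dist_top[of i] 1 by simp
    also have "\<dots> \<le> end_weight P + K"
      using 1 face_size by simp
    finally show ?thesis by simp
  next
    case (2 j)
    have "edge_dist D' (fst d) \<le> vert_dist D' (F (k0 + real j, 0)) + 1/2"
      using edge_dist_dart_le[of D' "dsA ! j"] F_bot_A[OF 2(1), of 0] old_dart_pt 2 by simp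
    also have "\<dots> \<le> end_weight P + real j + 1/2"
      using vert_dist_A[of j] 2 by simp
    also have "\<dots> \<le> end_weight P + K"
      using 2 face_size by simp
    finally show ?thesis by simp
  qed
qed

lemma top_point_cases:
  assumes "th \<in> {k0..<k0 + l2}"
  obtains i s where "i < length B" "s \<in> {0..<1}" "th = k0 + real i + s"
proof -
  obtain i s where "i < length B" "s \<in> {0..<1}" "th - k0 = real i + s"
    using nat_floor_decomp[of "th - k0" "length B"] assms by auto
  thus ?thesis
    using that[of i s] by auto
qed

lemma psi_range: "th \<in> {k0..k0 + l2} \<Longrightarrow> psi th - k0 \<in> {0..l1}"
  using l2_ge(3) mult_right_mono[of "th - k0" l2 l1] by (simp add: psi_mid divide_le_eq mult.commute)

lemma F1_T_cases:
  assumes "w \<in> T"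
  obtains x where "x \<in> {0..l1}" "F1 w = F (k0 + x, 0)"
    | th where "th \<in> {k0<..<k0 + l2}" "F1 w = top th" | "F1 w \<in> F1 ` Tin"
  using T_cases[OF assms]
proof
  assume "w \<in> Tpos"
  hence "F1 w \<in> F1 ` Tin \<union> top ` {k0<..<k0 + l2}"
    using F1_T_split by blast
  thus ?thesis using that by blast
next
  assume w: "snd w = 0 \<and> fst w \<in> {k0..k0 + l2}"
  hence "F1 w = F (k0 + (psi (fst w) - k0), 0)"
    using F1_bot[of "fst w"] by (cases w) simp
  thus ?thesis using that(1) psi_range w by blast
qed

text \<open>Walking along \<open>A\<close> or \<open>B\<close> from the first vertex of the cell
  takes fewer than \<open>K\<close> steps.\<close>

lemma coarse_dist_T:
  assumes "w \<in> T"
  shows "coarse_dist D' (F1 w) \<le> end_weight P + K"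
  using assms
proof (cases rule: F1_T_cases)
  case (1 x)
  thus ?thesis using coarse_dist_A by simp
next
  case (2 th)
  then obtain i s where ij: "i < length B" "s \<in> {0..<1}" "th = k0 + real i + s"
    using top_point_cases[of th] by auto
  have "coarse_dist D' (top th) \<le> end_weight P + i + 1"
    using coarse_dist_top[of i s] ij by auto
  thus ?thesis using ij face_size 2 by simp
next
  case 3
  thus ?thesis
    using coarse_dist_face[OF planar', of M "F1 w"] face_dist_M new_open_face by (simp add: D'_simps)
qed

abbreviation "Om \<equiv> fst (snd (last B))"

lemma Om_ge: "end_weight P + K \<le> Om"
  using new_edge_weight[of "last B"] l2_ge(5) by simp

lemma coarse_dist_sub: "q \<in> space_of D \<Longrightarrow> coarse_dist D' q \<le> coarse_dist D q"
  by (rule subdiagram_coarse_dist[OF sub reach planar planar'])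

lemma track_A:
  assumes "x \<in> {0..l1}" "t \<ge> 0"
  shows "coarse_dist D' (Phi (F (k0 + x, 0), t)) \<le> Om"
proof -
  have sp: "F (k0 + x, 0) \<in> space_of D"
    using assms n_eq by (intro F_bot_space) auto
  have "coarse_dist D (Phi (F (k0 + x, 0), t)) \<le> Om"
    using assms(1)
  proof (cases rule: A_point_cases)
    case 1
    thus ?thesis
      using vert_weight[of "length P" t] P_le assms Om_ge bw_eq by simp
  next
    case (2 j s)
    have "fst (snd (bw ! (length P + j))) \<le> Om"
      using 2 by (auto simp: bw_eq nth_append intro!: sweep_weight)
    moreover have "coarse_dist D (Phi (F (real (length P + j) + s, 0), t)) \<le> fst (snd (bw ! (length P + j)))"
      using 2 assms by (intro edge_weight) (auto simp: bw_eq)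
    ultimately show ?thesis
      by (simp add: 2 add.assoc)
  qed
  thus ?thesis
    using coarse_dist_sub[OF Phi_space[OF sp assms(2)]] by simp
qed

text \<open>For one unit of time the point moves inside the closed cell, at most \<open>K\<close>
  beyond the bound for its first vertex; then it joins the track of a point of \<open>A\<close>.
  \<open>Om\<close>, the weight of the last edge of \<open>B\<close>, is above both.\<close>

lemma track_T:
  assumes "w \<in> T" "t \<ge> 0"
  shows "coarse_dist D' (Phi' (F1 w, t)) \<le> Om"
proof (cases "t \<le> 1")
  case True
  hence "Phi' (F1 w, t) = F1 (pull w t)" "pull w t \<in> T"
    using assms by (auto simp: Phi'_early retr_F1 pull_T)
  thus ?thesis
    using coarse_dist_T[of "pull w t"] Om_ge by simp
next
  case False
  have "F1 w \<in> space_of D'"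
    using assms by (simp add: space_D')
  hence "Phi' (F1 w, t) = Phi (F1 (pull w 1), t - 1)"
    using False assms by (simp add: Phi'_late retr_F1)
  moreover have "pull w 1 \<in> T" "snd (pull w 1) = 0"
    using pull_T[of w 1] assms by (auto simp: pull_def)
  moreover from this have "fst (pull w 1) \<in> {k0..k0 + l2}"
    using T_dom(1) by (auto simp: prod_eq_iff)
  moreover from calculation have "F1 (pull w 1) = F (k0 + (psi (fst (pull w 1)) - k0), 0)"
    using F1_bot[of "fst (pull w 1)"] by (cases "pull w 1") simp
  ultimately show ?thesis
    using track_A[OF psi_range, of "fst (pull w 1)" "t - 1"] False by simp
qed

text \<open>The other half of tameness inside the cell: every label there is that of a vertex of
  \<open>A\<close> or \<open>B\<close>. As long as a point is in the new cell, its future is bounded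
  by \<open>Om\<close>, and \<open>Om\<close> by \<open>Lim\<close> of its label.\<close>

lemma Lim_T:
  assumes "w \<in> T"
  shows "Om \<le> Lim (gp' (F1 w))"
  using assms
proof (cases rule: F1_T_cases)
  case (1 x)
  have sp: "F (k0 + x, 0) \<in> space_of D"
    using 1 n_eq by (intro F_bot_space) auto
  have v: "gp (F (k0 + real j, 0)) = ev e0 (map fst (P @ take j A))" if "j \<le> length A" for j
    using gp_bot[of "length P + j"] that P_le bw_eq by simp
  have "\<exists>j\<le>length A. gp (F (k0 + x, 0)) = ev e0 (map fst (P @ take j A))"
    using 1(1)
  proof (cases rule: A_point_cases)
    case 1
    thus ?thesis using v[of 0] by simp
  next
    case (2 j s)
    have "gp (F (k0 + x, 0)) \<in> {gp (F (k0 + real j, 0)), gp (F (k0 + real (Suc j), 0))}"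
      using gp_dart[of "length P + j" s] 2 P_le by (simp add: add_ac)
    moreover have "j \<le> length A" "Suc j \<le> length A"
      using 2 by auto
    ultimately show ?thesis
      using v by (metis insertE singletonD)
  qed
  thus ?thesis
    using lim_old 1 sp by (auto simp: gp'_old)
next
  case (2 th)
  then obtain i s where ij: "i < length B" "s \<in> {0..<1}" "th = k0 + real i + s"
    using top_point_cases[of th] by auto
  thus ?thesis
    using gp'_top[of i s] lim_new[of i] 2 by simp
next
  case 3
  thus ?thesis
    using gp'_Tin lim_new[of 0] by simp
qed

lemma tame':
  assumes "q \<in> space_of D'" "0 \<le> t" "t \<le> t'"
  shows "coarse_dist D' (Phi' (q, t')) \<le> Lim (gp' (Phi' (q, t)))"
proof -
  have old: "coarse_dist D' (Phi (r, u')) \<le> Lim (gp' (Phi (r, u)))"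
    if "r \<in> space_of D" "0 \<le> u" "u \<le> u'" for r u u'
  proof -
    have "coarse_dist D' (Phi (r, u')) \<le> coarse_dist D (Phi (r, u'))"
      using that by (intro coarse_dist_sub Phi_space) auto
    also have "\<dots> \<le> Lim (gp (Phi (r, u)))"
      using that by (rule tame)
    also have "gp (Phi (r, u)) = gp' (Phi (r, u))"
      using that by (simp add: gp'_old Phi_space)
    finally show ?thesis .
  qed
  show ?thesis
    using assms(1)
  proof (cases rule: space_D'_cases)
    case 1: old
    thus ?thesis
      using old[of q "max 0 (t - 1)" "max 0 (t' - 1)"] assms by (simp add: Phi'_old)
  next
    case (new w)
    show ?thesis
    proof (cases "t \<le> 1")
      case True
      have "Phi' (q, t) = F1 (pull w t)" "pull w t \<in> T"
        using new True assms pull_T[of w t] by (auto simp: Phi'_early retr_F1)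
      thus ?thesis
        using track_T[OF new(1), of t'] Lim_T[of "pull w t"] assms new by simp
    next
      case False
      thus ?thesis
        using old[OF retr_1[OF assms(1)], of "t - 1" "t' - 1"] assms by (simp add: Phi'_late)
    qed
  qed
qed

lemma nth_PBS: "k < length P \<Longrightarrow> (P @ B @ S) ! k = bw ! k"
  "i < length B \<Longrightarrow> (P @ B @ S) ! (length P + i) = B ! i"
  "i < length S \<Longrightarrow> (P @ B @ S) ! (length P + length B + i) = bw ! (length P + length A + i)"
  by (auto simp: bw_eq nth_append)

lemma track_old:
  assumes "th \<in> {0..n}" "t \<ge> 0"
  shows "coarse_dist D' (Phi' (F (th, 0), t)) \<le> coarse_dist D (Phi (F (th, 0), max 0 (t - 1)))"
proof -
  have "F (th, 0) \<in> space_of D"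
    using assms by (intro F_bot_space) auto
  thus ?thesis
    using coarse_dist_sub[OF Phi_space[of _ "max 0 (t - 1)"]] by (simp add: Phi'_old)
qed

lemma edge_weight':
  assumes "k < length (P @ B @ S)" "s \<in> {0..1}" "t \<ge> 0"
  shows "coarse_dist D' (Phi' (F' (real k + s, 0), t)) \<le> fst (snd ((P @ B @ S) ! k))"
  using assms(1)
proof (cases rule: pos_cases)
  case left
  have "k < length bw" "real k + s \<in> {0..n}"
    using left bw_eq assms length_bw by auto
  thus ?thesis
    using track_old[of "real k + s" t] edge_weight[of k s "max 0 (t - 1)"] assms left
    by (simp add: F'_left nth_PBS(1) del: append_assoc)
next
  case (new i)
  define th where "th = k0 + real i + s"
  have i: "real i + 1 \<le> l2" using new by simp
  have T: "(th, bump th) \<in> T"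
    using assms i by (intro top_T) (auto simp: th_def)
  have q: "F' (real k + s, 0) = F1 (th, bump th)"
    using new by (simp add: F'_bot top_def th_def)
  show ?thesis
  proof (cases "i = length B - 1")
    case True
    hence "B ! i = last B" using l2_ge(5) by (simp add: last_conv_nth)
    thus ?thesis
      using track_T[OF T assms(3)] nth_PBS(2)[OF new(1)] new(2) q by simp
  next
    case False
    hence "Suc (Suc i) \<le> length B" using new by simp
    hence "real (Suc (Suc i)) \<le> l2" by (simp only: of_nat_le_iff)
    \<comment> \<open>These edges lie on the rising branch of \<open>bump\<close>, so
      \<open>pull\<close> slides them along \<open>B\<close> to its first vertex without crossing
      the cell.\<close>
    hence th: "k0 \<le> th" "th \<le> k0 + l2 - 1"
      using assms by (auto simp: th_def)
    have "coarse_dist D' (Phi' (F1 (th, bump th), t)) \<le> end_weight P + K"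
    proof (cases "t \<le> 1")
      case True
      thus ?thesis
        using coarse_dist_T[OF pull_T[OF T, of t]] assms by (simp add: Phi'_early retr_F1[OF T])
    next
      case False
      have "F1 (th, bump th) \<in> space_of D'" using T by (simp add: space_D')
      moreover have "F1 (pull (th, bump th) 1) = F (k0, 0)"
        using pull_top[of "th - k0" 1] th by (simp add: top_k0)
      ultimately have eq: "Phi' (F1 (th, bump th), t) = Phi (F (k0, 0), t - 1)"
        using False by (simp add: Phi'_late retr_F1[OF T])
      have "F (k0, 0) \<in> space_of D"
        using F_bot_vert[OF P_le(1)] skeleton1_space(1,2) by blast
      hence "coarse_dist D' (Phi (F (k0, 0), t - 1)) \<le> coarse_dist D (Phi (F (k0, 0), t - 1))"
        using False by (intro coarse_dist_sub Phi_space) auto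
      also have "\<dots> \<le> end_weight P"
        using vert_weight[of "length P" "t - 1"] P_le False bw_eq by simp
      finally show ?thesis
        unfolding eq by simp
    qed
    thus ?thesis
      using new_edge_weight[of "B ! i"] nth_PBS(2)[OF new(1)] new q by simp
  qed
next
  case (right i)
  have k: "length P + length A + i < length bw" "real (length P + length A + i) + s \<in> {0..n}"
    using right bw_eq assms length_bw by auto
  show ?thesis
    using track_old[OF k(2) assms(3)] edge_weight[OF k(1) assms(2), of "max 0 (t - 1)"] F'_right[OF assms(2), of i] right
    by (simp add: nth_PBS(3) del: append_assoc of_nat_add)
qed

lemma vert_weight':
  assumes "k \<le> length (P @ B @ S)" "t \<ge> 0"
  shows "coarse_dist D' (Phi' (F' (real k, 0), t)) \<le> end_weight (take k (P @ B @ S))"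
proof -
  have old: "coarse_dist D' (Phi' (F (real j, 0), t)) \<le> end_weight (take j bw)" if "j \<le> length bw" for j
    using that vert_weight[OF that, of "max 0 (t - 1)"] track_old[of "real j" t] assms(2) length_bw by simp
  consider "k \<le> length P" | i where "0 < i" "i < length B" "k = length P + i"
    | i where "k = length P + length B + i" "i \<le> length S"
  proof -
    have "k \<le> length P \<or> (length P < k \<and> k < length P + length B) \<or> length P + length B \<le> k"
      by linarith
    thus ?thesis
      using that(1) that(2)[of "k - length P"] that(3)[of "k - length P - length B"] assms by force
  qed
  thus ?thesis
  proof cases
    case 1
    thus ?thesis
      using old[of k] bw_eq top_low[of "real k"] by (simp add: F'_bot)
  next
    case (2 i)
    have w: "end_weight (take k (P @ B @ S)) = snd (snd (B ! (i - 1)))"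
    proof -
      have "end_weight (take i B) = snd (snd (B ! (i - 1)))" "take i B \<noteq> []"
        using 2 end_weight_take_Suc[of "i - 1" B] by auto
      thus ?thesis using 2 by simp
    qed
    have ge: "end_weight P + i \<le> end_weight (take k (P @ B @ S))"
      unfolding w using new_vert_weight[of "i - 1"] 2 by simp
    have "coarse_dist D' (Phi' (top (k0 + real i), t)) \<le> end_weight P + i"
    proof (cases "t \<le> 1")
      case True
      define x where "x = (1 - t) * real i"
      have x: "0 \<le> x" "x \<le> real i"
        using True assms by (auto simp: x_def intro: mult_left_le_one_le)
      have "coarse_dist D' (top (k0 + x)) \<le> end_weight P + i"
      proof (cases "x = real i")
        case True
        thus ?thesis
          using vert_dist_top[of i] top_vert[of i] 2 by (simp add: coarse_dist_vert)
      next
        case False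
        then obtain j s where js: "j < i" "s \<in> {0..<1}" "x = real j + s"
          using nat_floor_decomp[of x i] x by auto
        have "coarse_dist D' (top (k0 + real j + s)) \<le> end_weight P + j + 1"
          using js 2 by (intro coarse_dist_top) auto
        moreover have "end_weight P + j + 1 \<le> end_weight P + i" using js by simp
        ultimately show ?thesis by (simp add: js add.assoc)
      qed
      thus ?thesis
        using Phi'_new_vert[OF 2(2) assms(2)] True by (simp add: x_def)
    next
      case False
      have "F (k0, 0) \<in> space_of D"
        using F_bot_vert[OF P_le(1)] skeleton1_space(1,2) by blast
      hence "coarse_dist D' (Phi (F (k0, 0), t - 1)) \<le> coarse_dist D (Phi (F (k0, 0), t - 1))"
        using False by (intro coarse_dist_sub Phi_space) auto
      also have "\<dots> \<le> end_weight P"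
        using vert_weight[of "length P" "t - 1"] P_le False bw_eq by simp
      finally show ?thesis
        using Phi'_new_vert[OF 2(2) assms(2)] False by simp
    qed
    thus ?thesis
      using ge 2 by (simp add: F'_bot)
  next
    case (3 i)
    have le: "length P + length A + i \<le> length bw"
      using 3 bw_eq by simp
    have "F' (real k, 0) = F (real (length P + length A + i), 0)"
      using F'_right[of 0 i] 3 by simp
    moreover have "end_weight (take (length P + length A + i) bw) \<le> end_weight (take k (P @ B @ S))"
    proof (cases "i = 0")
      \<comment> \<open>The end of \<open>B\<close> is the old vertex at the end of
        \<open>A\<close>, but its weight is now read from the last entry of
        \<open>B\<close>.\<close>
      case True
      thus ?thesis
        using last_vert_weight 3 bw_eq l2_ge(5) by (simp add: end_weight_def)
    next
      case False
      hence "take i S \<noteq> []" using 3 by auto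
      thus ?thesis
        using 3 bw_eq by simp
    qed
    ultimately show ?thesis
      using old[OF le] by simp
  qed
qed

lemma face_labels':
  assumes "f \<in> faces D'"
  shows "path_label D' (fbdry D' f) \<in> R"
proof (cases "f = M")
  case True
  thus ?thesis using fbdry_label by simp
next
  case False
  hence f: "f \<in> faces D" using assms by (simp add: D'_simps)
  hence eq: "fbdry D' f = fbdry D f" using sub by (simp add: subdiagram_def)
  obtain v where "edge_path D v (fbdry D f) v" using planar_complex_faceD(4)[OF planar f] by blast
  thus ?thesis
    using face_labels[OF f] path_label_sub by (simp add: eq)
qed

theorem filling_D': "filling R act e0 K Lim D' ds' F' Phi' gp' (P @ B @ S)"
proof
  show "basept D' = 0" by (simp add: D'_simps)
qed (fact planar' reach' face_labels' ds'_path ds'_lab F'_cont F'_per F'_inj F'_out F'_top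
      F'_bot_dart F'_dummy compact_space' Phi'_cont Phi'_space Phi'_0 Phi'_base Phi'_end Phi'_vert
      lbl' edge_weight' vert_weight' tame')+

end

section \<open>Closing up the collar\<close>

context filling begin

text \<open>\<open>xi\<close> collapses the constant interval \<open>[n, n+1]\<close> on the bottom of the strip.\<close>

definition xi :: "real \<Rightarrow> real \<Rightarrow> real" where
  "xi th y = (if ds = [] then th else
     (1 - y) * (min th (real (length ds)) / real (length ds)) + y * (th / (real (length ds) + 1)))"

definition annulus_map :: "real \<times> real \<Rightarrow> complex" where
  "annulus_map q = of_real (1 + snd q) * cis (2 * pi * xi (fst q) (snd q))"

abbreviation "strip \<equiv> {0..real (length ds) + 1} \<times> {0..1 :: real}"

lemma xi_mono:
  assumes "th < th'" "0 \<le> y" "y \<le> 1"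
  shows "xi th y \<le> xi th' y" "0 < y \<Longrightarrow> xi th y < xi th' y"
proof -
  have 1: "(1 - y) * (min th (real (length ds)) / real (length ds)) \<le>
      (1 - y) * (min th' (real (length ds)) / real (length ds))"
    using assms by (intro mult_left_mono divide_right_mono) auto
  have 2: "th / (real (length ds) + 1) < th' / (real (length ds) + 1)"
    using assms by (intro divide_strict_right_mono) auto
  hence 3: "y * (th / (real (length ds) + 1)) \<le> y * (th' / (real (length ds) + 1))"
    using assms by (intro mult_left_mono) auto
  show "xi th y \<le> xi th' y"
    using 1 3 assms by (simp add: xi_def)
  assume "0 < y"
  hence "y * (th / (real (length ds) + 1)) < y * (th' / (real (length ds) + 1))"
    using 2 by (intro mult_strict_left_mono)
  thus "xi th y < xi th' y"
    using 1 assms by (simp add: xi_def)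
qed

lemma xi_ends: "xi 0 y = 0" "xi (real (length ds) + 1) y = 1"
  by (auto simp: xi_def min_def)

lemma xi_range:
  assumes "(th, y) \<in> strip"
  shows "xi th y \<in> {0..1}"
  using xi_mono(1)[of 0 th y] xi_mono(1)[of th "real (length ds) + 1" y] assms xi_ends
  by (cases "th = 0"; cases "th = real (length ds) + 1") auto

lemma continuous_on_xi: "continuous_on X (\<lambda>q. xi (fst q) (snd q))"
proof (cases "ds = []")
  case False
  thus ?thesis unfolding xi_def if_not_P[OF False] by (intro continuous_intros) auto
next
  case True
  show ?thesis unfolding xi_def if_P[OF True] by (intro continuous_intros)
qed

lemma annulus_map_cont: "continuous_on X annulus_map"
  unfolding annulus_map_def cis_conv_exp by (intro continuous_intros continuous_on_xi)

lemma norm_annulus_map: "q \<in> strip \<Longrightarrow> norm (annulus_map q) = 1 + snd q"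
  by (auto simp: annulus_map_def norm_mult simp del: of_real_add)

lemma annulus_map_image: "annulus_map ` strip = {z. 1 \<le> norm z \<and> norm z \<le> 2}"
proof
  show "annulus_map ` strip \<subseteq> {z. 1 \<le> norm z \<and> norm z \<le> 2}"
    using norm_annulus_map by auto
  show "{z. 1 \<le> norm z \<and> norm z \<le> 2} \<subseteq> annulus_map ` strip"
  proof
    fix z :: complex assume z: "z \<in> {z. 1 \<le> norm z \<and> norm z \<le> 2}"
    define y where "y = norm z - 1"
    have y: "y \<in> {0..1}" using z by (simp add: y_def)
    define s where "s = Arg2pi z / (2 * pi)"
    have s: "0 \<le> s" "s \<le> 1" using Arg2pi[of z] by (auto simp: s_def)
    have "continuous_on {0..real (length ds) + 1} (\<lambda>th. xi (fst (th, y)) (snd (th, y)))"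
      by (intro continuous_on_compose2[OF continuous_on_xi[of UNIV]] continuous_intros) auto
    then obtain th where th: "0 \<le> th" "th \<le> real (length ds) + 1" "xi th y = s"
      using IVT'[of "\<lambda>th. xi th y" 0 s "real (length ds) + 1"] s xi_ends by auto
    have "annulus_map (th, y) = of_real (norm z) * exp (\<i> * of_real (Arg2pi z))"
      using th by (simp add: annulus_map_def y_def s_def cis_conv_exp)
    hence "annulus_map (th, y) = z"
      using Arg2pi[of z] by (simp add: is_Arg_def)
    thus "z \<in> annulus_map ` strip"
      using th y by (intro image_eqI[of _ _ "(th, y)"]) auto
  qed
qed

lemma F_dummy_wrap:
  assumes "th \<in> {0..real (length ds) + 1}" "xi th 0 \<in> {0, 1}"
  shows "F (th, 0) = 0"
proof (cases "ds = []")
  case True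
  thus ?thesis using assms by (intro F_dummy) auto
next
  case False
  hence "th = 0 \<or> th \<ge> real (length ds)"
    using assms by (auto simp: xi_def min_def split: if_splits)
  thus ?thesis
    using assms F_dummy[of th] F_0_0 by auto
qed

text \<open>The vertical ends of the strip meet (\<open>F_per\<close>), and on the bottom the
  constant interval goes to one point of the circle (\<open>F_dummy\<close>); nothing else is
  glued.\<close>

lemma annulus_map_fibre:
  assumes "q \<in> strip" "q' \<in> strip" "annulus_map q = annulus_map q'"
  shows "F q = F q'"
proof -
  obtain th y th' y' where q: "q = (th, y)" "q' = (th', y')" by fastforce
  have yy: "y' = y"
    using norm_annulus_map[OF assms(1)] norm_annulus_map[OF assms(2)] assms(3) q by simp
  have "cis (2 * pi * xi th y) = cis (2 * pi * xi th' y)"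
    using assms q yy by (auto simp: annulus_map_def simp del: of_real_add)
  hence cases: "xi th y = xi th' y \<or> {xi th y, xi th' y} = {0, 1}"
    using cis_2pi_eq_cases[of "xi th y" "xi th' y"] xi_range[of th y] xi_range[of th' y] assms q yy
    by (auto simp: abs_le_iff)
  show ?thesis
  proof (cases "y = 0")
    case True
    show ?thesis
      using cases
    proof
      assume eq: "xi th y = xi th' y"
      show ?thesis
      proof (cases "th = th' \<or> ds = []")
        case True
        thus ?thesis using F_dummy[of th] F_dummy[of th'] assms q yy \<open>y = 0\<close> by auto
      next
        case False
        hence "min th (real (length ds)) = min th' (real (length ds))"
          using eq \<open>y = 0\<close> by (simp add: xi_def)
        hence "th \<ge> real (length ds)" "th' \<ge> real (length ds)"
          using False by (auto simp: min_def split: if_splits)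
        thus ?thesis using F_dummy[of th] F_dummy[of th'] assms q yy \<open>y = 0\<close> by auto
      qed
    next
      assume "{xi th y, xi th' y} = {0, 1}"
      thus ?thesis
        using F_dummy_wrap[of th] F_dummy_wrap[of th'] assms q yy True by (auto simp: doubleton_eq_iff)
    qed
  next
    case False
    have inj: "a = b" if "xi a y = xi b y" for a b
      using xi_mono(2)[of a b y] xi_mono(2)[of b a y] that False assms q
      by (cases a b rule: linorder_cases) auto
    have "th = th' \<or> {th, th'} = {0, real (length ds) + 1}"
      using cases inj[of th th'] inj[of th 0] inj[of th' 0] inj[of th "real (length ds) + 1"]
        inj[of th' "real (length ds) + 1"] xi_ends by (auto simp: doubleton_eq_iff)
    thus ?thesis
      using F_per[of y] assms q yy by (auto simp: doubleton_eq_iff)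
  qed
qed

definition outer :: "complex \<Rightarrow> complex" where
  "outer z = F (SOME q. q \<in> strip \<and> annulus_map q = z)"

lemma outer_annulus_map:
  assumes "q \<in> strip"
  shows "outer (annulus_map q) = F q"
proof -
  define q' where "q' = (SOME q'. q' \<in> strip \<and> annulus_map q' = annulus_map q)"
  have "q' \<in> strip \<and> annulus_map q' = annulus_map q"
    unfolding q'_def by (rule someI[of _ q]) (use assms in auto)
  hence "F q' = F q"
    using annulus_map_fibre assms by blast
  thus ?thesis
    by (simp add: outer_def q'_def)
qed

lemma outer_cont: "continuous_on {z. 1 \<le> norm z \<and> norm z \<le> 2} outer"
proof -
  have "continuous_on strip (outer \<circ> annulus_map)"
    by (rule continuous_on_eq[OF F_cont]) (simp only: outer_annulus_map comp_def)
  hence "continuous_on (annulus_map ` strip) outer"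
    by (intro continuous_on_compact_quotient annulus_map_cont compact_Times compact_Icc)
  thus ?thesis
    by (simp only: annulus_map_image)
qed

lemma outer_rep:
  assumes "1 < norm z" "norm z \<le> 2"
  obtains q where "q \<in> {0..<real (length ds) + 1} \<times> {0<..1}" "annulus_map q = z" "outer z = F q"
proof -
  obtain q where q: "q \<in> strip" "annulus_map q = z"
    using assms annulus_map_image by (metis (mono_tags, lifting) imageE less_imp_le mem_Collect_eq)
  have pos: "snd q > 0"
    using norm_annulus_map[OF q(1)] q(2) assms by simp
  define q' where "q' = (if fst q = real (length ds) + 1 then (0, snd q) else q)"
  have q': "q' \<in> {0..<real (length ds) + 1} \<times> {0<..1}" "q' \<in> strip"
    using q pos by (auto simp: q'_def)
  moreover have "annulus_map q' = z"
    using q xi_ends by (cases q) (auto simp: q'_def annulus_map_def)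
  ultimately show ?thesis
    using that outer_annulus_map by metis
qed

lemma outer_inj: "inj_on outer {z. 1 < norm z \<and> norm z \<le> 2}"
proof (rule inj_onI)
  fix z z' assume z: "z \<in> {z. 1 < norm z \<and> norm z \<le> 2}" "z' \<in> {z. 1 < norm z \<and> norm z \<le> 2}"
    "outer z = outer z'"
  obtain q where q: "q \<in> {0..<real (length ds) + 1} \<times> {0<..1}" "annulus_map q = z" "outer z = F q"
    using outer_rep z by blast
  obtain q' where q': "q' \<in> {0..<real (length ds) + 1} \<times> {0<..1}" "annulus_map q' = z'" "outer z' = F q'"
    using outer_rep z by blast
  have "q = q'"
    using inj_onD[OF F_inj] q q' z by metis
  thus "z = z'"
    using q q' by simp
qed

lemma outer_disjoint: "outer ` {z. 1 < norm z \<and> norm z \<le> 2} \<inter> space_of D = {}"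
proof -
  have "outer z \<notin> space_of D" if z: "1 < norm z" "norm z \<le> 2" for z
  proof -
    obtain q where "q \<in> {0..<real (length ds) + 1} \<times> {0<..1}" "annulus_map q = z" "outer z = F q"
      by (rule outer_rep[OF z])
    thus ?thesis using F_out[of "fst q" "snd q"] by (cases q) auto
  qed
  thus ?thesis by blast
qed

text \<open>\<open>F_top\<close> has fixed the outer circle of the collar throughout the gluing, so
  the path is literally the circle of radius 2.\<close>

lemma winding_outer: "winding_number (outer \<circ> circlepath 0 2) 0 = 1"
proof -
  have "(outer \<circ> circlepath 0 2) s = circlepath 0 2 s" if "0 \<le> s" "s \<le> 1" for s
  proof -
    let ?th = "s * (real (length ds) + 1)"
    have "?th \<le> 1 * (real (length ds) + 1)"
      using that by (intro mult_right_mono) auto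
    hence th: "?th \<in> {0..real (length ds) + 1}" using that by simp
    have c: "circlepath 0 2 s = 2 * cis (2 * pi * s)"
      by (simp add: circlepath cis_conv_exp mult_ac)
    have "xi ?th 1 = s"
      by (simp add: xi_def)
    hence "annulus_map (?th, 1) = 2 * cis (2 * pi * s)"
      by (simp add: annulus_map_def)
    hence "outer (2 * cis (2 * pi * s)) = F (?th, 1)"
      using outer_annulus_map[of "(?th, 1)"] th by simp
    also have "\<dots> = 2 * cis (2 * pi * s)"
      using F_top[OF th] by simp
    finally show ?thesis
      by (simp add: c)
  qed
  hence "winding_number (outer \<circ> circlepath 0 2) 0 = winding_number (circlepath 0 2) 0"
    by (intro winding_number_cong) auto
  thus ?thesis
    by (simp add: winding_number_circlepath)
qed

lemma ccw_boundary_ds: "ccw_boundary D ds"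
  unfolding ccw_boundary_def basept
proof (intro conjI exI[of _ outer] impI allI)
  show "circle_follows D outer ds"
    unfolding circle_follows_def
  proof (intro allI impI ballI)
    fix k s assume k: "k < length ds" and s: "s \<in> {0..1::real}"
    have le: "real k + s \<le> real (length ds)" using k s by auto
    have "ds \<noteq> []" using k by auto
    hence "annulus_map (real k + s, 0) = cis (2 * pi * (real k + s) / real (length ds))"
      using le by (simp add: annulus_map_def xi_def)
    moreover have "(real k + s, 0) \<in> strip" using le s by simp
    ultimately show "outer (cis (2 * pi * (real k + s) / real (length ds))) = dart_pt D (ds ! k) s"
      using outer_annulus_map[of "(real k + s, 0)"] F_bot[OF k s] by simp
  qed
  show "outer z = 0" if "ds = []" "norm z = 1" for z
  proof -
    have "z \<in> annulus_map ` strip"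
      using that unfolding annulus_map_image by simp
    then obtain q where q: "q \<in> strip" "annulus_map q = z" by blast
    have "snd q = 0" using norm_annulus_map[OF q(1)] q that by simp
    hence "F q = 0" using F_dummy[of "fst q"] q that by (cases q) auto
    thus ?thesis using outer_annulus_map[OF q(1)] q by simp
  qed
qed (fact path outer_cont outer_inj outer_disjoint winding_outer)+

lemma contractible_space: "contractible (space_of D)"
proof -
  obtain N where N: "N \<ge> 0" "\<forall>q\<in>space_of D. \<forall>t\<ge>N. Phi (q, t) = 0"
    using Phi_end by blast
  have "continuous_on ({0..1} \<times> space_of D) (\<lambda>tq. Phi (snd tq, N * fst tq))"
    using N by (intro continuous_on_compose2[OF Phi_cont] continuous_intros) auto
  moreover have "(\<lambda>tq. Phi (snd tq, N * fst tq)) \<in> ({0..1} \<times> space_of D) \<rightarrow> space_of D"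
    using N Phi_space by auto
  ultimately have "homotopic_with_canon (\<lambda>x. True) (space_of D) (space_of D) id (\<lambda>x. 0)"
    using N Phi_0 by (subst homotopic_with) (auto intro!: exI[of _ "\<lambda>tq. Phi (snd tq, N * fst tq)"])
  thus ?thesis
    unfolding contractible_def by blast
qed

lemma van_kampen_diagram_D: "van_kampen_diagram R (map fst bw) D"
  unfolding van_kampen_diagram_def
  using planar contractible_space base_space face_labels ccw_boundary_ds lab basept by auto

text \<open>The homotopy runs \<open>Phi\<close> backwards, from the basepoint to the boundary. So
  the smaller parameter \<open>s\<close> is the later time of the contraction, \<open>tame\<close>
  bounds it by the label at \<open>t\<close>, and \<open>labelling_point\<close> turns that label
  into a short word.\<close>

lemma tame_homotopy:
  "\<exists>\<Psi>. van_kampen_homotopy D \<Psi> \<and>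
     (\<forall>q\<in>bdry D. \<forall>s t. 0 \<le> s \<and> s < t \<and> t \<le> 1 \<longrightarrow>
        (\<exists>u. length u \<le> coarse_dist D (\<Psi> (q, t)) + 1 \<and> coarse_dist D (\<Psi> (q, s)) \<le> Lim (ev e0 u)))"
proof -
  obtain N where N: "N \<ge> 0" "\<forall>q\<in>space_of D. \<forall>t\<ge>N. Phi (q, t) = 0"
    using Phi_end by blast
  define Psi where "Psi qt = Phi (fst qt, N * (1 - snd qt))" for qt
  have bd: "bdry D \<subseteq> space_of D"
    unfolding bdry_def using compact_space by (intro frontier_subset_closed compact_imp_closed)
  have "van_kampen_homotopy D Psi"
    unfolding van_kampen_homotopy_def basept
  proof (intro conjI ballI)
    show "continuous_on (bdry D \<times> {0..1}) Psi"
      unfolding Psi_def using N bd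
      by (intro continuous_on_compose2[OF Phi_cont] continuous_intros) auto
    show "Psi ` (bdry D \<times> {0..1}) \<subseteq> space_of D"
      using N bd by (auto simp: Psi_def intro!: Phi_space)
    show "Psi (q, 0) = 0" "Psi (q, 1) = q" if "q \<in> bdry D" for q
      using that N bd Phi_0 by (auto simp: Psi_def)
    show "Psi (0, t) = 0" if "t \<in> {0..1}" for t
      using that N by (auto simp: Psi_def intro!: Phi_base)
    show "Psi (q, t) \<in> skeleton1 D" if "q \<in> bdry D \<inter> verts D" "t \<in> {0..1}" for q t
      using that N by (auto simp: Psi_def intro!: Phi_vert)
  qed
  moreover have "\<exists>u. length u \<le> coarse_dist D (Psi (q, t)) + 1 \<and> coarse_dist D (Psi (q, s)) \<le> Lim (ev e0 u)"
    if "q \<in> bdry D" "0 \<le> s" "s < t" "t \<le> 1" for q s t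
  proof -
    have q: "q \<in> space_of D" using that bd by blast
    have t0: "0 \<le> N * (1 - t)" using N that by simp
    have "N * (1 - t) \<le> N * (1 - s)" using N that by (intro mult_left_mono) auto
    hence "coarse_dist D (Psi (q, s)) \<le> Lim (gp (Psi (q, t)))"
      using tame[OF q t0] by (simp add: Psi_def)
    moreover have "Psi (q, t) \<in> space_of D"
      using Phi_space[OF q t0] by (simp add: Psi_def)
    ultimately show ?thesis
      using labelling_point[OF planar reach lbl, of "Psi (q, t)"] by metis
  qed
  ultimately show ?thesis
    by (intro exI[of _ Psi]) blast
qed

end

section \<open>Induction over weighted boundary words\<close>

context letter_action begin

text \<open>Forgets the diagram, so that the rest is combinatorics of words with weights.\<close>

definition fillable :: "('g letter \<times> nat \<times> nat) list \<Rightarrow> bool" where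
  "fillable bw \<longleftrightarrow> (\<exists>D ds F Phi gp. filling R act e0 K Lim D ds F Phi gp bw)"

lemma fillable_Nil:
  assumes "Lim e0 \<ge> 0"
  shows "fillable []"
proof -
  define D :: "'g diagram" where "D = \<lparr>verts = {0}, edges = {}, emap = \<lambda>_ _. 0, elab = \<lambda>_. undefined,
    faces = {}, fmap = \<lambda>_ _. 0, fbdry = \<lambda>_. [], basept = 0\<rparr>"
  have simps: "verts D = {0}" "edges D = {}" "faces D = {}" "basept D = 0"
    by (simp_all add: D_def)
  have sk: "skeleton1 D = {0}" by (simp add: skeleton1_def simps)
  have sp: "space_of D = {0}" by (simp add: space_of_def sk simps)
  have ep: "edge_path D 0 [] 0" by (simp add: simps)
  hence vd: "vert_dist D 0 = 0" using vert_dist_le[of D "[]" 0] simps by simp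
  \<comment> \<open>Polar coordinates about the one-point diagram; the bottom of the strip collapses
    to it.\<close>
  define F :: "real \<times> real \<Rightarrow> complex" where "F q = of_real (2 * snd q) * cis (2 * pi * fst q)" for q
  have inj: "inj_on F ({0..<1} \<times> {0<..1})"
  proof (rule inj_onI)
    fix p q assume p: "p \<in> {0..<1} \<times> {0<..1::real}" and q: "q \<in> {0..<1} \<times> {0<..1::real}" and eq: "F p = F q"
    have n: "norm (F r) = 2 * snd r" if "r \<in> {0..<1} \<times> {0<..1::real}" for r
      using that by (auto simp: F_def norm_mult)
    have s: "snd p = snd q" using n[OF p] n[OF q] eq by simp
    hence "cis (2 * pi * fst p) = cis (2 * pi * fst q)" using eq p by (auto simp: F_def)
    hence "fst p = fst q" using p q by (intro cis_2pi_eqD) auto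
    thus "p = q" using s by (simp add: prod_eq_iff)
  qed
  have "filling R act e0 K Lim D [] F (\<lambda>_. 0) (\<lambda>_. e0) []"
  proof
    show "planar_complex D"
      by (simp add: planar_complex_def simps disjoint_family_on_def)
    show "reachable D"
      using ep unfolding reachable_def simps by blast
    show "continuous_on ({0..real (length ([] :: dart list)) + 1} \<times> {0..1}) F"
      unfolding F_def cis_conv_exp by (intro continuous_intros)
    show "inj_on F ({0..<real (length ([] :: dart list)) + 1} \<times> {0<..1})"
      using inj by simp
    show "labelling D (\<lambda>_. e0)"
      by (simp add: labelling_def simps)
  qed (use assms in \<open>auto simp: simps sk sp vd path_label_def F_def coarse_dist_vert\<close>)
  thus ?thesis
    unfolding fillable_def by blast
qed

lemma fillable_step:
  assumes "fillable (P @ A @ S)" "B \<noteq> []" "map fst B @ inv_word (map fst A) \<in> R"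
    and "\<And>i. i < length B - 1 \<Longrightarrow> end_weight P + i + 1 \<le> snd (snd (B ! i))"
    and "end_weight (P @ A) \<le> snd (snd (last B))"
    and "\<And>b. b \<in> set B \<Longrightarrow> end_weight P + K \<le> fst (snd b)"
    and "\<And>x. x \<in> set A \<Longrightarrow> fst (snd x) \<le> fst (snd (last B))"
    and "\<And>i. i \<le> length B \<Longrightarrow> real (fst (snd (last B))) \<le> Lim (ev e0 (map fst (P @ take i B)))"
    and "\<And>i. i \<le> length A \<Longrightarrow> real (fst (snd (last B))) \<le> Lim (ev e0 (map fst (P @ take i A)))"
  shows "fillable (P @ B @ S)"
proof -
  obtain D ds F Phi gp where f: "filling R act e0 K Lim D ds F Phi gp (P @ A @ S)"
    using assms(1) by (auto simp: fillable_def)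
  interpret filling R act e0 K Lim D ds F Phi gp "P @ A @ S"
    by (rule f)
  obtain N where N: "\<And>e. e \<in> edges D \<Longrightarrow> e < N"
    using planar_complex_finiteD(2)[OF planar] by (auto simp: finite_nat_set_iff_bounded)
  obtain M where M: "M \<notin> faces D"
    using planar_complex_finiteD(3)[OF planar] ex_new_if_finite[OF infinite_UNIV_nat] by blast
  interpret filling_step R act e0 K Lim D ds F Phi gp "P @ A @ S" P A B S N M
    by unfold_locales (use assms N M in auto)
  show ?thesis
    unfolding fillable_def using filling_D' by blast
qed

theorem fillable_imp_tame_diagram:
  assumes "fillable bw"
  shows "\<exists>D \<Psi>. van_kampen_diagram R (map fst bw) D \<and> van_kampen_homotopy D \<Psi> \<and>
     (\<forall>q\<in>bdry D. \<forall>s t. 0 \<le> s \<and> s < t \<and> t \<le> 1 \<longrightarrow>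
        (\<exists>u. length u \<le> coarse_dist D (\<Psi> (q, t)) + 1 \<and> coarse_dist D (\<Psi> (q, s)) \<le> Lim (ev e0 u)))"
  using assms filling.van_kampen_diagram_D filling.tame_homotopy
  unfolding fillable_def by metis

end

section \<open>Normal forms in the Baumslag-Solitar group\<close>

lemma foldl_letters_inv_word:
  assumes "\<And>x g. act (inv_letter x) (act x g) = g"
  shows "foldl (\<lambda>g x. act x g) (foldl (\<lambda>g x. act x g) g (inv_word w)) w = g"
proof -
  have "act x (act (inv_letter x) g) = g" for x g
    using assms[of "inv_letter x" g] by simp
  thus ?thesis
    by (induction w arbitrary: g) (simp_all add: inv_word_def)
qed

lemma foldl_letters_symmetrization:
  assumes inv: "\<And>x g. act (inv_letter x) (act x g) = g"
    and R: "\<And>r g. r \<in> R \<Longrightarrow> foldl (\<lambda>g x. act x g) g r = g"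
    and r: "r \<in> symmetrization R"
  shows "foldl (\<lambda>g x. act x g) g r = g"
  using r
proof (induction arbitrary: g)
  case (inversion r)
  thus ?case
    using foldl_letters_inv_word[of act, OF inv] by metis
next
  case (cyclic u v)
  \<comment> \<open>From \<open>?h\<close> the word \<open>u\<close> leads to \<open>g\<close>, so
    that the induction hypothesis for \<open>u @ v\<close> at \<open>?h\<close> says where
    \<open>v\<close> leads from \<open>g\<close>.\<close>
  let ?h = "foldl (\<lambda>g x. act x g) g (inv_word u)"
  have "foldl (\<lambda>g x. act x g) (foldl (\<lambda>g x. act x g) (foldl (\<lambda>g x. act x g) ?h u) v) u
      = foldl (\<lambda>g x. act x g) ?h u"
    using cyclic.IH[of ?h] by simp
  thus ?case
    using foldl_letters_inv_word[of act, OF inv] by simp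
next
  case (reduction u x v)
  thus ?case
    using inv by simp
qed (use R in auto)

lemma length_symmetrization:
  assumes "\<And>r. r \<in> R \<Longrightarrow> length r \<le> n" "r \<in> symmetrization R"
  shows "length r \<le> n"
  using assms(2) by induction (auto simp: inv_word_def dest: assms(1))

locale baumslag_solitar =
  fixes p :: nat
  assumes p_ge: "p \<ge> 2"
begin

abbreviation "\<t> \<equiv> (Gen_t, True)"
abbreviation "\<T> \<equiv> (Gen_t, False)"

definition sg :: "bool \<Rightarrow> int" where
  "sg b = (if b then 1 else -1)"

text \<open>Right multiplication in the group of affine maps of the line, with \<open>a\<close> as
  translation by 1 and \<open>t\<close> as multiplication by \<open>p\<close>.\<close>

fun act :: "bs_gen letter \<Rightarrow> real \<times> int \<Rightarrow> real \<times> int" where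
  "act (Gen_a, b) (x, h) = (x + of_int (sg b) * real p powi h, h)"
| "act (Gen_t, b) (x, h) = (x, h + sg b)"

definition R :: "bs_gen letter list set" where
  "R = symmetrization (BS_relators p)"

text \<open>Relators have at most \<open>p + 3\<close> letters, and \<open>letter_action\<close>
  asks for a strict bound.\<close>

definition K :: nat where
  "K = p + 4"

definition word_norm :: "real \<times> int \<Rightarrow> nat" where
  "word_norm g = (LEAST n. \<exists>u. foldl (\<lambda>g x. act x g) (0, 0) u = g \<and> length u = n)"

text \<open>Two vertices of one 2-cell differ by a word of at most \<open>2 * K\<close> letters,
  hence the shift of the norm; the exponential is that of \<open>nf_length_bound\<close>. The
  summand \<open>2 * K\<close> pays for the constant by which edge weights exceed lengths of normal
  forms.\<close>

definition Lim :: "real \<times> int \<Rightarrow> real" where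
  "Lim g = real (p ^ (2 * (word_norm g + 2 * K) + 2) + 2 * K)"

lemma p_pos: "real p > 0" "p > 0"
  using p_ge by auto

lemma act_inv: "act (inv_letter x) (act x g) = g"
  by (cases x; cases g; cases "fst x") (auto simp: sg_def)

lemma foldl_a: "foldl (\<lambda>g x. act x g) (x, h) (replicate n (Gen_a, b)) = (x + of_int (sg b) * real n * real p powi h, h)"
  by (induction n arbitrary: x) (simp_all add: algebra_simps)

lemma inv_word_replicate: "inv_word (replicate n x) = replicate n (inv_letter x)"
  by (simp add: inv_word_def)

sublocale letter_action R act "(0, 0)" K Lim
proof
  show "act (inv_letter x) (act x g) = g" for x g
    by (rule act_inv)
  fix r assume r: "r \<in> R"
  have "foldl (\<lambda>g x. act x g) g r' = g" if "r' \<in> BS_relators p" for r' g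
  proof -
    have "real p powi (h + 1) = real p * real p powi h" for h
      using p_pos by (simp add: power_int_add)
    moreover obtain x h where "g = (x, h)" by fastforce
    ultimately show ?thesis
      using that by (simp add: BS_relators_def inv_word_replicate foldl_a sg_def)
  qed
  thus "foldl (\<lambda>g x. act x g) g r = g" for g
    using foldl_letters_symmetrization[of act "BS_relators p" r g, OF act_inv] r by (simp add: R_def)
  have "length r \<le> p + 3"
    using r unfolding R_def by (rule length_symmetrization[rotated]) (simp add: BS_relators_def inv_word_def)
  thus "length r < K"
    by (simp add: K_def)
qed

lemma rotate_relator: "u @ v \<in> R \<Longrightarrow> v @ u \<in> R"
  unfolding R_def by (rule symmetrization.cyclic)

lemma relator: "[\<t>, (Gen_a, b), \<T>] @ replicate p (Gen_a, \<not> b) \<in> R"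
proof -
  have 1: "[\<t>, (Gen_a, True), \<T>] @ replicate p (Gen_a, False) \<in> R"
    unfolding R_def by (rule symmetrization.base) (simp_all add: BS_relators_def inv_word_replicate)
  hence "inv_word ([\<t>, (Gen_a, True), \<T>] @ replicate p (Gen_a, False)) \<in> R"
    unfolding R_def by (rule symmetrization.inversion)
  hence "replicate p (Gen_a, True) @ [\<t>, (Gen_a, False), \<T>] \<in> R"
    by (simp add: inv_word_def)
  from rotate_relator[OF this] 1 show ?thesis
    by (cases b) simp_all
qed

lemma relator_starting_with: "\<exists>s. x # s \<in> R \<and> s \<noteq> []"
proof -
  obtain g b where x: "x = (g, b)" by fastforce
  show ?thesis
  proof (cases g)
    case Gen_a
    have "[(Gen_a, b), \<T>] @ replicate p (Gen_a, \<not> b) @ [\<t>] \<in> R"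
      using rotate_relator[of "[\<t>]" "[(Gen_a, b), \<T>] @ replicate p (Gen_a, \<not> b)"] relator[of b]
      by simp
    thus ?thesis using x Gen_a by auto
  next
    case Gen_t
    have "[\<T>] @ replicate p (Gen_a, False) @ [\<t>, (Gen_a, True)] \<in> R"
      using rotate_relator[of "[\<t>, (Gen_a, True)]" "[\<T>] @ replicate p (Gen_a, False)"] relator[of True]
      by simp
    thus ?thesis using x Gen_t relator[of True] by (cases b) auto
  qed
qed

text \<open>\<open>val (i, k, j)\<close> is the element \<open>t\<^sup>-\<^sup>i a\<^sup>k t\<^sup>j\<close>; the pair \<open>(x, h)\<close> stands for the affine
  map \<open>y \<mapsto> p\<^sup>h y + x\<close>.\<close>

fun val :: "nat \<times> int \<times> nat \<Rightarrow> real \<times> int" where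
  "val (i, k, j) = (of_int k / real p ^ i, int j - int i)"

text \<open>Excludes the pinch t^-1 a^(p m) t, which equals a^m.\<close>

fun normal :: "nat \<times> int \<times> nat \<Rightarrow> bool" where
  "normal (i, k, j) \<longleftrightarrow> i = 0 \<or> j = 0 \<or> \<not> int p dvd k"

text \<open>If \<open>i < i'\<close>, clearing denominators shows that \<open>p\<close> divides
  \<open>k'\<close>, and \<open>j' - i' = j - i\<close> forces \<open>j' > 0\<close>; so the second
  triple is not normal.\<close>

lemma normal_unique:
  assumes "normal (i, k, j)" "normal (i', k', j')" "val (i, k, j) = val (i', k', j')"
  shows "(i, k, j) = (i', k', j')"
proof -
  have less: False if "i < i'" "normal (i', k', j')" "val (i, k, j) = val (i', k', j')" for i k j i' k' j'
  proof -
    have d: "real p ^ i' = real p ^ i * real p ^ (i' - i)"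
      using that by (simp flip: power_add)
    have "of_int k' = (of_int k * real p ^ (i' - i) :: real)"
      using that(3) p_pos by (simp add: d field_simps)
    hence "k' = k * int p ^ (i' - i)"
      by (metis of_int_eq_iff of_int_mult of_int_of_nat_eq of_int_power)
    moreover have "int p dvd int p ^ (i' - i)"
      using that(1) by (intro dvd_power) simp
    ultimately have "int p dvd k'" by simp
    moreover have "j' > 0" using that by simp
    ultimately show False using that by simp
  qed
  have "i = i'"
    using less[of i i' k' j' k j] less[of i' i k j k' j'] assms by (metis nat_neq_iff)
  thus ?thesis
    using assms(3) p_pos by simp
qed

definition nf_length :: "real \<times> int \<Rightarrow> nat" where
  "nf_length g = (THE n. \<exists>i k j. normal (i, k, j) \<and> g = val (i, k, j) \<and> n = i + nat \<bar>k\<bar> + j)"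

lemma nf_length_val: "normal (i, k, j) \<Longrightarrow> nf_length (val (i, k, j)) = i + nat \<bar>k\<bar> + j"
  unfolding nf_length_def using normal_unique by (intro the_equality) (blast, metis Pair_inject)

lemma act_val:
  "act (Gen_a, b) (val (i, k, j)) = val (i, k + sg b * int p ^ j, j)"
  "act \<t> (val (i, k, j)) = val (i, k, Suc j)"
  "act \<T> (val (i, k, Suc j)) = val (i, k, j)"
  "act \<T> (val (i, k, 0)) = val (Suc i, int p * k, 0)"
  "act \<t> (val (Suc i, int p * k, 0)) = val (i, k, 0)"
  using p_pos by (simp_all add: sg_def power_int_diff field_simps)

declare val.simps [simp del]

lemma ev_val:
  "ev (val (i, k, j)) (replicate n (Gen_a, b)) = val (i, k + sg b * int n * int p ^ j, j)"
  "ev (val (i, k, j)) (replicate n \<t>) = val (i, k, j + n)"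
  "ev (val (i, 0, 0)) (replicate n \<T>) = val (i + n, 0, 0)"
proof -
  show "ev (val (i, k, j)) (replicate n (Gen_a, b)) = val (i, k + sg b * int n * int p ^ j, j)"
    by (induction n arbitrary: k) (simp_all add: act_val algebra_simps)
  show "ev (val (i, k, j)) (replicate n \<t>) = val (i, k, j + n)"
    by (induction n arbitrary: j) (simp_all add: act_val)
  show "ev (val (i, 0, 0)) (replicate n \<T>) = val (i + n, 0, 0)"
    by (induction n arbitrary: i) (simp_all add: act_val)
qed

lemma val_0: "val (0, 0, 0) = (0, 0)"
  by (simp add: val.simps)

definition apow :: "int \<Rightarrow> bs_gen letter list" where
  "apow k = replicate (nat \<bar>k\<bar>) (Gen_a, k \<ge> 0)"

lemma sg_sg [simp]: "sg b * sg b = 1" "\<bar>sg b\<bar> = 1"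
  by (simp_all add: sg_def)

lemma apow_sg: "apow (sg b * int n) = replicate n (Gen_a, b)"
  by (cases "n = 0"; cases b) (auto simp: apow_def sg_def)

fun wd :: "nat \<times> int \<times> nat \<Rightarrow> bs_gen letter list" where
  "wd (i, k, j) = replicate i \<T> @ apow k @ replicate j \<t>"

lemma ev_apow: "ev (val (i, k, j)) (apow k') = val (i, k + k' * int p ^ j, j)"
  by (simp add: apow_def ev_val sg_def abs_if)

lemma ev_Ts: "ev (0, 0) (replicate i \<T>) = val (i, 0, 0)"
  using ev_val(3)[of 0 i] by (simp add: val_0)

lemma ev_wd: "ev (0, 0) (wd n) = val n"
  by (cases n) (simp add: ev_Ts ev_apow ev_val)

text \<open>Right multiplication on normal forms. Only a t right behind the power of a can create a
  pinch, and a t^-1 in that position moves to the left by a^k t^-1 = t^-1 a^(p k).\<close>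

fun step :: "bs_gen letter \<Rightarrow> nat \<times> int \<times> nat \<Rightarrow> nat \<times> int \<times> nat" where
  "step (Gen_a, b) (i, k, j) = (i, k + sg b * int p ^ j, j)"
| "step (Gen_t, True) (i, k, j) = (if j = 0 \<and> i > 0 \<and> int p dvd k then (i - 1, k div int p, 0) else (i, k, Suc j))"
| "step (Gen_t, False) (i, k, j) = (if j > 0 then (i, k, j - 1) else (Suc i, int p * k, 0))"

lemma step_normal: "normal n \<Longrightarrow> normal (step x n)"
proof (induction x n rule: step.induct)
  case (1 b i k j)
  have "int p dvd k + sg b * int p ^ j \<longleftrightarrow> int p dvd k" if "j > 0"
    using that by (intro dvd_add_left_iff) (simp add: dvd_power)
  thus ?case using 1 by auto
qed auto

lemma val_step: "val (step x n) = act x (val n)"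
proof (induction x n rule: step.induct)
  case (2 i k j)
  show ?case
  proof (cases "j = 0 \<and> i > 0 \<and> int p dvd k")
    case True
    then obtain i' k' where "i = Suc i'" "k = int p * k'" by (metis dvdE gr0_implies_Suc)
    thus ?thesis using True p_pos by (simp add: act_val(5))
  qed (auto simp: act_val)
next
  case (3 i k j)
  show ?case by (cases j) (auto simp: act_val)
qed (simp add: act_val)

definition nf :: "bs_gen letter list \<Rightarrow> nat \<times> int \<times> nat" where
  "nf = foldl (\<lambda>n x. step x n) (0, 0, 0)"

lemma nf_simps [simp]: "nf [] = (0, 0, 0)" "nf (u @ [x]) = step x (nf u)"
  by (simp_all add: nf_def)

lemma normal_nf: "normal (nf u)"
  by (induction u rule: rev_induct) (simp_all add: step_normal)

lemma val_nf: "val (nf u) = ev (0, 0) u"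
  by (induction u rule: rev_induct) (simp_all add: val_0 val_step)

text \<open>\<open>j\<close> is at most the number of letters, so a letter a or a^-1 changes the
  exponent by at most the current bound, and t^-1 multiplies it by \<open>p\<close>; both stay
  within the factor p^2 that each letter is granted.\<close>

lemma nf_bounds:
  "fst (nf u) \<le> length u \<and> \<bar>fst (snd (nf u))\<bar> \<le> int p ^ (2 * length u) \<and> snd (snd (nf u)) \<le> length u"
proof (induction u rule: rev_induct)
  case (snoc x u)
  obtain i k j where n: "nf u = (i, k, j)" by (metis prod.exhaust)
  define P where "P = int p ^ (2 * length u)"
  have IH: "i \<le> length u" "\<bar>k\<bar> \<le> P" "j \<le> length u"
    using snoc n by (auto simp: P_def)
  have p1: "int p \<ge> 2" using p_ge by simp
  have P1: "P \<ge> 1" using p1 by (simp add: P_def)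
  have P2: "int p ^ (2 * length (u @ [x])) = int p * (int p * P)"
    by (simp add: P_def)
  have pj: "int p ^ j \<le> P"
    unfolding P_def using p1 IH by (intro power_increasing) auto
  have "2 * P \<le> int p * P" using p1 P1 by (intro mult_right_mono) auto
  moreover have "1 * (int p * P) \<le> int p * (int p * P)" using p1 P1 by (intro mult_right_mono) auto
  ultimately have big: "2 * P \<le> int p * (int p * P)" "int p * P \<le> int p * (int p * P)" by linarith+
  obtain g b where x: "x = (g, b)" by fastforce
  show ?case
  proof (cases g)
    case Gen_a
    have "\<bar>k + sg b * int p ^ j\<bar> \<le> \<bar>k\<bar> + int p ^ j"
      using abs_triangle_ineq[of k "sg b * int p ^ j"] by (simp add: abs_mult)
    hence "\<bar>k + sg b * int p ^ j\<bar> \<le> int p * (int p * P)"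
      using IH pj big by linarith
    thus ?thesis
      using IH unfolding P2 by (simp add: n x Gen_a)
  next
    case Gen_t
    have div: "\<bar>k div int p\<bar> \<le> \<bar>k\<bar>" if "int p dvd k"
      using that p1 by (auto elim!: dvdE simp: abs_mult mult_le_cancel_right1)
    have "\<bar>k div int p\<bar> \<le> int p * (int p * P)" if "int p dvd k"
      using div[OF that] IH(2) big(1) P1 by linarith
    moreover have "\<bar>int p * k\<bar> \<le> int p * P"
      using IH p1 by (simp add: abs_mult mult_left_mono)
    hence "\<bar>int p * k\<bar> \<le> int p * (int p * P)"
      using big by linarith
    moreover have "\<bar>k\<bar> \<le> int p * (int p * P)"
      using IH big P1 by linarith
    ultimately show ?thesis
      using IH unfolding P2 by (cases b) (auto simp: n x Gen_t)
  qed
qed simp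

lemma nf_length_bound: "nf_length (ev (0, 0) u) \<le> p ^ (2 * length u + 2)"
proof -
  obtain i k j where n: "nf u = (i, k, j)" by (metis prod.exhaust)
  have "nf_length (ev (0, 0) u) = i + nat \<bar>k\<bar> + j"
    using nf_length_val[of i k j] normal_nf[of u] val_nf[of u] n by simp
  moreover have "nat \<bar>k\<bar> \<le> p ^ (2 * length u)" "i \<le> length u" "j \<le> length u"
    using nf_bounds[of u] n by (auto simp: nat_le_iff)
  moreover have "2 * length u \<le> p ^ (2 * length u)"
    using less_exp[of "2 * length u"] power_mono[of 2 p "2 * length u"] p_ge by simp
  moreover have "2 * 1 * p ^ (2 * length u) \<le> p * p * p ^ (2 * length u)"
    using p_ge by (intro mult_right_mono mult_mono) auto
  moreover have "p ^ (2 * length u + 2) = p * p * p ^ (2 * length u)"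
    by (simp add: power_add power2_eq_square)
  ultimately show ?thesis
    by linarith
qed

lemma word_norm_le: "word_norm (ev (0, 0) u) \<le> length u"
  unfolding word_norm_def by (rule Least_le) (auto simp: ev_def)

lemma nf_length_Lim:
  assumes "length v \<le> 2 * K"
  shows "real (nf_length (ev (ev (0, 0) w) v) + 2 * K) \<le> Lim (ev (0, 0) w)"
proof -
  have "\<exists>u. foldl (\<lambda>g x. act x g) (0, 0) u = ev (0, 0) w \<and> length u = word_norm (ev (0, 0) w)"
    unfolding word_norm_def by (rule LeastI[of _ "length w"]) (auto simp: ev_def)
  then obtain u where u: "ev (0, 0) u = ev (0, 0) w" "length u = word_norm (ev (0, 0) w)"
    by (auto simp: ev_def)
  have "nf_length (ev (0, 0) (u @ v)) \<le> p ^ (2 * length (u @ v) + 2)"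
    by (rule nf_length_bound)
  also have "\<dots> \<le> p ^ (2 * (word_norm (ev (0, 0) w) + 2 * K) + 2)"
    using p_ge u assms by (intro power_increasing) auto
  finally show ?thesis
    by (simp add: Lim_def u(1) del: of_nat_add of_nat_power)
qed

section \<open>Derivations of boundary words\<close>

text \<open>The weight of a vertex is the length of its normal form; an edge gets \<open>K\<close>
  more, the room it needs while it crosses a cell.\<close>

fun weigh :: "real \<times> int \<Rightarrow> bs_gen letter list \<Rightarrow> (bs_gen letter \<times> nat \<times> nat) list" where
  "weigh g [] = []"
| "weigh g (x # u) = (x, max (nf_length g) (nf_length (act x g)) + K, nf_length (act x g)) # weigh (act x g) u"

lemma map_fst_weigh [simp]: "map fst (weigh g u) = u"
  by (induction u arbitrary: g) auto

lemma length_weigh [simp]: "length (weigh g u) = length u"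
  by (induction u arbitrary: g) auto

lemma weigh_append: "weigh g (u @ v) = weigh g u @ weigh (ev g u) v"
  by (induction u arbitrary: g) auto

lemma weigh_eq_Nil [simp]: "weigh g u = [] \<longleftrightarrow> u = []"
  by (cases u) auto

lemma nth_weigh:
  "i < length u \<Longrightarrow> weigh g u ! i = (u ! i,
     max (nf_length (ev g (take i u))) (nf_length (ev g (take (Suc i) u))) + K,
     nf_length (ev g (take (Suc i) u)))"
proof (induction u arbitrary: g i)
  case (Cons x u)
  thus ?case by (cases i) auto
qed simp

lemma last_weigh:
  assumes "u \<noteq> []"
  shows "last (weigh g u) = (last u,
     max (nf_length (ev g (butlast u))) (nf_length (ev g u)) + K, nf_length (ev g u))"
  using assms nth_weigh[of "length u - 1" u g]
  by (simp add: last_conv_nth butlast_conv_take)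

lemma nf_length_0: "nf_length (0, 0) = 0"
  using nf_length_val[of 0 0 0] by (simp add: val_0)

lemma end_weight_weigh: "end_weight (weigh (0, 0) u) = nf_length (ev (0, 0) u)"
  by (cases "u = []") (simp_all add: end_weight_def last_weigh nf_length_0)

lemma ev_inv_word': "ev (ev g w) (inv_word w) = g"
proof (induction w arbitrary: g)
  case (Cons x w)
  have "inv_word (x # w) = inv_word w @ [inv_letter x]"
    by (simp add: inv_word_def)
  thus ?case using Cons[of "act x g"] act_inv by simp
qed (simp add: inv_word_def)

lemma length_inv_word [simp]: "length (inv_word w) = length w"
  by (simp add: inv_word_def)

text \<open>\<open>u\<close> and \<open>v\<close> are to lead to two vertices of one 2-cell; the
  word from the second to the first has at most \<open>2 * K\<close> letters.\<close>

lemma nf_length_Lim_face: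
  assumes "length u + length v \<le> 2 * K"
  shows "real (nf_length (ev (ev (0, 0) w) u) + 2 * K) \<le> Lim (ev (ev (0, 0) w) v)"
proof -
  have "ev (ev (0, 0) (w @ v)) (inv_word v @ u) = ev (ev (0, 0) w) u"
    using ev_inv_word'[of "ev (0, 0) w" v] by simp
  thus ?thesis
    using nf_length_Lim[of "inv_word v @ u" "w @ v"] assms by simp
qed

definition derivable :: "bs_gen letter list \<Rightarrow> bool" where
  "derivable u \<longleftrightarrow> fillable (weigh (0, 0) u)"

lemma derivable_Nil: "derivable []"
  unfolding derivable_def by (simp add: fillable_Nil Lim_def)

text \<open>With \<open>weigh\<close> the conditions of \<open>fillable_step\<close> become
  statements on lengths of normal forms: they grow along \<open>B\<close> up to its last edge, whose
  two ends dominate \<open>A\<close>. The conditions on \<open>Lim\<close> hold since the cell has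
  fewer than \<open>K\<close> edges.\<close>

lemma derivable_face:
  assumes der: "derivable (P @ A @ S)" and B: "B \<noteq> []" and rel: "B @ inv_word A \<in> R"
    and g: "g = ev (0, 0) P"
    and incr: "\<And>i. 0 < i \<Longrightarrow> i < length B \<Longrightarrow> nf_length g + i \<le> nf_length (ev g (take i B))"
    and sweep: "\<And>i. i \<le> length A \<Longrightarrow>
       nf_length (ev g (take i A)) \<le> max (nf_length (ev g (butlast B))) (nf_length (ev g B))"
  shows "derivable (P @ B @ S)"
proof -
  have eq: "ev g B = ev g A"
    using ev_relator_eq[OF rel] .
  have size: "length A + length B < K"
    using length_relator[OF rel] by simp
  have ge: "nf_length g \<le> nf_length (ev g (take i B))" if "i < length B" for i
    using incr[of i] that by (cases "i = 0") auto
  let ?m = "max (nf_length (ev g (butlast B))) (nf_length (ev g B))"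
  have lim: "real (?m + K) \<le> Lim (ev g v)" if "length v \<le> K" for v
  proof -
    have "real (nf_length (ev g B) + 2 * K) \<le> Lim (ev g v)"
      "real (nf_length (ev g (butlast B)) + 2 * K) \<le> Lim (ev g v)"
      using nf_length_Lim_face[of B v P] nf_length_Lim_face[of "butlast B" v P] that size g by simp_all
    thus ?thesis by (simp add: max_def)
  qed
  have m: "fst (snd (last (weigh g B))) = ?m + K"
    using B by (simp add: last_weigh)
  have "fillable (weigh (0, 0) P @ weigh g B @ weigh (ev g A) S)"
  proof (rule fillable_step[where A = "weigh g A"])
    show "fillable (weigh (0, 0) P @ weigh g A @ weigh (ev g A) S)"
      using der by (simp add: derivable_def weigh_append g)
    show "end_weight (weigh (0, 0) P) + i + 1 \<le> snd (snd (weigh g B ! i))" if "i < length (weigh g B) - 1" for i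
      using incr[of "Suc i"] that by (simp add: nth_weigh end_weight_weigh g)
    have "end_weight (weigh (0, 0) P @ weigh g A) = nf_length (ev g A)"
      using end_weight_weigh[of "P @ A"] by (simp add: weigh_append g)
    thus "end_weight (weigh (0, 0) P @ weigh g A) \<le> snd (snd (last (weigh g B)))"
      using B by (simp add: last_weigh eq)
    show "end_weight (weigh (0, 0) P) + K \<le> fst (snd b)" if "b \<in> set (weigh g B)" for b
      using that ge by (auto simp: in_set_conv_nth nth_weigh end_weight_weigh g le_max_iff_disj)
    show "fst (snd x) \<le> fst (snd (last (weigh g B)))" if "x \<in> set (weigh g A)" for x
      unfolding m using that sweep by (auto simp: in_set_conv_nth nth_weigh)
    show "real (fst (snd (last (weigh g B)))) \<le> Lim (ev (0, 0) (map fst (weigh (0, 0) P @ take i (weigh g B))))"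
      if "i \<le> length (weigh g B)" for i
      unfolding m using lim[of "take i B"] that size by (simp add: g take_map[symmetric])
    show "real (fst (snd (last (weigh g B)))) \<le> Lim (ev (0, 0) (map fst (weigh (0, 0) P @ take i (weigh g A))))"
      if "i \<le> length (weigh g A)" for i
      unfolding m using lim[of "take i A"] that size by (simp add: g take_map[symmetric])
  qed (use B rel in auto)
  thus ?thesis
    by (simp add: derivable_def weigh_append eq flip: g)
qed

text \<open>A spike \<open>x x\<^sup>-\<^sup>1\<close> is replaced by a disc made of two mirror-image 2-cells; the interior of
  the disc does not follow the normal forms but stays within a bounded distance of them.\<close>

lemma derivable_spike:
  assumes der: "derivable (P @ S)" and g: "g = ev (0, 0) P" and incr: "nf_length g < nf_length (act x g)"
  shows "derivable (P @ [x, inv_letter x] @ S)"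
proof -
  obtain s where s: "x # s \<in> R" "s \<noteq> []"
    using relator_starting_with by blast
  have s': "[inv_letter x] @ inv_word s \<in> R"
  proof -
    have "inv_word (x # s) \<in> R"
      using s(1) unfolding R_def by (rule symmetrization.inversion)
    thus ?thesis
      using rotate_relator[of "inv_word s" "[inv_letter x]"] by (simp add: inv_word_def)
  qed
  have size: "length s + 1 < K"
    using length_relator[OF s(1)] by simp
  define n where "n = nf_length g"
  define n' where "n' = nf_length (act x g)"
  define l where "l = length s"
  define e where "e = (x, n' + K, n')"
  \<comment> \<open>After \<open>x\<close> and \<open>i + 1\<close> letters of \<open>s\<close> the
    distance has grown by at most \<open>i + 2\<close>; the last letter returns to the vertex where
    the cell is attached, of weight \<open>n\<close>.\<close>
  define W where "W = map (\<lambda>i. (s ! i, n + K, if Suc i = l then n else n + i + 2)) [0..<l]"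
  have W: "length W = l" "map fst W = s" "W \<noteq> []" "last W = (last s, n + K, n)"
    "\<And>b. b \<in> set W \<Longrightarrow> fst (snd b) = n + K"
    using s(2) by (auto simp: W_def l_def last_conv_nth intro: nth_equalityI)
  have gs: "ev g (x # s) = g"
    using fold_relator[OF s(1)] by (simp add: ev_def)
  have lim: "real (n + 2 * K) \<le> Lim (ev g v)" "real (n' + 2 * K) \<le> Lim (ev g v)" if "length v \<le> K" for v
    using nf_length_Lim_face[of "[]" v P] nf_length_Lim_face[of "[x]" v P] that size g
    by (simp_all add: n_def n'_def)
  have endP: "end_weight (weigh (0, 0) P) = n"
    by (simp add: end_weight_weigh n_def g)
  \<comment> \<open>The first cell hangs from the vertex labelled \<open>g\<close>: its
    \<open>A\<close> is empty, and its boundary reads \<open>x # s\<close>.\<close>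
  have "fillable (weigh (0, 0) P @ (e # W) @ weigh g S)"
  proof (rule fillable_step[where A = "[]"])
    show "fillable (weigh (0, 0) P @ [] @ weigh g S)"
      using der by (simp add: derivable_def weigh_append g)
    show "map fst (e # W) @ inv_word (map fst []) \<in> R"
      using s W by (simp add: e_def inv_word_def)
    show "end_weight (weigh (0, 0) P) + i + 1 \<le> snd (snd ((e # W) ! i))" if "i < length (e # W) - 1" for i
      using that incr W(1) by (cases i) (auto simp: endP e_def W_def n_def n'_def)
    show "real (fst (snd (last (e # W)))) \<le> Lim (ev (0, 0) (map fst (weigh (0, 0) P @ take i (e # W))))"
      if "i \<le> length (e # W)" for i
    proof -
      have "map fst (take i (e # W)) = take i (x # s)"
        using W(2) by (cases i) (auto simp: e_def simp flip: take_map)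
      moreover have "length (take i (x # s)) \<le> K"
        using size by (simp add: min.coboundedI1)
      ultimately show ?thesis
        using lim(1)[of "take i (x # s)"] W by (simp add: g)
    qed
    show "real (fst (snd (last (e # W)))) \<le> Lim (ev (0, 0) (map fst (weigh (0, 0) P @ take i [])))" for i
      using lim(1)[of "[]"] W by (simp add: g)
    show "end_weight (weigh (0, 0) P) + K \<le> fst (snd b)" if "b \<in> set (e # W)" for b
      using that W(5)[of b] incr by (auto simp: endP e_def n_def n'_def)
  qed (use W endP in auto)
  hence "fillable ((weigh (0, 0) P @ [e]) @ W @ weigh g S)"
    by simp
  \<comment> \<open>The second cell covers all of \<open>s\<close> and leaves a single edge,
    labelled by the inverse of \<open>x\<close>, in its place.\<close>
  hence "fillable ((weigh (0, 0) P @ [e]) @ [(inv_letter x, n' + K, n)] @ weigh g S)"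
  proof (rule fillable_step)
    show "map fst [(inv_letter x, n' + K, n)] @ inv_word (map fst W) \<in> R"
      using s' W by simp
    show "fst (snd w) \<le> fst (snd (last [(inv_letter x, n' + K, n)]))" if "w \<in> set W" for w
      using W(5)[OF that] incr by (simp add: n_def n'_def)
    show "real (fst (snd (last [(inv_letter x, n' + K, n)]))) \<le>
        Lim (ev (0, 0) (map fst ((weigh (0, 0) P @ [e]) @ take i [(inv_letter x, n' + K, n)])))"
      if "i \<le> length [(inv_letter x, n' + K, n)]" for i
      using lim(2)[of "x # take i [inv_letter x]"] that size by (cases i) (auto simp: g e_def)
    show "real (fst (snd (last [(inv_letter x, n' + K, n)]))) \<le>
        Lim (ev (0, 0) (map fst ((weigh (0, 0) P @ [e]) @ take i W)))" if "i \<le> length W" for i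
    proof -
      have "map fst (take i W) = take i s"
        using W(2) by (metis take_map)
      moreover have "length (x # take i s) \<le> K"
        using size by (simp add: min.coboundedI1)
      ultimately show ?thesis
        using lim(2)[of "x # take i s"] by (simp add: g e_def)
    qed
    show "end_weight ((weigh (0, 0) P @ [e]) @ W) \<le> snd (snd (last [(inv_letter x, n' + K, n)]))"
      using W(3,4) by (simp add: end_weight_def)
  qed (use W in \<open>auto simp: e_def\<close>)
  moreover have "weigh (0, 0) (P @ [x, inv_letter x] @ S)
      = (weigh (0, 0) P @ [e]) @ [(inv_letter x, n' + K, n)] @ weigh g S"
    using incr by (simp add: weigh_append e_def n_def n'_def g act_inv max_def)
  ultimately show ?thesis
    by (simp add: derivable_def)
qed

section \<open>Carrying letters through a normal form by strips of 2-cells\<close>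

abbreviation "Ts i \<equiv> replicate i \<T>"
abbreviation "ts j \<equiv> replicate j \<t>"
abbreviation "as b n \<equiv> replicate n (Gen_a, b)"

lemma ev_prefix: "ev (0, 0) (Ts i @ apow k @ ts l) = val (i, k, l)"
  "ev (0, 0) (Ts i @ apow k) = val (i, k, 0)"
  "ev (0, 0) (Ts i @ as b r) = val (i, sg b * int r, 0)"
  by (simp_all add: ev_Ts ev_apow ev_val)

lemma normal_row:
  assumes "normal (i, k, j)" "l \<le> j" "0 < j"
  shows "normal (i, k + x * int p ^ l, l)"
proof (cases "l = 0")
  case False
  hence "int p dvd k + x * int p ^ l \<longleftrightarrow> int p dvd k"
    by (intro dvd_add_left_iff) (simp add: dvd_power dvd_mult)
  thus ?thesis using assms by auto
qed simp

text \<open>Convexity of the absolute value: along a row of equal letters a, the exponent is largest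
  at an end of the row.\<close>

lemma abs_between:
  fixes q d :: int
  assumes "0 \<le> r" "r \<le> n" "\<bar>s\<bar> = 1" "0 \<le> d"
  shows "\<bar>q + s * r * d\<bar> \<le> max \<bar>q\<bar> \<bar>q + s * n * d\<bar>"
proof -
  have "0 \<le> r * d" "r * d \<le> n * d"
    using assms by (auto intro: mult_right_mono)
  moreover have "s = 1 \<or> s = -1"
    using assms by linarith
  ultimately show ?thesis by auto
qed

text \<open>The relation t a = a^p t, one cell for each letter, from the right end of the row to the
  left. As \<open>l < j\<close>, the rows at levels \<open>l\<close> and \<open>l + 1\<close>
  consist of normal forms. Lengths on the lower side of a cell are convex, so its two ends decide,
  and these are one shorter than the ends of the new edge above them.\<close>

lemma strip_up:
  assumes nrm: "normal (i, k, j)" and l: "l < j"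
    and der: "derivable (Ts i @ apow k @ ts l @ as b (p * M) @ [\<t>] @ S)"
  shows "derivable (Ts i @ apow k @ ts l @ [\<t>] @ as b M @ S)"
  using der
proof (induction M arbitrary: S)
  case (Suc M)
  define q where "q = k + sg b * int (p * M) * int p ^ l"
  let ?P = "Ts i @ apow k @ ts l @ as b (p * M)"
  have split: "as b (p * Suc M) = as b (p * M) @ as b p"
    by (simp add: replicate_add[symmetric] add.commute)
  have g: "ev (0, 0) ?P = val (i, q, l)"
    using ev_prefix(1)[of i k l] by (simp add: ev_val q_def)
  let ?g = "val (i, q, l)"
  have N1: "normal (i, q + sg b * int r * int p ^ l, l)" for r
    using normal_row[OF nrm, of l "sg b * int (p * M) + sg b * int r"] l
    by (simp add: q_def algebra_simps)
  have N2: "normal (i, q + x * int p ^ Suc l, Suc l)" for x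
    using normal_row[OF nrm, of "Suc l" "sg b * int M + x"] l
    by (simp add: q_def algebra_simps)
  have L1: "nf_length (val (i, q + sg b * int r * int p ^ l, l)) = i + nat \<bar>q + sg b * int r * int p ^ l\<bar> + l" for r
    by (rule nf_length_val[OF N1])
  have L2: "nf_length (val (i, q + x * int p ^ Suc l, Suc l)) = i + nat \<bar>q + x * int p ^ Suc l\<bar> + Suc l" for x
    by (rule nf_length_val[OF N2])
  have "derivable (?P @ (as b p @ [\<t>]) @ S)"
    using Suc.prems by (simp only: split append_assoc)
  hence "derivable (?P @ [\<t>, (Gen_a, b)] @ S)"
  proof (rule derivable_face[OF _ _ _ g[symmetric]])
    show "[\<t>, (Gen_a, b)] @ inv_word (as b p @ [\<t>]) \<in> R"
      using relator[of b] by (simp add: inv_word_def)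
    show "nf_length ?g + c \<le> nf_length (ev ?g (take c [\<t>, (Gen_a, b)]))"
      if "0 < c" "c < length [\<t>, (Gen_a, b)]" for c
      using that L1[of 0] L2[of 0] by (auto simp: less_Suc_eq act_val)
    show "nf_length (ev ?g (take c (as b p @ [\<t>]))) \<le>
      max (nf_length (ev ?g (butlast [\<t>, (Gen_a, b)]))) (nf_length (ev ?g [\<t>, (Gen_a, b)]))"
      if "c \<le> length (as b p @ [\<t>])" for c
    proof -
      have m: "max (nf_length (ev ?g (butlast [\<t>, (Gen_a, b)]))) (nf_length (ev ?g [\<t>, (Gen_a, b)]))
          = max (i + nat \<bar>q\<bar> + Suc l) (i + nat \<bar>q + sg b * int p ^ Suc l\<bar> + Suc l)"
        using L2[of 0] L2[of "sg b"] by (simp add: act_val)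
      show ?thesis
      proof (cases "c \<le> p")
        case True
        have "\<bar>q + sg b * int c * int p ^ l\<bar> \<le> max \<bar>q\<bar> \<bar>q + sg b * int p * int p ^ l\<bar>"
          using True by (intro abs_between) auto
        hence disj: "nat \<bar>q + sg b * int c * int p ^ l\<bar> \<le> nat \<bar>q\<bar> \<or>
            nat \<bar>q + sg b * int c * int p ^ l\<bar> \<le> nat \<bar>q + sg b * int p * int p ^ l\<bar>"
          unfolding le_max_iff_disj using nat_mono by blast
        have "take c (as b p @ [\<t>]) = as b c"
          using True by (simp add: min_absorb1)
        hence v: "nf_length (ev ?g (take c (as b p @ [\<t>])))
            = i + nat \<bar>q + sg b * int c * int p ^ l\<bar> + l"
          using L1[of c] by (simp only: ev_val)
        have q2: "sg b * int p ^ Suc l = sg b * int p * int p ^ l"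
          by simp
        show ?thesis
          unfolding m v q2 le_max_iff_disj using disj by linarith
      next
        case False
        hence "take c (as b p @ [\<t>]) = as b p @ [\<t>]" using that by simp
        thus ?thesis
          unfolding m using L2[of "sg b"] by (simp add: ev_val act_val mult.assoc)
      qed
    qed
  qed simp
  hence "derivable (Ts i @ apow k @ ts l @ as b (p * M) @ [\<t>] @ ((Gen_a, b) # S))"
    by simp
  from Suc.IH[OF this] show ?case
    by (simp add: replicate_app_Cons_same)
qed simp

text \<open>t^j a = a^(p^j) t^j, by strips one above the other; each has \<open>p\<close> times
  fewer letters on its upper side than on its lower side.\<close>

lemma tower:
  assumes "normal (i, k, j)" "derivable (Ts i @ apow k @ as b (p ^ j) @ ts j @ S)"
  shows "derivable (Ts i @ apow k @ ts j @ [(Gen_a, b)] @ S)"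
proof -
  have "derivable (Ts i @ apow k @ ts l @ as b (p ^ (j - l)) @ ts (j - l) @ S)" if "l \<le> j" for l
    using that
  proof (induction l)
    case 0
    thus ?case using assms(2) by simp
  next
    case (Suc l)
    have "j - l = Suc (j - Suc l)" using Suc.prems by simp
    hence "derivable (Ts i @ apow k @ ts l @ as b (p * p ^ (j - Suc l)) @ [\<t>] @ ts (j - Suc l) @ S)"
      using Suc by simp
    from strip_up[OF assms(1) _ this] Suc.prems show ?case
      by (simp add: replicate_app_Cons_same)
  qed
  from this[of j] show ?thesis by simp
qed

text \<open>Either the letter prolongs the power of a, and nothing is glued, or it cancels the last
  letter of that power, and a spike is glued.\<close>

lemma insert_a:
  assumes "derivable (Ts i @ apow (k + sg b) @ S)"
  shows "derivable (Ts i @ apow k @ [(Gen_a, b)] @ S)"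
proof (cases "sg b * k \<ge> 0")
  case True
  hence "nat \<bar>k + sg b\<bar> = Suc (nat \<bar>k\<bar>)" "(k + sg b \<ge> 0) = b" "k = 0 \<or> (k \<ge> 0) = b"
    by (cases b; auto simp: sg_def)+
  hence "apow (k + sg b) = apow k @ [(Gen_a, b)]"
    by (auto simp: apow_def replicate_append_same)
  thus ?thesis using assms by simp
next
  case False
  have eq: "apow k = apow (k + sg b) @ [(Gen_a, \<not> b)]"
  proof -
    have "nat \<bar>k\<bar> = Suc (nat \<bar>k + sg b\<bar>)" "(k \<ge> 0) = (\<not> b)" "k + sg b = 0 \<or> (k + sg b \<ge> 0) = (\<not> b)"
      using False by (cases b; auto simp: sg_def)+
    thus ?thesis
      by (auto simp: apow_def replicate_append_same)
  qed
  have "derivable ((Ts i @ apow (k + sg b)) @ [(Gen_a, \<not> b), inv_letter (Gen_a, \<not> b)] @ S)"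
  proof (rule derivable_spike[OF _ ev_prefix(2)[symmetric]])
    have "sg (\<not> b) = - sg b" by (simp add: sg_def)
    hence "act (Gen_a, \<not> b) (val (i, k + sg b, 0)) = val (i, k, 0)" by (simp add: act_val)
    moreover have "\<bar>k + sg b\<bar> < \<bar>k\<bar>" using False by (cases b) (auto simp: sg_def)
    ultimately show "nf_length (val (i, k + sg b, 0)) < nf_length (act (Gen_a, \<not> b) (val (i, k + sg b, 0)))"
      by (simp add: nf_length_val)
  qed (use assms in simp)
  thus ?thesis by (simp add: eq)
qed

lemma insert_as:
  assumes "derivable (Ts i @ apow (k + sg b * int n) @ S)"
  shows "derivable (Ts i @ apow k @ as b n @ S)"
  using assms
proof (induction n arbitrary: k)
  case (Suc n)
  have "derivable (Ts i @ apow ((k + sg b) + sg b * int n) @ S)"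
    using Suc.prems by (simp add: algebra_simps)
  from insert_a[OF Suc.IH[OF this]] show ?case
    by simp
qed simp

text \<open>Here t leads to the shorter normal form t^-i a^r, so the cells are attached the other
  way round, with a^p t as the new side. All exponents have the same sign, so lengths increase along
  a^p, and the last edge starts at the longest form.\<close>

lemma strip_t:
  assumes "derivable (Ts (Suc i) @ as b (p * r) @ [\<t>] @ as b M @ S)"
  shows "derivable (Ts (Suc i) @ as b (p * (r + M)) @ [\<t>] @ S)"
  using assms
proof (induction M arbitrary: r)
  case (Suc M)
  let ?P = "Ts (Suc i) @ as b (p * r)"
  define q where "q = sg b * int (p * r)"
  have q: "q = int p * (sg b * int r)" by (simp add: q_def)
  let ?g = "val (Suc i, q, 0)"
  have g: "ev (0, 0) ?P = ?g"
    unfolding q_def by (rule ev_prefix(3))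
  have len: "nat \<bar>sg b * int n\<bar> = n" for n
    by (simp add: abs_mult)
  have E: "ev ?g (as b c) = val (Suc i, sg b * int (p * r + c), 0)" for c
    by (simp add: ev_val q_def algebra_simps)
  have Et: "act \<t> ?g = val (i, sg b * int r, 0)"
    unfolding q by (rule act_val(5))
  have Eta: "act (Gen_a, b) (val (i, sg b * int r, 0)) = val (i, sg b * int (Suc r), 0)"
    by (simp add: act_val algebra_simps)
  have L: "nf_length (val (i', sg b * int n, 0)) = i' + n" for i' n
    using nf_length_val[of i' "sg b * int n" 0] len by simp
  have LE: "nf_length (ev ?g (as b c)) = Suc i + (p * r + c)" for c
    unfolding E L ..
  have Lq: "nf_length ?g = Suc i + p * r"
    unfolding q_def L ..
  have "derivable (?P @ [\<t>, (Gen_a, b)] @ as b M @ S)"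
    using Suc.prems by simp
  hence "derivable (?P @ (as b p @ [\<t>]) @ as b M @ S)"
  proof (rule derivable_face[OF _ _ _ g[symmetric]])
    show "(as b p @ [\<t>]) @ inv_word [\<t>, (Gen_a, b)] \<in> R"
      using rotate_relator[OF relator[of "\<not> b"]] by (simp add: inv_word_def)
    show "nf_length ?g + c \<le> nf_length (ev ?g (take c (as b p @ [\<t>])))"
      if "0 < c" "c < length (as b p @ [\<t>])" for c
    proof -
      have "take c (as b p @ [\<t>]) = as b c" using that by simp
      thus ?thesis using LE[of c] Lq by (simp del: take_append)
    qed
    show "nf_length (ev ?g (take c [\<t>, (Gen_a, b)])) \<le>
      max (nf_length (ev ?g (butlast (as b p @ [\<t>])))) (nf_length (ev ?g (as b p @ [\<t>])))"
      if "c \<le> length [\<t>, (Gen_a, b)]" for c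
    proof -
      have last: "nf_length (ev ?g (butlast (as b p @ [\<t>]))) = Suc i + (p * r + p)"
        using LE[of p] by simp
      have rp: "r \<le> p * r" using p_pos by simp
      have "take c [\<t>, (Gen_a, b)] \<in> {[], [\<t>], [\<t>, (Gen_a, b)]}"
        using that by (auto simp: le_Suc_eq)
      moreover have vals: "nf_length (ev ?g [\<t>]) = i + r"
        "nf_length (ev ?g [\<t>, (Gen_a, b)]) = i + Suc r"
        unfolding ev_simps Et Eta L by simp_all
      have val0: "nf_length (ev ?g []) = Suc i + p * r"
        using Lq by simp
      have "\<forall>X\<in>{[], [\<t>], [\<t>, (Gen_a, b)]}. nf_length (ev ?g X) \<le> Suc i + (p * r + p)"
        using rp p_pos(2) vals val0 by (intro ballI; elim insertE emptyE; hypsubst; linarith)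
      ultimately have "nf_length (ev ?g (take c [\<t>, (Gen_a, b)])) \<le> Suc i + (p * r + p)"
        by blast
      thus ?thesis
        unfolding last by (rule order_trans) (rule max.cobounded1)
    qed
  qed simp
  moreover have "as b (p * r) @ as b p = as b (p * Suc r)"
    by (simp add: replicate_add[symmetric] add.commute)
  ultimately have "derivable (Ts (Suc i) @ as b (p * Suc r) @ [\<t>] @ as b M @ S)"
    by (metis append_assoc)
  from Suc.IH[OF this] show ?case by simp
qed simp

text \<open>The relation a t^-1 = t^-1 a^p. Exponents move away from 0, so the last edge of the new
  side, t^-1, ends at the longest normal form of the cell.\<close>

lemma strip_T:
  assumes "derivable (Ts i @ as b r @ [\<T>] @ as b (p * M) @ S)"
  shows "derivable (Ts i @ as b (r + M) @ [\<T>] @ S)"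
  using assms
proof (induction M arbitrary: r)
  case (Suc M)
  let ?P = "Ts i @ as b r"
  let ?g = "val (i, sg b * int r, 0)"
  have g: "ev (0, 0) ?P = ?g"
    by (rule ev_prefix(3))
  have len: "nat \<bar>sg b * int n\<bar> = n" for n
    by (simp add: abs_mult)
  have L: "nf_length (val (i', sg b * int n, 0)) = i' + n" for i' n
    using nf_length_val[of i' "sg b * int n" 0] len by simp
  have ET: "act \<T> (val (i, sg b * int n, 0)) = val (Suc i, sg b * int (p * n), 0)" for n
    by (simp add: act_val mult.left_commute)
  have E: "ev (val (i', sg b * int n, 0)) (as b c) = val (i', sg b * int (n + c), 0)" for i' n c
    by (simp add: ev_val algebra_simps)
  have Ea: "act (Gen_a, b) ?g = val (i, sg b * int (Suc r), 0)"
    by (simp add: act_val algebra_simps)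
  have La: "nf_length (act (Gen_a, b) ?g) = i + Suc r"
    unfolding Ea L ..
  have "as b (p * Suc M) = as b p @ as b (p * M)"
    by (simp add: replicate_add)
  hence "derivable (?P @ ([\<T>] @ as b p) @ as b (p * M) @ S)"
    using Suc.prems by simp
  hence "derivable (?P @ [(Gen_a, b), \<T>] @ as b (p * M) @ S)"
  proof (rule derivable_face[OF _ _ _ g[symmetric]])
    show "[(Gen_a, b), \<T>] @ inv_word ([\<T>] @ as b p) \<in> R"
      using rotate_relator[of "[\<t>]" "[(Gen_a, b), \<T>] @ as (\<not> b) p"] relator[of b]
      by (simp add: inv_word_def)
    show "nf_length ?g + c \<le> nf_length (ev ?g (take c [(Gen_a, b), \<T>]))"
      if "0 < c" "c < length [(Gen_a, b), \<T>]" for c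
    proof -
      have "c = 1" using that by simp
      thus ?thesis using La L[of i r] by simp
    qed
    show "nf_length (ev ?g (take c ([\<T>] @ as b p))) \<le>
      max (nf_length (ev ?g (butlast [(Gen_a, b), \<T>])))
        (nf_length (ev ?g [(Gen_a, b), \<T>]))"
      if "c \<le> length ([\<T>] @ as b p)" for c
    proof -
      have "ev ?g [(Gen_a, b), \<T>] = val (Suc i, sg b * int (p * Suc r), 0)"
        using Ea ET[of "Suc r"] by simp
      hence m: "nf_length (ev ?g [(Gen_a, b), \<T>]) = Suc i + (p * r + p)"
        by (simp only: L) simp
      show ?thesis
      proof (cases c)
        case 0
        have "r \<le> p * r" using p_pos by simp
        hence "r \<le> Suc (p * r + p)" by linarith
        thus ?thesis using m L[of i r] 0 by (simp add: le_max_iff_disj)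
      next
        case (Suc c')
        hence "take c ([\<T>] @ as b p) = \<T> # as b c'" using that by simp
        hence "nf_length (ev ?g (take c ([\<T>] @ as b p))) = Suc i + (p * r + c')"
          by (simp only: ev_simps ET E L)
        thus ?thesis using m Suc that by simp
      qed
    qed
  qed simp
  hence "derivable (Ts i @ as b (Suc r) @ [\<T>] @ as b (p * M) @ S)"
    by (simp add: replicate_app_Cons_same)
  from Suc.IH[OF this] show ?case by simp
qed simp

lemma apow_as: "apow k = as (k \<ge> 0) (nat \<bar>k\<bar>)" "k = sg (k \<ge> 0) * int (nat \<bar>k\<bar>)"
  by (auto simp: apow_def sg_def)

lemma derivable_step:
  assumes nrm: "normal n" and der: "derivable (wd (step x n) @ S)"
  shows "derivable (wd n @ [x] @ S)"
proof -
  obtain i k j where n: "n = (i, k, j)" by (metis prod.exhaust)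
  have pk: "apow (int p * k) = as (k \<ge> 0) (p * nat \<bar>k\<bar>)" for k
    using apow_sg[of "k \<ge> 0" "p * nat \<bar>k\<bar>"] apow_as(2)[of k] by (metis mult.left_commute of_nat_mult)
  consider b where "x = (Gen_a, b)" | "x = \<t>" | "x = \<T>"
    by (cases x; cases "fst x"; cases "snd x") auto
  thus ?thesis
  proof cases
    case 1
    \<comment> \<open>Behind t^j a letter a is worth p^j such letters in front of it: insert those
      next to a^k, then carry them through t^j.\<close>
    have "derivable (Ts i @ apow (k + sg b * int (p ^ j)) @ ts j @ S)"
      using der by (simp add: n 1)
    from tower[OF _ insert_as[OF this]] show ?thesis
      using nrm by (simp add: n 1)
  next
    case 2
    show ?thesis
    proof (cases "j = 0 \<and> i > 0 \<and> int p dvd k")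
      case True
      then obtain i' k' where ik: "i = Suc i'" "k = int p * k'" by (metis dvdE gr0_implies_Suc)
      \<comment> \<open>The pinch is undone: a spike t^-1 t is put in front of a^k', and its t is
        then carried behind a^k', which becomes a^(p k').\<close>
      have "derivable (Ts i' @ apow k' @ S)"
        using der True p_pos by (simp add: n 2 ik)
      moreover have "nf_length (val (i', 0, 0)) < nf_length (act \<T> (val (i', 0, 0)))"
        by (simp add: act_val nf_length_val)
      ultimately have "derivable (Ts i' @ [\<T>, inv_letter \<T>] @ apow k' @ S)"
        by (intro derivable_spike[OF _ ev_Ts[symmetric]])
      hence "derivable (Ts (Suc i') @ as (k' \<ge> 0) (p * 0) @ [\<t>] @ as (k' \<ge> 0) (nat \<bar>k'\<bar>) @ S)"
        using apow_as(1)[of k'] by (simp add: replicate_app_Cons_same)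
      from strip_t[OF this] show ?thesis
        using True by (simp add: n 2 ik pk)
    next
      case False
      thus ?thesis
        using der by (auto simp: n 2 replicate_app_Cons_same)
    qed
  next
    case 3
    show ?thesis
    proof (cases j)
      case 0
      have "derivable (Ts i @ as (k \<ge> 0) 0 @ [\<T>] @ as (k \<ge> 0) (p * nat \<bar>k\<bar>) @ S)"
        using der by (simp add: n 3 0 pk replicate_app_Cons_same)
      from strip_T[OF this] show ?thesis
        by (simp add: n 3 0 apow_as(1)[of k])
    next
      case (Suc j')
      \<comment> \<open>Here the letter shortens the normal form, so it is the second half of a
        spike t t^-1.\<close>
      have nrm': "normal (i, k, j')" using nrm by (auto simp: n Suc)
      have "nf_length (val (i, k, j')) < nf_length (act \<t> (val (i, k, j')))"
        using nf_length_val[OF nrm'] nf_length_val[of i k "Suc j'"] nrm by (simp add: n Suc act_val)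
      hence "derivable (wd (i, k, j') @ [\<t>, inv_letter \<t>] @ S)"
        using der by (intro derivable_spike[OF _ ev_wd[symmetric]]) (simp_all add: n 3 Suc)
      thus ?thesis
        by (simp add: n 3 Suc replicate_app_Cons_same)
    qed
  qed
qed

lemma derivable_nf: "derivable (wd (nf u) @ S) \<Longrightarrow> derivable (u @ S)"
proof (induction u arbitrary: S rule: rev_induct)
  case (snoc x u)
  thus ?case
    using derivable_step[OF normal_nf[of u], of x S] by simp
qed (simp add: apow_def)

lemma pres_eq_ev:
  assumes "pres_eq R u v"
  shows "ev g u = ev g v"
  using assms
proof (induction arbitrary: g)
  case (relator r u v)
  thus ?case using fold_relator[of r] by (simp flip: ev_def)
qed (use act_inv in auto)

text \<open>By uniqueness of normal forms, a word that represents the identity has the normal form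
  of the empty word, from which the gluing starts.\<close>

lemma derivable_trivial_word:
  assumes "pres_eq R w []"
  shows "derivable w"
proof -
  obtain i k j where n: "nf w = (i, k, j)" by (metis prod.exhaust)
  have "val (i, k, j) = val (0, 0, 0)"
    using pres_eq_ev[OF assms, of "(0, 0)"] val_nf[of w] by (simp add: n val_0)
  moreover have "normal (i, k, j)"
    using normal_nf[of w] n by (simp only:)
  moreover have "normal (0, 0, 0)"
    by simp
  ultimately have "nf w = (0, 0, 0)"
    using normal_unique n by metis
  hence "derivable (wd (nf w) @ [])"
    using derivable_Nil by (simp add: apow_def)
  thus ?thesis
    using derivable_nf[of w "[]"] by simp
qed

text \<open>With the summand \<open>2 * K\<close> absorbed into the power, the exponent is at most
  \<open>2 * c + 6 * K + 4\<close>, and the assumption forces \<open>c \<ge> -1\<close>. The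
  coefficient 4 makes the bound an integer power of \<open>p\<close> on
  \<open>quarter_nats\<close>.\<close>

lemma Lim_le:
  assumes "real (length u) \<le> c + 1"
  shows "Lim (ev (0, 0) u) \<le> real p powr (4 * c + real (6 * K + 6))"
proof -
  let ?n = "2 * (length u + 2 * K) + 2"
  have "p ^ (2 * (word_norm (ev (0, 0) u) + 2 * K) + 2) \<le> p ^ ?n"
    using word_norm_le[of u] p_ge by (intro power_increasing) auto
  moreover have "p ^ ?n + 2 * K \<le> p ^ (?n + 2 * K)"
  proof -
    have "1 + 2 * K \<le> p ^ (2 * K)"
      using less_exp[of "2 * K"] power_mono[of 2 p "2 * K"] p_ge by linarith
    hence "p ^ ?n * (1 + 2 * K) \<le> p ^ ?n * p ^ (2 * K)"
      by (rule mult_left_mono) simp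
    moreover have "1 * (2 * K) \<le> p ^ ?n * (2 * K)"
      using p_pos by (intro mult_right_mono) auto
    moreover have "p ^ (?n + 2 * K) = p ^ ?n * p ^ (2 * K)"
      by (rule power_add)
    ultimately show ?thesis
      unfolding distrib_left by linarith
  qed
  ultimately have "p ^ (2 * (word_norm (ev (0, 0) u) + 2 * K) + 2) + 2 * K \<le> p ^ (?n + 2 * K)"
    by linarith
  hence "Lim (ev (0, 0) u) \<le> real (p ^ (?n + 2 * K))"
    unfolding Lim_def by (simp only: of_nat_le_iff)
  also have "\<dots> = real p powr real (?n + 2 * K)"
    using p_pos by (simp only: powr_realpow of_nat_power)
  also have "\<dots> \<le> real p powr (4 * c + real (6 * K + 6))"
    using assms p_ge by (intro powr_mono) auto
  finally show ?thesis .
qed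

theorem intrinsic_tame_filling_BS:
  "intrinsic_tame_filling R (\<lambda>x. real p powr (4 * x + real (6 * K + 6)))"
  unfolding intrinsic_tame_filling_def
proof (intro conjI allI impI)
  let ?f = "\<lambda>x. real p powr (4 * x + real (6 * K + 6))"
  show "?f ` quarter_nats \<subseteq> quarter_nats"
  proof
    fix y assume "y \<in> ?f ` quarter_nats"
    then obtain m :: nat where "y = real p powr (4 * (real m / 4) + real (6 * K + 6))"
      by (auto simp: quarter_nats_def)
    also have "\<dots> = real p powr real (m + (6 * K + 6))"
      by simp
    also have "\<dots> = real (4 * p ^ (m + (6 * K + 6))) / 4"
      using p_pos by (simp only: powr_realpow) simp
    finally show "y \<in> quarter_nats"
      unfolding quarter_nats_def by blast
  qed
  show "mono_on quarter_nats ?f"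
    using p_ge by (intro mono_onI powr_mono) auto
  fix w assume "pres_eq R w []"
  hence "fillable (weigh (0, 0) w)"
    using derivable_trivial_word by (simp add: derivable_def)
  from fillable_imp_tame_diagram[OF this] obtain D \<Psi> where
    "van_kampen_diagram R w D" "van_kampen_homotopy D \<Psi>"
    "\<forall>q\<in>bdry D. \<forall>s t. 0 \<le> s \<and> s < t \<and> t \<le> 1 \<longrightarrow>
      (\<exists>u. length u \<le> coarse_dist D (\<Psi> (q, t)) + 1 \<and> coarse_dist D (\<Psi> (q, s)) \<le> Lim (ev (0, 0) u))"
    by auto
  thus "\<exists>D \<Psi>. van_kampen_diagram R w D \<and> van_kampen_homotopy D \<Psi> \<and>
     (\<forall>q\<in>bdry D. \<forall>s t. 0 \<le> s \<and> s < t \<and> t \<le> 1 \<longrightarrow>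
        coarse_dist D (\<Psi> (q, s)) \<le> ?f (coarse_dist D (\<Psi> (q, t))))"
    using Lim_le order_trans by meson
qed

end

lemma lipschitz_equivalent_powr:
  assumes "b \<ge> 1"
  shows "lipschitz_equivalent (\<lambda>x. b powr (4 * x + real c)) (\<lambda>x. b powr x)"
  unfolding lipschitz_equivalent_def
\<comment> \<open>\<open>c + 4\<close> dominates both coefficients of \<open>4 * x + c\<close>, and
  in the other direction any rescaling by it is generous.\<close>
proof (intro exI[of _ "c + 4"] ballI conjI)
  fix x assume "x \<in> quarter_nats"
  hence x: "x \<ge> 0" by (auto simp: quarter_nats_def)
  have cx: "0 \<le> real c * x" using x by simp
  have ge: "y \<le> real (c + 4) * y + real (c + 4)" if "y \<ge> 0" for y :: real
    using that by (simp add: algebra_simps add_increasing)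
  have "b powr (4 * x + real c) \<le> b powr (real (c + 4) * x + real (c + 4))"
    using assms x cx by (intro powr_mono) (auto simp: algebra_simps)
  also note ge[OF powr_ge_zero]
  finally show "b powr (4 * x + real c) \<le> real (c + 4) * b powr (real (c + 4) * x + real (c + 4)) + real (c + 4)" .
  have "b powr x \<le> b powr (4 * (real (c + 4) * x + real (c + 4)) + real c)"
    using assms x cx by (intro powr_mono) (auto simp: algebra_simps)
  also note ge[OF powr_ge_zero]
  finally show "b powr x \<le> real (c + 4) * b powr (4 * (real (c + 4) * x + real (c + 4)) + real c) + real (c + 4)" .
qed

theorem mainTheorem14:
  fixes p :: nat
  assumes "p \<ge> 3"
  shows "\<exists>f :: real \<Rightarrow> real.
           intrinsic_tame_filling (symmetrization (BS_relators p)) f \<and>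
           lipschitz_equivalent f (\<lambda>n. real p powr n)"
proof -
  interpret baumslag_solitar p
    using assms by unfold_locales simp
  have "real p \<ge> 1"
    using assms by simp
  thus ?thesis
    using intrinsic_tame_filling_BS[unfolded R_def] lipschitz_equivalent_powr by blast
qed

end
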